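(* Let $q\in\mathbb{C}$, $|q|=1$, let $(T_1,T_2)$ be a pair of $q$-commuting contractions on a Hilbert space $\mathcal{H}$, $T=T_1T_2$, and let $(W_1,W_2)$ on $\mathcal{Q}_{T^*}$ be the canonical $q$-commuting pair of unitaries for $(T_1,T_2)$. (Forward direction.) Let $(\mathcal{F}_*;\Lambda_*,P_*,U_* )$ be a special Andô tuple for $(T_1^*,T_2^* )$. On $H^2(\mathcal{F}_* )\oplus\mathcal{Q}_{T^*}$ consider $$(V_1^D,V_2^D)=\left(\begin{bmatrix}M_{U_*^*(P_*^\perp+zP_* )}R_q&0\\0&W_1\end{bmatrix},\ \begin{bmatrix}R_{\overline{q}}M_{(P_*+zP_*^\perp)U_*}&0\\0&W_2\end{bmatrix}\right)\qquad(\ast)$$ and let $\Pi^D:\mathcal{H}\to H^2(\mathcal{F}_* )\oplus\mathcal{Q}_{T^*}$ be $$\Pi^Dh=\begin{bmatrix}\sum_{n=0}^\infty z^n\Lambda_*D_{T^*}T^{*n}h\\ Q_{T^*}h\end{bmatrix}.\qquad(\ast\ast)$$ Then $\Pi^D$ is an isometry and $(\Pi^D;V_1^D,V_2^D)$ is a $q$-commuting isometric lift of $(T_1,T_2)$. (Converse direction.) If $(\mathbf{V}_1,\mathbf{V}_2)$ acting on $\boldsymbol{\mathcal{K}}$ is any minimal $q$-commuting isometric lift of $(T_1,T_2)$ via an isometric embedding $\boldsymbol{\Pi}:\mathcal{H}\to\boldsymbol{\mathcal{K}}$, then there is an Andô tuple $(\mathcal{F}_*;\Lambda_*,P_*,U_*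 )$ for $(T_1^*,T_2^* )$ such that $(\mathbf{V}_1,\mathbf{V}_2)$ is unitarily equivalent to the pair of the form $(\ast)$ formed with this tuple, and under this unitary equivalence the embedding $\boldsymbol{\Pi}$ becomes the map of the form $(\ast\ast)$ formed with this tuple.
   Context: A pair $(A_1,A_2)$ is $q$-commuting if $A_1A_2=qA_2A_1$. For a contraction $A$, $D_A=(I-A^*A)^{1/2}$, $\mathcal{D}_A=\overline{\operatorname{Ran}D_A}$. If $(T_1,T_2)$ is $q$-commuting then so is $(T_1^*,T_2^* )$; and $T=T_1T_2=qT_2T_1$. Special Andô tuple $(\mathcal{F}_*;\Lambda_*,P_*,U_* )$ for $(T_1^*,T_2^* )$: $\mathcal{F}_*=\mathcal{D}_{T_1^*}\oplus\mathcal{D}_{T_2^*}\oplus\mathcal{E}_*$ with $\mathcal{E}_*=\{0\}$ or a copy of $\mathcal{H}$ (added if required for the extension below to exist); $\Lambda_*:\mathcal{D}_{T^*}\to\mathcal{F}_*$ is the isometry $\Lambda_*D_{T^*}h=D_{T_1^*}T_2^*h\oplus D_{T_2^*}h\oplus0$; $U_*$ is a unitary on $\mathcal{F}_*$ extending $D_{T_1^*}T_2^*h\oplus D_{T_2^*}h\oplus0\mapsto D_{T_1^*}h\oplus D_{T_2^*}T_1^*h\oplus0$ ($h\in\mathcal H$); $P_*$ is the orthogonal projection onto $\mathcal{D}_{T_1^*}\oplus\{0\}\oplus\{0\}$. Andô tuple for $(T_1^*,T_2^* )$ (general): a Hilbert space $\mathcal{F}_*$, an isometry $\Lambda_*:\mathcal{D}_{T^*}\to\mathcal{F}_*$,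 an orthogonal projection $P_*$ and a unitary $U_*$ on $\mathcal{F}_*$. $P_*^\perp=I-P_*$. Canonical unitary pair: $Q_{T^*}$ is the positive square root of the strong limit of $T^nT^{*n}$. The map $X^*Q_{T^*}h=Q_{T^*}T^*h$ defines an isometry $X^*$ on $\overline{\operatorname{Ran}Q_{T^*}}$; $W_D^*$ on $\mathcal{Q}_{T^*}\supseteq\overline{\operatorname{Ran}Q_{T^*}}$ is its minimal unitary extension, so $\mathcal{Q}_{T^*}=\bigvee_{n\ge0}W_D^n\overline{\operatorname{Ran}Q_{T^*}}$. The maps $X_i^*Q_{T^*}h=Q_{T^*}T_i^*h$ ($i=1,2$) define a $q$-commuting pair of isometries $(X_1^*,X_2^* )$ on $\overline{\operatorname{Ran}Q_{T^*}}$ with $X_1^*X_2^*=qX^*$, and it extends to a $q$-commuting pair of unitaries $(W_1^*,W_2^* )$ on $\mathcal{Q}_{T^*}$ with $W_1^*W_2^*=qW_D^*$. $(W_1,W_2)$ is the canonical $q$-commuting pair of unitaries for $(T_1,T_2)$. $H^2(\mathcal{F}_* )$ is the $\mathcal{F}_*$-valued Hardy space on the unit disk, $M_\varphi$ multiplication by $\varphi$, $(R_qf)(z)=f(qz)$. $(\Pi;V_1,V_2)$ is a ($q$-commuting) isometric lift of $(T_1,T_2)$ if $(V_1,V_2)$ is a ($q$-commuting) pair of isometries on $\mathcal{K}$ and $\Pi:\mathcal{H}\to\mathcal{K}$ is an isometry with $V_j^*\Pi=\Pi T_j^*$, $j=1,2$; it is minimal if $\mathcal{K}=\bigvee_{n_1,n_2\ge0}V_1^{n_1}V_2^{n_2}\Pi\mathcal{H}$.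 *)

theory Defs
  imports "HOL-Analysis.Analysis"
begin

section \<open>Complex Hilbert spaces\<close>

class scaleC =
  fixes scaleC :: "complex \<Rightarrow> 'a \<Rightarrow> 'a"  (infixr \<open>*\<^sub>C\<close> 75)

text \<open>The complex inner product is linear in its \<^emph>\<open>first\<close> argument.  Norm and topology are
  those of the underlying real inner product space, whose inner product is the real part of the
  complex one.\<close>

class complex_inner = real_inner + scaleC +
  fixes cinner :: "'a \<Rightarrow> 'a \<Rightarrow> complex"
  assumes scaleC_add_right: "a *\<^sub>C (x + y) = a *\<^sub>C x + a *\<^sub>C y"
    and scaleC_add_left: "(a + b) *\<^sub>C x = a *\<^sub>C x + b *\<^sub>C x"
    and scaleC_scaleC [simp]: "a *\<^sub>C (b *\<^sub>C x) = (a * b) *\<^sub>C x"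
    and scaleR_scaleC: "r *\<^sub>R x = complex_of_real r *\<^sub>C x"
    and cinner_commute: "cinner x y = cnj (cinner y x)"
    and cinner_add_left: "cinner (x + y) z = cinner x z + cinner y z"
    and cinner_scaleC_left [simp]: "cinner (a *\<^sub>C x) y = a * cinner x y"
    and inner_eq_Re_cinner: "inner x y = Re (cinner x y)"

class chilbert_space = complex_inner + complete_space
begin
subclass banach ..
end

lemma scaleC_one [simp]: "1 *\<^sub>C x = (x::'a::complex_inner)"
  using scaleR_scaleC[of 1 x] by simp

lemma scaleC_zero_left [simp]: "0 *\<^sub>C x = (0::'a::complex_inner)"
  using scaleC_add_left[of 0 0 x] by simp

lemma scaleC_zero_right [simp]: "a *\<^sub>C 0 = (0::'a::complex_inner)"
  using scaleC_add_right[of a 0 "0::'a"] by simp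

lemma cinner_zero_left [simp]: "cinner 0 (y::'a::complex_inner) = 0"
  using cinner_add_left[of 0 0 y] by simp

lemma cinner_same: "cinner x x = complex_of_real (inner x (x::'a::complex_inner))"
  using cinner_commute[of x x] by (simp add: complex_eq_iff inner_eq_Re_cinner)

lemma cinner_scaleC_right: "cinner x (a *\<^sub>C y) = cnj a * cinner x (y::'a::complex_inner)"
  by (metis cinner_commute cinner_scaleC_left complex_cnj_mult)

lemma norm_scaleC [simp]: "norm (a *\<^sub>C x) = cmod a * norm (x::'a::complex_inner)"
proof -
  have "inner (a *\<^sub>C x) (a *\<^sub>C x) = Re ((a * cnj a) * cinner x x)"
    by (simp only: inner_eq_Re_cinner cinner_scaleC_left cinner_scaleC_right mult_ac)
  also have "\<dots> = (cmod a)\<^sup>2 * inner x x"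
    by (simp only: complex_norm_square[symmetric] cinner_same of_real_mult[symmetric] Re_complex_of_real)
  finally show ?thesis
    by (simp add: norm_eq_sqrt_inner real_sqrt_mult)
qed

lemma cmod_cinner_le: "cmod (cinner x y) \<le> norm x * norm (y::'a::complex_inner)"
proof (cases "cinner x y = 0")
  case False
  define a where "a = cnj (cinner x y) / cmod (cinner x y)"
  have a: "cmod a = 1" using False by (simp add: a_def norm_divide)
  have "cmod (cinner x y) = inner (a *\<^sub>C x) y"
  proof -
    have "a * cinner x y = complex_of_real (cmod (cinner x y))"
      using False complex_norm_square[of "cinner x y"]
      by (simp add: a_def field_simps power2_eq_square)
    then show ?thesis by (simp add: inner_eq_Re_cinner)
  qed
  also have "\<dots> \<le> norm (a *\<^sub>C x) * norm y" by (rule norm_cauchy_schwarz)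
  finally show ?thesis using a by simp
qed simp

instantiation complex :: chilbert_space
begin
definition scaleC_complex :: "complex \<Rightarrow> complex \<Rightarrow> complex"
  where "scaleC_complex = (*)"
definition cinner_complex :: "complex \<Rightarrow> complex \<Rightarrow> complex"
  where "cinner_complex x y = x * cnj y"
instance
  by standard (auto simp: scaleC_complex_def cinner_complex_def algebra_simps scaleR_conv_of_real
      inner_complex_def)
end

instantiation prod :: (complex_inner, complex_inner) complex_inner
begin
definition scaleC_prod :: "complex \<Rightarrow> 'a \<times> 'b \<Rightarrow> 'a \<times> 'b"
  where "scaleC_prod a x = (a *\<^sub>C fst x, a *\<^sub>C snd x)"
definition cinner_prod :: "'a \<times> 'b \<Rightarrow> 'a \<times> 'b \<Rightarrow> complex"
  where "cinner_prod x y = cinner (fst x) (fst y) + cinner (snd x) (snd y)"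
instance
proof
  fix x y :: "'a \<times> 'b"
  show "cinner x y = cnj (cinner y x)"
    unfolding cinner_prod_def complex_cnj_add by (metis cinner_commute)
qed (auto simp: scaleC_prod_def cinner_prod_def scaleC_add_right scaleC_add_left scaleR_prod_def
      scaleR_scaleC cinner_add_left inner_prod_def inner_eq_Re_cinner algebra_simps)
end

instance prod :: (chilbert_space, chilbert_space) chilbert_space ..


section \<open>Operators\<close>

definition closed_csubspace :: "'a::complex_inner set \<Rightarrow> bool" where
  "closed_csubspace S \<longleftrightarrow> closed S \<and> 0 \<in> S \<and> (\<forall>x\<in>S. \<forall>y\<in>S. x + y \<in> S) \<and> (\<forall>c. \<forall>x\<in>S. c *\<^sub>C x \<in> S)"

definition clinear_on :: "'a::complex_inner set \<Rightarrow> ('a \<Rightarrow> 'b::complex_inner) \<Rightarrow> bool" where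
  "clinear_on S A \<longleftrightarrow> (\<forall>x\<in>S. \<forall>y\<in>S. A (x + y) = A x + A y) \<and> (\<forall>c. \<forall>x\<in>S. A (c *\<^sub>C x) = c *\<^sub>C A x)"

text \<open>Hilbert spaces are represented by closed subspaces of a type; the values of an operator
  outside the space it acts on are irrelevant.\<close>

definition isometry_into :: "'a::complex_inner set \<Rightarrow> 'b::complex_inner set \<Rightarrow> ('a \<Rightarrow> 'b) \<Rightarrow> bool" where
  "isometry_into S S' A \<longleftrightarrow> clinear_on S A \<and> A ` S \<subseteq> S' \<and> (\<forall>x\<in>S. norm (A x) = norm x)"

definition unitary_onto :: "'a::complex_inner set \<Rightarrow> 'b::complex_inner set \<Rightarrow> ('a \<Rightarrow> 'b) \<Rightarrow> bool" where
  "unitary_onto S S' A \<longleftrightarrow> isometry_into S S' A \<and> A ` S = S'"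

definition bounded_clinear :: "('a::complex_inner \<Rightarrow> 'b::complex_inner) \<Rightarrow> bool" where
  "bounded_clinear A \<longleftrightarrow> bounded_linear A \<and> clinear_on UNIV A"

definition contraction :: "('a::complex_inner \<Rightarrow> 'b::complex_inner) \<Rightarrow> bool" where
  "contraction A \<longleftrightarrow> bounded_clinear A \<and> onorm A \<le> 1"

text \<open>The Hilbert space adjoint of an operator with domain \<open>S\<close>.\<close>

definition adj_on :: "'a::complex_inner set \<Rightarrow> ('a \<Rightarrow> 'b::complex_inner) \<Rightarrow> 'b \<Rightarrow> 'a" where
  "adj_on S A y = (THE x. x \<in> S \<and> (\<forall>s\<in>S. cinner (A s) y = cinner s x))"

abbreviation cadj :: "('a::complex_inner \<Rightarrow> 'b::complex_inner) \<Rightarrow> 'b \<Rightarrow> 'a" where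
  "cadj \<equiv> adj_on UNIV"

definition orth_projection :: "'a::complex_inner set \<Rightarrow> 'a set \<Rightarrow> ('a \<Rightarrow> 'a) \<Rightarrow> bool" where
  "orth_projection S M P \<longleftrightarrow> closed_csubspace M \<and> M \<subseteq> S \<and>
     (\<forall>x\<in>S. P x \<in> M \<and> (\<forall>m\<in>M. cinner (x - P x) m = 0))"

definition positive_op :: "('a::complex_inner \<Rightarrow> 'a) \<Rightarrow> bool" where
  "positive_op A \<longleftrightarrow> bounded_clinear A \<and> (\<forall>x. cinner (A x) x \<in> \<real> \<and> 0 \<le> Re (cinner (A x) x))"

definition pos_sqrt :: "('a::complex_inner \<Rightarrow> 'a) \<Rightarrow> 'a \<Rightarrow> 'a" where
  "pos_sqrt A = (THE B. positive_op B \<and> B \<circ> B = A)"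

definition defect :: "('a::complex_inner \<Rightarrow> 'b::complex_inner) \<Rightarrow> 'a \<Rightarrow> 'a" where
  "defect A = pos_sqrt (\<lambda>x. x - cadj A (A x))"

definition defect_space :: "('a::complex_inner \<Rightarrow> 'b::complex_inner) \<Rightarrow> 'a set" where
  "defect_space A = closure (range (defect A))"

definition q_commuting_on :: "complex \<Rightarrow> 'a::complex_inner set \<Rightarrow> ('a \<Rightarrow> 'a) \<Rightarrow> ('a \<Rightarrow> 'a) \<Rightarrow> bool" where
  "q_commuting_on q S A B \<longleftrightarrow> (\<forall>x\<in>S. A (B x) = q *\<^sub>C B (A x))"


section \<open>Isometric lifts\<close>

definition q_isometric_lift ::
  "complex \<Rightarrow> ('h::complex_inner \<Rightarrow> 'h) \<Rightarrow> ('h \<Rightarrow> 'h) \<Rightarrow> 'k::complex_inner set \<Rightarrow> ('k \<Rightarrow> 'k) \<Rightarrow> ('k \<Rightarrow> 'k) \<Rightarrow>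
    ('h \<Rightarrow> 'k) \<Rightarrow> bool" where
  "q_isometric_lift q T1 T2 K V1 V2 Emb \<longleftrightarrow>
     closed_csubspace K \<and>
     isometry_into K K V1 \<and> isometry_into K K V2 \<and> q_commuting_on q K V1 V2 \<and>
     isometry_into UNIV K Emb \<and>
     (\<forall>h. adj_on K V1 (Emb h) = Emb (cadj T1 h)) \<and>
     (\<forall>h. adj_on K V2 (Emb h) = Emb (cadj T2 h))"

definition minimal_lift ::
  "'k::complex_inner set \<Rightarrow> ('k \<Rightarrow> 'k) \<Rightarrow> ('k \<Rightarrow> 'k) \<Rightarrow> ('h \<Rightarrow> 'k) \<Rightarrow> bool" where
  "minimal_lift K V1 V2 Emb \<longleftrightarrow>
     K = closed_csubspace hull {(V1 ^^ n1) ((V2 ^^ n2) (Emb h)) | n1 n2 h. True}"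


section \<open>The canonical \<open>q\<close>-commuting pair of unitaries\<close>

text \<open>\<open>Q_star T\<close> is \<open>Q\<^bsub>T*\<^esub>\<close>, the positive square root of the strong limit of \<open>T\<^sup>n T*\<^sup>n\<close>.\<close>

definition Q_star :: "('h::complex_inner \<Rightarrow> 'h) \<Rightarrow> 'h \<Rightarrow> 'h" where
  "Q_star T = pos_sqrt (\<lambda>h. lim (\<lambda>n. (T ^^ n) ((cadj T ^^ n) h)))"

definition Q_range :: "('h::complex_inner \<Rightarrow> 'h) \<Rightarrow> 'h set" where
  "Q_range T = closure (range (Q_star T))"

text \<open>\<open>Q_isometry T A X\<close>: the isometry \<open>X\<close> of the closed range of \<open>Q\<^bsub>T*\<^esub>\<close> is the one defined by
  \<open>X Q\<^bsub>T*\<^esub> h = Q\<^bsub>T*\<^esub> A* h\<close>.\<close>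

definition Q_isometry :: "('h::complex_inner \<Rightarrow> 'h) \<Rightarrow> ('h \<Rightarrow> 'h) \<Rightarrow> ('h \<Rightarrow> 'h) \<Rightarrow> bool" where
  "Q_isometry T A X \<longleftrightarrow> isometry_into (Q_range T) (Q_range T) X \<and> (\<forall>h. X (Q_star T h) = Q_star T (cadj A h))"

text \<open>The space on which the minimal unitary extension \<open>W\<^sub>D*\<close> of \<open>X*\<close> acts is only determined up
  to unitary equivalence, so it is a type \<open>'w\<close> of its own here, and \<open>\<iota>\<close> is the inclusion of the
  closed range of \<open>Q\<^bsub>T*\<^esub>\<close> into it.  \<open>Xs\<close>, \<open>X1s\<close>, \<open>X2s\<close> stand for \<open>X*\<close>, \<open>X\<^sub>1*\<close>, \<open>X\<^sub>2*\<close>.\<close>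

definition canonical_unitary_pair ::
  "complex \<Rightarrow> ('h::complex_inner \<Rightarrow> 'h) \<Rightarrow> ('h \<Rightarrow> 'h) \<Rightarrow> ('h \<Rightarrow> 'w::complex_inner) \<Rightarrow> ('w \<Rightarrow> 'w) \<Rightarrow> ('w \<Rightarrow> 'w) \<Rightarrow> bool"
  where
  "canonical_unitary_pair q T1 T2 \<iota> W1 W2 \<longleftrightarrow>
     (let T = T1 \<circ> T2; R = Q_range T in
       isometry_into R UNIV \<iota> \<and>
       (\<exists>Xs X1s X2s WD.
          Q_isometry T T Xs \<and> Q_isometry T T1 X1s \<and> Q_isometry T T2 X2s \<and>
          unitary_onto UNIV UNIV WD \<and> (\<forall>x\<in>R. cadj WD (\<iota> x) = \<iota> (Xs x)) \<and>
          UNIV = closed_csubspace hull (\<Union>n. (WD ^^ n) ` \<iota> ` R) \<and>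
          unitary_onto UNIV UNIV W1 \<and> (\<forall>x\<in>R. cadj W1 (\<iota> x) = \<iota> (X1s x)) \<and>
          unitary_onto UNIV UNIV W2 \<and> (\<forall>x\<in>R. cadj W2 (\<iota> x) = \<iota> (X2s x)) \<and>
          q_commuting_on q UNIV (cadj W1) (cadj W2) \<and>
          (\<forall>x. cadj W1 (cadj W2 x) = q *\<^sub>C cadj WD x)))"


section \<open>Vector-valued Hardy space on the unit disk\<close>

text \<open>\<open>hardy_series a f\<close>: on the open unit disk \<open>f\<close> is the sum of the power series with square
  summable coefficients \<open>a\<close>; outside the disk \<open>f\<close> is set to \<open>0\<close>, so that elements of the Hardy space
  are determined by their values on the disk.\<close>

definition hardy_series :: "(nat \<Rightarrow> 'a::chilbert_space) \<Rightarrow> (complex \<Rightarrow> 'a) \<Rightarrow> bool" where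
  "hardy_series a f \<longleftrightarrow> summable (\<lambda>n. (norm (a n))\<^sup>2) \<and>
     (\<forall>z. cmod z < 1 \<longrightarrow> (\<lambda>n. z ^ n *\<^sub>C a n) sums f z) \<and> (\<forall>z. 1 \<le> cmod z \<longrightarrow> f z = 0)"

lemma hardy_series_zero: "hardy_series (\<lambda>_. 0) (\<lambda>_. 0)"
  by (simp add: hardy_series_def)

lemma scaleC_bounded_linear: "bounded_linear (\<lambda>x::'a::complex_inner. c *\<^sub>C x)"
  by (rule bounded_linear_intro[where K = "cmod c"])
    (auto simp: scaleC_add_right scaleR_scaleC mult.commute)

lemma cinner_bounded_linear: "bounded_linear (\<lambda>x::'a::complex_inner. cinner x y)"
  by (rule bounded_linear_intro[where K = "norm y"])
    (simp_all add: cinner_add_left scaleR_scaleC[where 'a = 'a] scaleR_conv_of_real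
      cmod_cinner_le)

lemma square_summable_add:
  fixes a b :: "nat \<Rightarrow> 'a::real_inner"
  assumes "summable (\<lambda>n. (norm (a n))\<^sup>2)" "summable (\<lambda>n. (norm (b n))\<^sup>2)"
  shows "summable (\<lambda>n. (norm (a n + b n))\<^sup>2)"
proof (rule summable_comparison_test_ev)
  show "summable (\<lambda>n. 2 * (norm (a n))\<^sup>2 + 2 * (norm (b n))\<^sup>2)"
    by (intro summable_add summable_mult assms)
  have "(norm (x + y))\<^sup>2 \<le> 2 * (norm x)\<^sup>2 + 2 * (norm y)\<^sup>2" for x y :: 'a
    using sum_squares_bound[of "norm x" "norm y"]
      power_mono[OF norm_triangle_ineq norm_ge_zero, of x y 2]
    by (simp add: power2_sum)
  then show "\<forall>\<^sub>F n in sequentially. norm ((norm (a n + b n))\<^sup>2) \<le> 2 * (norm (a n))\<^sup>2 + 2 * (norm (b n))\<^sup>2"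
    by simp
qed

lemma hardy_series_add:
  assumes "hardy_series a f" "hardy_series b g"
  shows "hardy_series (\<lambda>n. a n + b n) (\<lambda>z. f z + g z)"
  using assms by (auto simp: hardy_series_def scaleC_add_right intro: sums_add square_summable_add)

lemma hardy_series_scaleC:
  assumes "hardy_series a f"
  shows "hardy_series (\<lambda>n. c *\<^sub>C a n) (\<lambda>z. c *\<^sub>C f z)"
proof -
  have "(\<lambda>n. z ^ n *\<^sub>C c *\<^sub>C a n) sums (c *\<^sub>C f z)" if "cmod z < 1" for z
    using bounded_linear.sums[OF scaleC_bounded_linear[of c], of "\<lambda>n. z ^ n *\<^sub>C a n" "f z"] that assms
    by (simp add: hardy_series_def mult.commute)
  then show ?thesis
    using assms by (simp add: hardy_series_def power_mult_distrib summable_mult)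
qed

lemma hardy_series_exists:
  assumes "summable (\<lambda>n. (norm (a n))\<^sup>2)"
  shows "\<exists>f. hardy_series (a :: nat \<Rightarrow> 'a::chilbert_space) f"
proof
  let ?f = "\<lambda>z. if cmod z < 1 then \<Sum>n. z ^ n *\<^sub>C a n else 0"
  have "summable (\<lambda>n. z ^ n *\<^sub>C a n)" if z: "cmod z < 1" for z
  proof (rule summable_comparison_test_ev)
    have "summable (\<lambda>n. ((cmod z)\<^sup>2) ^ n)"
      using z by (intro summable_geometric) (simp add: abs_square_less_1)
    then show "summable (\<lambda>n. ((cmod z)\<^sup>2) ^ n + (norm (a n))\<^sup>2)"
      by (intro summable_add assms)
    have "norm (z ^ n *\<^sub>C a n) \<le> ((cmod z)\<^sup>2) ^ n + (norm (a n))\<^sup>2" for n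
    proof -
      have "2 * (cmod z ^ n * norm (a n)) \<le> (cmod z ^ n)\<^sup>2 + (norm (a n))\<^sup>2"
        using sum_squares_bound[of "cmod z ^ n" "norm (a n)"] by (simp add: mult.assoc)
      moreover have "0 \<le> cmod z ^ n * norm (a n)" by simp
      moreover have "(cmod z ^ n)\<^sup>2 = ((cmod z)\<^sup>2) ^ n" by (simp add: power_mult[symmetric] mult.commute)
      ultimately have "cmod z ^ n * norm (a n) \<le> ((cmod z)\<^sup>2) ^ n + (norm (a n))\<^sup>2"
        by linarith
      then show ?thesis by (simp add: norm_power)
    qed
    then show "\<forall>\<^sub>F n in sequentially. norm (z ^ n *\<^sub>C a n) \<le> ((cmod z)\<^sup>2) ^ n + (norm (a n))\<^sup>2" by simp
  qed
  then show "hardy_series a ?f"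
    using assms by (auto simp: hardy_series_def summable_sums)
qed

lemma power_series_zero_coeff:
  fixes a :: "nat \<Rightarrow> complex"
  assumes "\<And>z. cmod z < 1 \<Longrightarrow> (\<lambda>n. a n * z ^ n) sums 0"
  shows "a m = 0"
proof (induction m rule: less_induct)
  case (less m)
  have "((\<lambda>_. 0) \<longlongrightarrow> a (0 + m)) (at (0::complex))"
  proof (rule powser_limit_0_strong[where s = 1 and a = "\<lambda>n. a (n + m)"])
    fix z :: complex assume z: "z \<noteq> 0" "norm z < 1"
    have "(\<lambda>n. a (n + m) * z ^ (n + m)) sums (0 - (\<Sum>i<m. a i * z ^ i))"
      using assms[OF z(2)] by (rule sums_split_initial_segment)
    then have "(\<lambda>n. inverse (z ^ m) * (a (n + m) * z ^ (n + m))) sums (inverse (z ^ m) * 0)"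
      using less by (intro sums_mult) simp
    then show "(\<lambda>n. a (n + m) * z ^ n) sums 0"
      using z by (simp add: power_add field_simps)
  qed simp
  then show ?case
    by (simp add: tendsto_const_iff)
qed

lemma hardy_series_unique:
  assumes "hardy_series a f" "hardy_series b f"
  shows "a = b"
proof
  fix n
  define c where "c = (\<lambda>n. a n + (-1) *\<^sub>C b n)"
  have neg: "(-1) *\<^sub>C x = - x" for x :: 'a
    using scaleR_scaleC[of "-1" x] by simp
  have "hardy_series c (\<lambda>z. f z + (-1) *\<^sub>C f z)"
    unfolding c_def by (intro hardy_series_add hardy_series_scaleC assms)
  then have c: "(\<lambda>n. z ^ n *\<^sub>C c n) sums 0" if "cmod z < 1" for z
    using that by (simp add: hardy_series_def neg)
  have "cinner (c n) y = 0" for y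
  proof (rule power_series_zero_coeff)
    fix z :: complex assume "cmod z < 1"
    then show "(\<lambda>n. cinner (c n) y * z ^ n) sums 0"
      using bounded_linear.sums[OF cinner_bounded_linear c, of z y] by (simp add: mult.commute)
  qed
  from this[of "c n"] have "c n = 0" by (simp add: cinner_same)
  then show "a n = b n" by (simp add: c_def neg)
qed

typedef (overloaded) 'a hardy = "{f :: complex \<Rightarrow> 'a::chilbert_space. \<exists>a. hardy_series a f}"
  morphisms hardy_eval Abs_hardy
  using hardy_series_zero by blast

definition hardy_coeff :: "'a::chilbert_space hardy \<Rightarrow> nat \<Rightarrow> 'a" where
  "hardy_coeff f = (THE a. hardy_series a (hardy_eval f))"

lemma hardy_coeff: "hardy_series (hardy_coeff f) (hardy_eval f)"
proof -
  obtain a where a: "hardy_series a (hardy_eval f)" using hardy_eval[of f] by blast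
  show ?thesis
    unfolding hardy_coeff_def
    by (rule theI[where P = "\<lambda>a. hardy_series a (hardy_eval f)", OF a]) (rule hardy_series_unique[OF _ a])
qed

lemma hardy_coeff_eqI: "hardy_series a (hardy_eval f) \<Longrightarrow> hardy_coeff f = a"
  using hardy_coeff hardy_series_unique by blast

lemma hardy_eqI: "hardy_coeff f = hardy_coeff g \<Longrightarrow> f = g"
proof -
  assume eq: "hardy_coeff f = hardy_coeff g"
  have "hardy_eval f z = hardy_eval g z" for z
    using hardy_coeff[of f] hardy_coeff[of g] eq sums_unique2
    unfolding hardy_series_def by (metis not_less)
  then show "f = g" by (metis ext hardy_eval_inject)
qed

lemma hardy_coeff_surj:
  assumes "summable (\<lambda>n. (norm (a n))\<^sup>2)"
  shows "\<exists>f. hardy_coeff f = a"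
proof -
  obtain g where g: "hardy_series a g" using hardy_series_exists[OF assms] by blast
  have "hardy_coeff (Abs_hardy g) = a"
    by (rule hardy_coeff_eqI, subst Abs_hardy_inverse) (use g in blast)+
  then show ?thesis by blast
qed

lemma hardy_coeff_summable: "summable (\<lambda>n. (norm (hardy_coeff f n))\<^sup>2)"
  using hardy_coeff[of f] by (simp add: hardy_series_def)

lemma square_summable_prod:
  fixes a b :: "nat \<Rightarrow> 'a::complex_inner"
  assumes "summable (\<lambda>n. (norm (a n))\<^sup>2)" "summable (\<lambda>n. (norm (b n))\<^sup>2)"
  shows "summable (\<lambda>n. norm (a n) * norm (b n))"
proof (rule summable_comparison_test_ev)
  show "summable (\<lambda>n. (norm (a n))\<^sup>2 + (norm (b n))\<^sup>2)"
    by (intro summable_add assms)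
  have "norm (norm x * norm y) \<le> (norm x)\<^sup>2 + (norm y)\<^sup>2" for x y :: 'a
  proof -
    have "0 \<le> norm x * norm y" by simp
    then have "norm x * norm y \<le> 2 * (norm x * norm y)" by linarith
    also have "2 * (norm x * norm y) \<le> (norm x)\<^sup>2 + (norm y)\<^sup>2"
      using sum_squares_bound[of "norm x" "norm y"] by (simp add: mult.assoc)
    finally show ?thesis by simp
  qed
  then show "\<forall>\<^sub>F n in sequentially. norm (norm (a n) * norm (b n)) \<le> (norm (a n))\<^sup>2 + (norm (b n))\<^sup>2"
    by simp
qed

lemma square_summable_cinner:
  fixes a b :: "nat \<Rightarrow> 'a::complex_inner"
  assumes "summable (\<lambda>n. (norm (a n))\<^sup>2)" "summable (\<lambda>n. (norm (b n))\<^sup>2)"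
  shows "summable (\<lambda>n. cinner (a n) (b n))"
  by (rule summable_comparison_test_ev[OF _ square_summable_prod[OF assms]])
    (simp add: cmod_cinner_le)

instantiation hardy :: (chilbert_space) scaleC
begin
definition scaleC_hardy :: "complex \<Rightarrow> 'a hardy \<Rightarrow> 'a hardy" where
  "scaleC_hardy c f = Abs_hardy (\<lambda>z. c *\<^sub>C hardy_eval f z)"
instance ..
end

instantiation hardy :: (chilbert_space) scaleR
begin
definition scaleR_hardy :: "real \<Rightarrow> 'a hardy \<Rightarrow> 'a hardy" where
  "scaleR_hardy r f = complex_of_real r *\<^sub>C f"
instance ..
end

instantiation hardy :: (chilbert_space) complex_inner
begin

definition zero_hardy :: "'a hardy" where
  "zero_hardy = Abs_hardy (\<lambda>_. 0)"
definition plus_hardy :: "'a hardy \<Rightarrow> 'a hardy \<Rightarrow> 'a hardy" where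
  "plus_hardy f g = Abs_hardy (\<lambda>z. hardy_eval f z + hardy_eval g z)"
definition uminus_hardy :: "'a hardy \<Rightarrow> 'a hardy" where
  "uminus_hardy f = (-1) *\<^sub>C f"
definition minus_hardy :: "'a hardy \<Rightarrow> 'a hardy \<Rightarrow> 'a hardy" where
  "minus_hardy f g = f + (-1) *\<^sub>C g"
definition cinner_hardy :: "'a hardy \<Rightarrow> 'a hardy \<Rightarrow> complex" where
  "cinner_hardy f g = (\<Sum>n. cinner (hardy_coeff f n) (hardy_coeff g n))"
definition inner_hardy :: "'a hardy \<Rightarrow> 'a hardy \<Rightarrow> real" where
  "inner_hardy f g = Re (cinner f g)"
definition norm_hardy :: "'a hardy \<Rightarrow> real" where
  "norm_hardy f = sqrt (inner f f)"
definition sgn_hardy :: "'a hardy \<Rightarrow> 'a hardy" where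
  "sgn_hardy f = f /\<^sub>R norm f"
definition dist_hardy :: "'a hardy \<Rightarrow> 'a hardy \<Rightarrow> real" where
  "dist_hardy f g = norm (f - g)"
definition uniformity_hardy :: "('a hardy \<times> 'a hardy) filter" where
  "uniformity_hardy = (INF e\<in>{0 <..}. principal {(x, y). dist x y < e})"
definition open_hardy :: "'a hardy set \<Rightarrow> bool" where
  "open_hardy U \<longleftrightarrow> (\<forall>x\<in>U. eventually (\<lambda>(x', y). x' = x \<longrightarrow> y \<in> U) uniformity)"

lemma hardy_coeff_zero [simp]: "hardy_coeff (0 :: 'a hardy) = (\<lambda>_. 0)"
  by (rule hardy_coeff_eqI)
    (unfold zero_hardy_def, subst Abs_hardy_inverse, use hardy_series_zero in blast, rule hardy_series_zero)

lemma hardy_coeff_add [simp]: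
  "hardy_coeff (f + g :: 'a hardy) = (\<lambda>n. hardy_coeff f n + hardy_coeff g n)"
proof (rule hardy_coeff_eqI)
  note * = hardy_series_add[OF hardy_coeff[of f] hardy_coeff[of g]]
  show "hardy_series (\<lambda>n. hardy_coeff f n + hardy_coeff g n) (hardy_eval (f + g))"
    unfolding plus_hardy_def by (subst Abs_hardy_inverse) (use * in blast)+
qed

lemma hardy_coeff_scaleC [simp]: "hardy_coeff (c *\<^sub>C f :: 'a hardy) = (\<lambda>n. c *\<^sub>C hardy_coeff f n)"
proof (rule hardy_coeff_eqI)
  note * = hardy_series_scaleC[OF hardy_coeff[of f]]
  show "hardy_series (\<lambda>n. c *\<^sub>C hardy_coeff f n) (hardy_eval (c *\<^sub>C f))"
    unfolding scaleC_hardy_def by (subst Abs_hardy_inverse) (use * in blast)+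
qed

lemma hardy_inner_sums:
  "(\<lambda>n. inner (hardy_coeff f n) (hardy_coeff (g::'a hardy) n)) sums inner f g"
  unfolding inner_hardy_def cinner_hardy_def inner_eq_Re_cinner
  by (intro sums_Re summable_sums square_summable_cinner hardy_coeff_summable)

lemma hardy_norm_sums: "(\<lambda>n. (norm (hardy_coeff f n))\<^sup>2) sums inner (f::'a hardy) f"
  using hardy_inner_sums[of f f] by (simp add: power2_norm_eq_inner)

instance
proof
  fix f g h :: "'a hardy" and r s :: real and c d :: complex
  have neg: "(-1) *\<^sub>C x = - x" for x :: 'a
    using scaleR_scaleC[of "-1" x] by simp
  show "f + g + h = f + (g + h)" "f + g = g + f" "0 + f = f"
    by (rule hardy_eqI; simp add: algebra_simps)+
  show "- f + f = 0" "f - g = f + - g"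
    by (rule hardy_eqI; simp add: uminus_hardy_def minus_hardy_def neg)+
  show "r *\<^sub>R (f + g) = r *\<^sub>R f + r *\<^sub>R g" "(r + s) *\<^sub>R f = r *\<^sub>R f + s *\<^sub>R f"
    "r *\<^sub>R s *\<^sub>R f = (r * s) *\<^sub>R f" "1 *\<^sub>R f = f"
    by (rule hardy_eqI; simp add: scaleR_hardy_def scaleC_add_left scaleC_add_right)+
  show "c *\<^sub>C (f + g) = c *\<^sub>C f + c *\<^sub>C g" "(c + d) *\<^sub>C f = c *\<^sub>C f + d *\<^sub>C f"
    "c *\<^sub>C d *\<^sub>C f = (c * d) *\<^sub>C f"
    by (rule hardy_eqI; simp add: scaleC_add_left scaleC_add_right)+
  show "r *\<^sub>R f = complex_of_real r *\<^sub>C f" by (simp add: scaleR_hardy_def)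
  show "dist f g = norm (f - g)" by (simp add: dist_hardy_def)
  show "sgn f = f /\<^sub>R norm f" by (simp add: sgn_hardy_def)
  show "(uniformity :: ('a hardy \<times> 'a hardy) filter) = (INF e\<in>{0 <..}. principal {(x, y). dist x y < e})"
    by (simp add: uniformity_hardy_def)
  show "open U \<longleftrightarrow> (\<forall>x\<in>U. eventually (\<lambda>(x', y). x' = x \<longrightarrow> y \<in> U) uniformity)" for U :: "'a hardy set"
    by (simp add: open_hardy_def)
  have sm: "summable (\<lambda>n. cinner (hardy_coeff f n) (hardy_coeff g n))" for f g :: "'a hardy"
    by (intro square_summable_cinner hardy_coeff_summable)
  show comm: "cinner f g = cnj (cinner g f)" for f g :: "'a hardy"
  proof -
    have "(\<lambda>n. cnj (cinner (hardy_coeff g n) (hardy_coeff f n))) sums cnj (cinner g f)"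
      unfolding sums_cnj cinner_hardy_def by (intro summable_sums sm)
    moreover have "(\<lambda>n. cnj (cinner (hardy_coeff g n) (hardy_coeff f n))) =
        (\<lambda>n. cinner (hardy_coeff f n) (hardy_coeff g n))"
      by (rule ext) (rule cinner_commute[symmetric])
    ultimately show ?thesis
      by (simp add: cinner_hardy_def sums_iff)
  qed
  show add: "cinner (f + g) h = cinner f h + cinner g h"
    by (simp add: cinner_hardy_def cinner_add_left suminf_add sm)
  show scale: "cinner (c *\<^sub>C f) g = c * cinner f g" for c and f g :: "'a hardy"
    by (simp add: cinner_hardy_def suminf_mult sm)
  show "inner f g = Re (cinner f g)" by (simp add: inner_hardy_def)
  show "inner f g = inner g f" using comm[of f g] by (simp add: inner_hardy_def)
  show "inner (f + g) h = inner f h + inner g h" using add by (simp add: inner_hardy_def)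
  show "inner (r *\<^sub>R f) g = r * inner f g" by (simp add: inner_hardy_def scaleR_hardy_def scale)
  show "0 \<le> inner f f"
    using sums_le[OF _ sums_zero hardy_norm_sums[of f]] by simp
  show "inner f f = 0 \<longleftrightarrow> f = 0"
  proof
    assume "inner f f = 0"
    then have "suminf (\<lambda>n. (norm (hardy_coeff f n))\<^sup>2) = 0"
      using hardy_norm_sums[of f] sums_unique by metis
    then have "\<forall>n. (norm (hardy_coeff f n))\<^sup>2 = 0"
      using suminf_eq_zero_iff[OF hardy_coeff_summable[of f]] by simp
    then show "f = 0" by (intro hardy_eqI) auto
  next
    assume "f = 0"
    then show "inner f f = 0" by (simp add: inner_hardy_def cinner_hardy_def)
  qed
  show "norm f = sqrt (inner f f)" by (simp add: norm_hardy_def)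
qed

end

lemma hardy_power2_norm: "(norm (f::'a::chilbert_space hardy))\<^sup>2 = (\<Sum>n. (norm (hardy_coeff f n))\<^sup>2)"
  using hardy_norm_sums[of f] by (simp add: power2_norm_eq_inner sums_unique)

lemma hardy_coeff_diff [simp]:
  "hardy_coeff (f - g) n = hardy_coeff f n - hardy_coeff (g::'a::chilbert_space hardy) n"
proof -
  have "hardy_coeff ((f - g) + g) n = hardy_coeff (f - g) n + hardy_coeff g n"
    by (simp only: hardy_coeff_add)
  then show ?thesis by simp
qed

lemma hardy_partial_norm_le:
  "(\<Sum>n<m. (norm (hardy_coeff f n))\<^sup>2) \<le> (norm (f::'a::chilbert_space hardy))\<^sup>2"
  unfolding hardy_power2_norm by (intro sum_le_suminf hardy_coeff_summable) auto

lemma hardy_norm_coeff_le: "norm (hardy_coeff f n) \<le> norm (f::'a::chilbert_space hardy)"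
proof -
  have "(norm (hardy_coeff f n))\<^sup>2 \<le> (\<Sum>k<Suc n. (norm (hardy_coeff f k))\<^sup>2)"
    by (simp add: sum_nonneg)
  also have "\<dots> \<le> (norm f)\<^sup>2" by (rule hardy_partial_norm_le)
  finally show ?thesis by (rule power2_le_imp_le) simp
qed

instance hardy :: (chilbert_space) chilbert_space
proof
  fix X :: "nat \<Rightarrow> 'a hardy"
  assume X: "Cauchy X"
  have "Cauchy (\<lambda>k. hardy_coeff (X k) n)" for n
  proof (rule metric_CauchyI)
    fix e :: real assume "e > 0"
    then obtain M where M: "\<And>k l. k \<ge> M \<Longrightarrow> l \<ge> M \<Longrightarrow> dist (X k) (X l) < e"
      using metric_CauchyD[OF X] by blast
    have "dist (hardy_coeff (X k) n) (hardy_coeff (X l) n) < e" if "k \<ge> M" "l \<ge> M" for k l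
      using hardy_norm_coeff_le[of "X k - X l" n] M[OF that] by (simp add: dist_norm)
    then show "\<exists>M. \<forall>k\<ge>M. \<forall>l\<ge>M. dist (hardy_coeff (X k) n) (hardy_coeff (X l) n) < e" by blast
  qed
  then have "\<forall>n. \<exists>l. (\<lambda>k. hardy_coeff (X k) n) \<longlonglongrightarrow> l"
    using Cauchy_convergent convergent_def by blast
  then obtain a where a: "\<And>n. (\<lambda>k. hardy_coeff (X k) n) \<longlonglongrightarrow> a n" by metis
  have bound: "\<exists>M. \<forall>k\<ge>M. \<forall>m. (\<Sum>n<m. (norm (a n - hardy_coeff (X k) n))\<^sup>2) \<le> e\<^sup>2"
    if "e > 0" for e :: real
  proof -
    obtain M where M: "\<And>k l. k \<ge> M \<Longrightarrow> l \<ge> M \<Longrightarrow> dist (X k) (X l) < e"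
      using metric_CauchyD[OF X \<open>e > 0\<close>] by blast
    have "(\<Sum>n<m. (norm (a n - hardy_coeff (X k) n))\<^sup>2) \<le> e\<^sup>2" if k: "k \<ge> M" for k m
    proof (rule LIMSEQ_le_const2)
      show "(\<lambda>l. \<Sum>n<m. (norm (hardy_coeff (X l) n - hardy_coeff (X k) n))\<^sup>2)
          \<longlonglongrightarrow> (\<Sum>n<m. (norm (a n - hardy_coeff (X k) n))\<^sup>2)"
        by (intro tendsto_intros a)
      have "(\<Sum>n<m. (norm (hardy_coeff (X l) n - hardy_coeff (X k) n))\<^sup>2) \<le> e\<^sup>2" if "l \<ge> M" for l
      proof -
        have "(\<Sum>n<m. (norm (hardy_coeff (X l) n - hardy_coeff (X k) n))\<^sup>2) \<le> (norm (X l - X k))\<^sup>2"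
          using hardy_partial_norm_le[where f = "X l - X k" and m = m] by simp
        also have "\<dots> \<le> e\<^sup>2"
          using M[OF that k] by (intro power_mono) (auto simp: dist_norm)
        finally show ?thesis .
      qed
      then show "\<exists>N. \<forall>l\<ge>N. (\<Sum>n<m. (norm (hardy_coeff (X l) n - hardy_coeff (X k) n))\<^sup>2) \<le> e\<^sup>2"
        by blast
    qed
    then show ?thesis by blast
  qed
  obtain M where "\<forall>m. (\<Sum>n<m. (norm (a n - hardy_coeff (X M) n))\<^sup>2) \<le> 1\<^sup>2"
    using bound[of 1] by auto
  then have "summable (\<lambda>n. (norm (a n - hardy_coeff (X M) n))\<^sup>2)"
    by (intro summableI_nonneg_bounded[where x = 1]) auto
  from square_summable_add[OF this hardy_coeff_summable[of "X M"]]
  have "summable (\<lambda>n. (norm (a n))\<^sup>2)" by simp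
  then obtain f where f: "hardy_coeff f = a" using hardy_coeff_surj by blast
  have "X \<longlonglongrightarrow> f"
  proof (rule metric_LIMSEQ_I)
    fix r :: real assume "r > 0"
    then obtain M where M: "\<And>k m. k \<ge> M \<Longrightarrow> (\<Sum>n<m. (norm (a n - hardy_coeff (X k) n))\<^sup>2) \<le> (r/2)\<^sup>2"
      using bound[of "r/2"] by auto
    have "dist (X k) f < r" if "k \<ge> M" for k
    proof -
      have "(norm (f - X k))\<^sup>2 \<le> (r/2)\<^sup>2"
        unfolding hardy_power2_norm
        by (intro suminf_le_const hardy_coeff_summable) (use M[OF that] f in auto)
      then have "norm (f - X k) \<le> r/2"
        by (rule power2_le_imp_le) (use \<open>r > 0\<close> in simp)
      then show ?thesis using \<open>r > 0\<close> by (simp add: dist_norm norm_minus_commute)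
    qed
    then show "\<exists>no. \<forall>n\<ge>no. dist (X n) f < r" by blast
  qed
  then show "convergent X" by (rule convergentI)
qed

definition hardy_space :: "'a::chilbert_space set \<Rightarrow> 'a hardy set" where
  "hardy_space F = {f. \<forall>z. cmod z < 1 \<longrightarrow> hardy_eval f z \<in> F}"

text \<open>The element of the Hardy space with the values of \<open>g\<close> on the disk (meaningful only if there is
  one).\<close>

definition disk_fun :: "(complex \<Rightarrow> 'a::chilbert_space) \<Rightarrow> 'a hardy" where
  "disk_fun g = Abs_hardy (\<lambda>z. if cmod z < 1 then g z else 0)"

definition mult_op :: "(complex \<Rightarrow> 'a \<Rightarrow> 'a::chilbert_space) \<Rightarrow> 'a hardy \<Rightarrow> 'a hardy" where
  "mult_op \<phi> f = disk_fun (\<lambda>z. \<phi> z (hardy_eval f z))"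

definition rotation_op :: "complex \<Rightarrow> 'a::chilbert_space hardy \<Rightarrow> 'a hardy" where
  "rotation_op q f = disk_fun (\<lambda>z. hardy_eval f (q * z))"


section \<open>Ando tuples and the associated models\<close>

definition ando_tuple ::
  "('h::complex_inner \<Rightarrow> 'h) \<Rightarrow> ('h \<Rightarrow> 'h) \<Rightarrow> 'f::complex_inner set \<Rightarrow> ('h \<Rightarrow> 'f) \<Rightarrow> ('f \<Rightarrow> 'f) \<Rightarrow> ('f \<Rightarrow> 'f) \<Rightarrow> bool"
  where
  "ando_tuple T1 T2 F \<Lambda> P U \<longleftrightarrow>
     closed_csubspace F \<and>
     isometry_into (defect_space (cadj (T1 \<circ> T2))) F \<Lambda> \<and>
     (\<exists>M. orth_projection F M P) \<and>
     unitary_onto F F U"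

text \<open>\<open>ando_tuple T1 T2\<close> and \<open>special_ando_tuple T1 T2\<close> are about tuples for the pair of adjoints
  \<open>(T1*, T2*)\<close>.  In a special tuple the third summand \<open>E\<close> is \<open>{0}\<close> or a full copy of \<open>'h\<close>.\<close>

definition special_ando_tuple ::
  "('h::complex_inner \<Rightarrow> 'h) \<Rightarrow> ('h \<Rightarrow> 'h) \<Rightarrow> ('h \<times> 'h \<times> 'h) set \<Rightarrow> ('h \<Rightarrow> 'h \<times> 'h \<times> 'h) \<Rightarrow>
    ('h \<times> 'h \<times> 'h \<Rightarrow> 'h \<times> 'h \<times> 'h) \<Rightarrow> ('h \<times> 'h \<times> 'h \<Rightarrow> 'h \<times> 'h \<times> 'h) \<Rightarrow> bool" where
  "special_ando_tuple T1 T2 F \<Lambda> P U \<longleftrightarrow>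
     (let T1s = cadj T1; T2s = cadj T2; Ts = cadj (T1 \<circ> T2) in
       (\<exists>E. (E = {0} \<or> E = UNIV) \<and> F = defect_space T1s \<times> defect_space T2s \<times> E) \<and>
       isometry_into (defect_space Ts) F \<Lambda> \<and>
       (\<forall>h. \<Lambda> (defect Ts h) = (defect T1s (T2s h), defect T2s h, 0)) \<and>
       orth_projection F (defect_space T1s \<times> {0} \<times> {0}) P \<and>
       unitary_onto F F U \<and>
       (\<forall>h. U (defect T1s (T2s h), defect T2s h, 0) = (defect T1s h, defect T2s (T1s h), 0)))"

definition model_V1 ::
  "complex \<Rightarrow> 'f::chilbert_space set \<Rightarrow> ('f \<Rightarrow> 'f) \<Rightarrow> ('f \<Rightarrow> 'f) \<Rightarrow> ('w \<Rightarrow> 'w) \<Rightarrow> 'f hardy \<times> 'w \<Rightarrow> 'f hardy \<times> 'w" where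
  "model_V1 q F P U W1 =
     map_prod (mult_op (\<lambda>z v. adj_on F U ((v - P v) + z *\<^sub>C P v)) \<circ> rotation_op q) W1"

definition model_V2 ::
  "complex \<Rightarrow> ('f::chilbert_space \<Rightarrow> 'f) \<Rightarrow> ('f \<Rightarrow> 'f) \<Rightarrow> ('w \<Rightarrow> 'w) \<Rightarrow> 'f hardy \<times> 'w \<Rightarrow> 'f hardy \<times> 'w" where
  "model_V2 q P U W2 =
     map_prod (rotation_op (cnj q) \<circ> mult_op (\<lambda>z v. P (U v) + z *\<^sub>C (U v - P (U v)))) W2"

definition model_embedding ::
  "('h::complex_inner \<Rightarrow> 'h) \<Rightarrow> ('h \<Rightarrow> 'f::chilbert_space) \<Rightarrow> ('h \<Rightarrow> 'w) \<Rightarrow> 'h \<Rightarrow> 'f hardy \<times> 'w" where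
  "model_embedding T \<Lambda> \<iota> h =
     (disk_fun (\<lambda>z. \<Sum>n. z ^ n *\<^sub>C \<Lambda> (defect (cadj T) ((cadj T ^^ n) h))), \<iota> (Q_star T h))"

end

theory Submission
  imports Defs
begin

text \<open>
  Put \<open>V = V1 V2\<close> for the pair in question.  A \<open>q\<close>-commuting pair of isometries can be recovered
  from its product together with a projection and a unitary on the wandering subspace of the
  product: on the Hardy space part of the model, \<open>V1 V2\<close> is the shift, and \<open>V1\<close>, \<open>V2\<close> factor it in
  the manner of Berger, Coburn and Lebow, with rotations absorbing the scalar \<open>q\<close>.

  Forward direction.  In terms of Taylor coefficients the model operators are bidiagonal, so that
  isometry, \<open>q\<close>-commutation and the formulas for the adjoints are identities between finitely many
  coefficients (\<open>hardy_V_norm\<close>, \<open>hardy_V_q_commute\<close>, \<open>hardy_V1_adjoint\<close>, \<open>hardy_V2_adjoint\<close>).  The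
  identity \<open>\<parallel>D h\<parallel>\<^sup>2 = \<parallel>h\<parallel>\<^sup>2 - \<parallel>T* h\<parallel>\<^sup>2\<close> telescopes along the orbit of \<open>T*\<close>; what is left over in
  the limit is \<open>\<parallel>Q h\<parallel>\<^sup>2\<close>, hence the embedding is isometric.  The intertwining relations with
  \<open>T1*\<close> and \<open>T2*\<close> are exactly the defining property of \<open>U\<close> in a special tuple
  (\<open>special_tuple_model_lift\<close>).

  Converse direction.  Take the Wold decomposition of \<open>V\<close>, with wandering subspace \<open>F = ker V*\<close> and
  unitary part \<open>\<Inter>n. V\<^sup>n K\<close>.  The two ways of writing \<open>F\<close> as an orthogonal sum,
  \<open>ker V2* + V2 (ker V1*)\<close> and \<open>V1 (ker V2*) + ker V1*\<close>, give the projection \<open>P\<close> and the unitary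
  \<open>U\<close>, and \<open>x \<mapsto> (\<Sum>n. z\<^sup>n G V*\<^sup>n x)\<close>, where \<open>G\<close> projects onto \<open>F\<close>, turns the pair into the Hardy space model
  (\<open>wold_V1\<close>, \<open>wold_V2\<close>).  The isometry \<open>\<Lambda>\<close> exists because \<open>D h\<close> and \<open>G h\<close> have the same norm.  By
  minimality the unitary part is spanned by the vectors \<open>V\<^sup>n E h\<close>, where \<open>E\<close> projects onto it.  They
  have the same Gram matrix as the vectors \<open>(W1 W2)\<^sup>n Q h\<close>, which span the space of the canonical
  pair, since on both sides the inner products are determined by \<open>\<parallel>E h\<parallel>\<^sup>2 = lim \<parallel>T*\<^sup>n h\<parallel>\<^sup>2 = \<parallel>Q h\<parallel>\<^sup>2\<close> and
  by the action of \<open>T*\<close>.  Families with equal Gram matrices are unitarily equivalent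
  (\<open>unitary_of_gram\<close>), and this identifies the unitary parts (\<open>minimal_lift_model\<close>).

  Everything needs adjoints and positive square roots on a Hilbert space, which come from the Riesz
  representation (\<open>riesz_representation\<close>) and from a convergent iteration (\<open>pos_sqrt\<close>).
\<close>

section \<open>Complex inner products\<close>

lemma scaleC_minus_left: "(- a) *\<^sub>C x = - (a *\<^sub>C (x::'a::complex_inner))"
  using scaleC_add_left[of a "- a" x] by (simp add: eq_neg_iff_add_eq_0 add.commute)

lemma scaleC_minus_right: "a *\<^sub>C (- x) = - (a *\<^sub>C (x::'a::complex_inner))"
  using scaleC_add_right[of a x "- x"] by (simp add: eq_neg_iff_add_eq_0 add.commute)

lemma scaleC_diff_right: "a *\<^sub>C (x - y) = a *\<^sub>C x - a *\<^sub>C (y::'a::complex_inner)"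
  using scaleC_add_right[of a x "- y"] by (simp add: scaleC_minus_right)

lemma scaleC_minus_one: "(- 1) *\<^sub>C x = - (x::'a::complex_inner)"
  by (simp add: scaleC_minus_left)

lemma cinner_add_right: "cinner x (y + z) = cinner x y + cinner x (z::'a::complex_inner)"
  by (metis cinner_add_left cinner_commute complex_cnj_add)

lemma cinner_zero_right [simp]: "cinner x (0::'a::complex_inner) = 0"
  by (metis cinner_commute cinner_zero_left complex_cnj_zero)

lemma cinner_minus_left: "cinner (- x) y = - cinner x (y::'a::complex_inner)"
  using cinner_scaleC_left[of "- 1" x y] by (simp add: scaleC_minus_one)

lemma cinner_minus_right: "cinner x (- y) = - cinner x (y::'a::complex_inner)"
  by (metis cinner_commute cinner_minus_left complex_cnj_minus)

lemma cinner_diff_left: "cinner (x - y) z = cinner x z - cinner y (z::'a::complex_inner)"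
  using cinner_add_left[of x "- y" z] by (simp add: cinner_minus_left)

lemma cinner_diff_right: "cinner x (y - z) = cinner x y - cinner x (z::'a::complex_inner)"
  using cinner_add_right[of x y "- z"] by (simp add: cinner_minus_right)

lemmas cinner_algebra = cinner_add_left cinner_add_right cinner_diff_left cinner_diff_right
  cinner_minus_left cinner_minus_right cinner_scaleC_right

lemma cinner_norm_square: "cinner x x = complex_of_real ((norm (x::'a::complex_inner))\<^sup>2)"
  by (simp add: cinner_same power2_norm_eq_inner)

lemma norm_eq_of_cinner_same: "cinner x x = cinner y y \<Longrightarrow> norm x = norm y"
  by (simp add: cinner_same norm_eq_sqrt_inner)

lemma cinner_eq_0_imp_eq_0: "cinner x x = 0 \<Longrightarrow> x = (0::'a::complex_inner)"
  by (simp add: cinner_same)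

lemma cinner_extensionality:
  fixes x y :: "'a::complex_inner"
  assumes "\<And>s. cinner s x = cinner s y"
  shows "x = y"
  using cinner_eq_0_imp_eq_0[of "x - y"] assms[of "x - y"] by (simp add: cinner_diff_right)

text \<open>The real part of the complex inner product determines it, because multiplying the first
  argument by \<open>\<i>\<close> turns the imaginary part into a real part.\<close>

lemma Im_cinner: "Im (cinner x y) = - inner (\<i> *\<^sub>C x) (y::'a::complex_inner)"
  by (simp add: inner_eq_Re_cinner)

lemma bounded_bilinear_cinner: "bounded_bilinear (cinner :: 'a::complex_inner \<Rightarrow> 'a \<Rightarrow> complex)"
proof
  show "\<exists>K. \<forall>x y::'a. norm (cinner x y) \<le> norm x * norm y * K"
    by (rule exI[where x = 1]) (simp add: cmod_cinner_le)
qed (simp_all add: cinner_algebra scaleR_scaleC[where 'a = 'a] scaleR_conv_of_real)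

lemmas tendsto_cinner = bounded_bilinear.tendsto[OF bounded_bilinear_cinner]
lemmas continuous_on_cinner = bounded_bilinear.continuous_on[OF bounded_bilinear_cinner]

lemma bounded_bilinear_scaleC: "bounded_bilinear (scaleC :: complex \<Rightarrow> 'a::complex_inner \<Rightarrow> 'a)"
proof
  show "\<exists>K. \<forall>a (b::'a). norm (a *\<^sub>C b) \<le> norm a * norm b * K"
    by (rule exI[where x = 1]) simp
qed (simp_all add: scaleC_add_left scaleC_add_right scaleR_scaleC[where 'a = 'a] scaleR_conv_of_real
       mult.commute)

lemmas tendsto_scaleC = bounded_bilinear.tendsto[OF bounded_bilinear_scaleC]


section \<open>Closed subspaces and the Riesz representation\<close>

lemma closed_csubspaceD:
  assumes "closed_csubspace S"
  shows "closed S" "0 \<in> S" "\<And>x y. x \<in> S \<Longrightarrow> y \<in> S \<Longrightarrow> x + y \<in> S" "\<And>c x. x \<in> S \<Longrightarrow> c *\<^sub>C x \<in> S"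
    "\<And>x y. x \<in> S \<Longrightarrow> y \<in> S \<Longrightarrow> x - y \<in> S" "\<And>x. x \<in> S \<Longrightarrow> - x \<in> S"
proof -
  show 1: "closed S" "0 \<in> S" "x \<in> S \<Longrightarrow> y \<in> S \<Longrightarrow> x + y \<in> S" "x \<in> S \<Longrightarrow> c *\<^sub>C x \<in> S" for x y c
    using assms by (auto simp: closed_csubspace_def)
  show minus: "- x \<in> S" if "x \<in> S" for x
    using 1(4)[OF that, of "- 1"] by (simp add: scaleC_minus_one)
  show "x - y \<in> S" if "x \<in> S" "y \<in> S" for x y
    using 1(3)[OF that(1) minus[OF that(2)]] by simp
qed

lemma closed_csubspace_UNIV: "closed_csubspace UNIV"
  by (simp add: closed_csubspace_def)

lemma closed_csubspace_Times:
  assumes "closed_csubspace A" "closed_csubspace B"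
  shows "closed_csubspace (A \<times> B)"
  unfolding closed_csubspace_def
proof (intro conjI ballI allI)
  note A = closed_csubspaceD[OF assms(1)] and B = closed_csubspaceD[OF assms(2)]
  show "closed (A \<times> B)" by (intro closed_Times A(1) B(1))
  show "0 \<in> A \<times> B" by (simp only: zero_prod_def mem_Sigma_iff A(2) B(2) simp_thms)
  show "x + y \<in> A \<times> B" if "x \<in> A \<times> B" "y \<in> A \<times> B" for x y
    using that A(3) B(3) by (cases x; cases y) simp
  show "c *\<^sub>C x \<in> A \<times> B" if "x \<in> A \<times> B" for c x
    using that A(4) B(4) by (cases x) (simp add: scaleC_prod_def)
qed

lemma closed_csubspace_sing_0: "closed_csubspace {0}"
  by (simp add: closed_csubspace_def)

lemma closed_csubspace_closure_range:
  assumes "\<And>x y. f (x + y) = f x + f y" "\<And>c x. f (c *\<^sub>C x) = c *\<^sub>C f x"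
  shows "closed_csubspace (closure (range (f :: 'a::complex_inner \<Rightarrow> 'b::complex_inner)))"
proof -
  have sub: "x + y \<in> closure (range f)" if xy: "x \<in> closure (range f)" "y \<in> closure (range f)" for x y
  proof -
    obtain X Y where X: "\<forall>n. X n \<in> range f" "X \<longlonglongrightarrow> x" and Y: "\<forall>n. Y n \<in> range f" "Y \<longlonglongrightarrow> y"
      using xy unfolding closure_sequential by blast
    have "X n + Y n \<in> range f" for n
    proof -
      obtain a b where "X n = f a" "Y n = f b" using X(1) Y(1) by blast
      then have "X n + Y n = f (a + b)" by (simp only: assms(1))
      then show ?thesis by blast
    qed
    then show ?thesis
      unfolding closure_sequential
      by (intro exI[where x = "\<lambda>n. X n + Y n"] conjI allI tendsto_add[OF X(2) Y(2)])
  qed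
  have scale: "c *\<^sub>C x \<in> closure (range f)" if x: "x \<in> closure (range f)" for c x
  proof -
    obtain X where X: "\<forall>n. X n \<in> range f" "X \<longlonglongrightarrow> x"
      using x unfolding closure_sequential by blast
    have "c *\<^sub>C X n \<in> range f" for n
    proof -
      obtain a where "X n = f a" using X(1) by blast
      then have "c *\<^sub>C X n = f (c *\<^sub>C a)" by (simp only: assms(2))
      then show ?thesis by blast
    qed
    then show ?thesis
      unfolding closure_sequential
      by (intro exI[where x = "\<lambda>n. c *\<^sub>C X n"] conjI allI tendsto_scaleC[OF tendsto_const X(2)])
  qed
  have "f 0 = 0" using assms(1)[of 0 0] by simp
  then have "0 \<in> closure (range f)"
    using closure_subset[of "range f"] rangeI[of f 0] by auto
  with sub scale show ?thesis by (simp add: closed_csubspace_def)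
qed

lemma closed_csubspace_hull: "closed_csubspace (closed_csubspace hull S)"
  unfolding hull_def closed_csubspace_def by (auto intro!: closed_Inter)

lemma closed_csubspace_hull_least:
  "closed_csubspace M \<Longrightarrow> S \<subseteq> M \<Longrightarrow> closed_csubspace hull S \<subseteq> M"
  by (rule hull_minimal)

lemma closed_csubspace_cinner_eq:
  fixes f g :: "'a::complex_inner \<Rightarrow> 'b::complex_inner" and u v :: "'a \<Rightarrow> 'c::complex_inner"
  assumes "bounded_clinear f" "bounded_clinear u"
  shows "closed_csubspace {p. cinner (f p) a = cinner (u p) b}"
  unfolding closed_csubspace_def
proof (safe)
  have cf: "continuous_on UNIV f" "continuous_on UNIV u"
    using assms by (auto simp: bounded_clinear_def linear_continuous_on)
  show "closed {p. cinner (f p) a = cinner (u p) b}"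
    by (intro closed_Collect_eq continuous_on_cinner cf continuous_on_const)
  have "f 0 = 0" "u 0 = 0"
    using assms by (auto simp: bounded_clinear_def linear_0 bounded_linear.linear)
  then show "cinner (f 0) a = cinner (u 0) b" by simp
qed (use assms in \<open>simp_all add: bounded_clinear_def clinear_on_def cinner_add_left\<close>)

text \<open>The representing vector minimises \<open>J m = \<parallel>m\<parallel>\<^sup>2 - 2 f m\<close> over the subspace.  By the parallelogram
  law \<open>\<parallel>m - n\<parallel>\<^sup>2 = 2 J m + 2 J n - 4 J ((m + n) / 2)\<close>, so every minimising sequence is Cauchy.  The
  case \<open>f = inner y\<close> is the existence of the orthogonal projection.\<close>

lemma riesz_real:
  fixes M :: "'a::{real_inner,complete_space} set" and f :: "'a \<Rightarrow> real"
  assumes M: "closed M" "subspace M"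
    and add: "\<And>x y. x \<in> M \<Longrightarrow> y \<in> M \<Longrightarrow> f (x + y) = f x + f y"
    and scale: "\<And>c x. x \<in> M \<Longrightarrow> f (c *\<^sub>R x) = c * f x"
    and bound: "\<And>x. x \<in> M \<Longrightarrow> \<bar>f x\<bar> \<le> C * norm x"
  shows "\<exists>x\<in>M. \<forall>m\<in>M. inner m x = f m"
proof -
  define J where "J = (\<lambda>m. (norm m)\<^sup>2 - 2 * f m)"
  have lower: "- C\<^sup>2 \<le> J m" if "m \<in> M" for m
  proof -
    have "0 \<le> (norm m - C)\<^sup>2" by simp
    then have "- C\<^sup>2 \<le> (norm m)\<^sup>2 - 2 * (C * norm m)" by (simp add: power2_diff algebra_simps)
    then show ?thesis using bound[OF that] by (simp add: J_def)
  qed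
  define i where "i = Inf (J ` M)"
  have bdd: "bdd_below (J ` M)" using lower by (intro bdd_belowI2) auto
  have ne: "J ` M \<noteq> {}" using subspace_0[OF M(2)] by blast
  have i_le: "i \<le> J m" if "m \<in> M" for m
    unfolding i_def using bdd that by (intro cInf_lower) auto
  have "\<exists>m\<in>M. J m < i + inverse (Suc n)" for n
    using cInf_lessD[OF ne, of "i + inverse (Suc n)"] by (auto simp: i_def)
  then obtain X where X: "\<And>n. X n \<in> M" "\<And>n. J (X n) < i + inverse (Suc n)" by metis
  have par: "(norm (m - n))\<^sup>2 \<le> 2 * (J m - i) + 2 * (J n - i)" if mn: "m \<in> M" "n \<in> M" for m n
  proof -
    have half: "(1/2) *\<^sub>R (m + n) \<in> M" using mn M(2) by (simp add: subspace_add subspace_scale)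
    have "f ((1/2) *\<^sub>R (m + n)) = (f m + f n) / 2"
      using scale[of "m + n" "1/2"] add mn M(2) by (simp add: subspace_add)
    moreover have "(norm ((1/2) *\<^sub>R (m + n)))\<^sup>2 = (norm (m + n))\<^sup>2 / 4"
      by (simp add: power_divide)
    moreover have "(norm (m + n))\<^sup>2 + (norm (m - n))\<^sup>2 = 2 * (norm m)\<^sup>2 + 2 * (norm n)\<^sup>2"
      by (simp add: power2_norm_eq_inner inner_add_left inner_add_right inner_diff_left inner_diff_right)
    ultimately show ?thesis using i_le[OF half] unfolding J_def by argo
  qed
  have "Cauchy X"
  proof (rule metric_CauchyI)
    fix e :: real assume "e > 0"
    then obtain N where N: "inverse (Suc N) < e\<^sup>2 / 4"
      using reals_Archimedean[of "e\<^sup>2 / 4"] by auto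
    have "dist (X m) (X n) < e" if "m \<ge> N" "n \<ge> N" for m n
    proof -
      have "inverse (real (Suc m)) \<le> inverse (Suc N)" "inverse (real (Suc n)) \<le> inverse (Suc N)"
        using that by (auto intro!: le_imp_inverse_le)
      then have "(norm (X m - X n))\<^sup>2 < e\<^sup>2"
        using par[OF X(1) X(1), of m n] X(2)[of m] X(2)[of n] N by argo
      then show ?thesis
        using \<open>e > 0\<close> by (simp add: dist_norm power_less_imp_less_base)
    qed
    then show "\<exists>M. \<forall>m\<ge>M. \<forall>n\<ge>M. dist (X m) (X n) < e" by blast
  qed
  then obtain x where x: "X \<longlonglongrightarrow> x"
    using Cauchy_convergent convergent_def by blast
  have xM: "x \<in> M" using closed_sequentially[OF M(1) X(1) x] .
  have "(\<lambda>n. f (X n)) \<longlonglongrightarrow> f x"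
  proof (rule LIMSEQ_I)
    fix r :: real assume "r > 0"
    have "(\<lambda>n. C * norm (X n - x)) \<longlonglongrightarrow> C * norm (x - x)"
      by (intro tendsto_intros x)
    then have "(\<lambda>n. C * norm (X n - x)) \<longlonglongrightarrow> 0" by simp
    then obtain N where N: "\<And>n. n \<ge> N \<Longrightarrow> norm (C * norm (X n - x)) < r"
      using LIMSEQ_D[of "\<lambda>n. C * norm (X n - x)" 0 r] \<open>r > 0\<close> by auto
    have "norm (f (X n) - f x) < r" if "n \<ge> N" for n
    proof -
      have d: "X n - x \<in> M" using X(1) xM M(2) by (simp add: subspace_diff)
      have "f (X n) = f (X n - x) + f x" using add[OF d xM] by simp
      then show ?thesis using bound[OF d] N[OF that] by simp
    qed
    then show "\<exists>no. \<forall>n\<ge>no. norm (f (X n) - f x) < r" by blast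
  qed
  then have "(\<lambda>n. J (X n)) \<longlonglongrightarrow> J x"
    unfolding J_def by (intro tendsto_intros x)
  moreover have "(\<lambda>n. i + inverse (real (Suc n))) \<longlonglongrightarrow> i + 0"
    by (intro tendsto_intros LIMSEQ_inverse_real_of_nat)
  ultimately have Jx: "J x \<le> i"
    by (metis (no_types, lifting) LIMSEQ_le X(2) add.right_neutral less_imp_le)
  have "inner m x = f m" if m: "m \<in> M" for m
  proof -
    define b where "b = inner m x - f m"
    have quad: "0 \<le> t\<^sup>2 * (norm m)\<^sup>2 + 2 * t * b" for t
    proof -
      have tm: "t *\<^sub>R m \<in> M" "x + t *\<^sub>R m \<in> M" using m xM M(2) by (auto simp: subspace_add subspace_scale)
      have "J (x + t *\<^sub>R m) = J x + (t\<^sup>2 * (norm m)\<^sup>2 + 2 * t * b)"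
        unfolding J_def b_def power2_norm_eq_inner
        by (simp add: add[OF xM tm(1)] scale[OF m] inner_add_left inner_add_right inner_commute
            algebra_simps power2_eq_square)
      then show ?thesis using i_le[OF tm(2)] Jx by linarith
    qed
    have "b = 0"
    proof (rule ccontr)
      assume "b \<noteq> 0"
      show False
      proof (cases "m = 0")
        case True
        then show False using quad[of "- b"] \<open>b \<noteq> 0\<close> by (simp add: not_le[symmetric] not_square_less_zero flip: power2_eq_square)
      next
        case False
        \<comment> \<open>the minimum of the quadratic is at this \<open>t\<close>\<close>
        define t where "t = - b / (norm m)\<^sup>2"
        have "t\<^sup>2 * (norm m)\<^sup>2 + 2 * t * b = - (b\<^sup>2 / (norm m)\<^sup>2)"
          using False unfolding t_def by (simp add: field_simps power2_eq_square)
        moreover have "b\<^sup>2 / (norm m)\<^sup>2 > 0" using \<open>b \<noteq> 0\<close> False by simp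
        ultimately show False using quad[of t] by linarith
      qed
    qed
    then show ?thesis by (simp add: b_def)
  qed
  with xM show ?thesis by blast
qed

lemma riesz_representation:
  fixes M :: "'a::chilbert_space set" and f :: "'a \<Rightarrow> complex"
  assumes M: "closed_csubspace M"
    and add: "\<And>x y. x \<in> M \<Longrightarrow> y \<in> M \<Longrightarrow> f (x + y) = f x + f y"
    and scale: "\<And>c x. x \<in> M \<Longrightarrow> f (c *\<^sub>C x) = c * f x"
    and bound: "\<And>x. x \<in> M \<Longrightarrow> cmod (f x) \<le> C * norm x"
  shows "\<exists>x\<in>M. \<forall>m\<in>M. cinner m x = f m"
proof -
  note M' = closed_csubspaceD[OF M]
  have "subspace M"
    using M' by (auto simp: subspace_def scaleR_scaleC)
  have "\<exists>x\<in>M. \<forall>m\<in>M. inner m x = Re (f m)"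
  proof (rule riesz_real[OF M'(1) \<open>subspace M\<close>])
    show "\<bar>Re (f x)\<bar> \<le> C * norm x" if "x \<in> M" for x
      using bound[OF that] abs_Re_le_cmod[of "f x"] by linarith
  qed (use add scale in \<open>simp_all add: scaleR_scaleC\<close>)
  then obtain x where x: "x \<in> M" "\<And>m. m \<in> M \<Longrightarrow> inner m x = Re (f m)" by blast
  have "cinner m x = f m" if m: "m \<in> M" for m
  proof (rule complex_eqI)
    show "Re (cinner m x) = Re (f m)" using x(2)[OF m] by (simp only: inner_eq_Re_cinner)
    have "Im (cinner m x) = - Re (f (\<i> *\<^sub>C m))"
      using x(2)[OF M'(4)[OF m, of \<i>]] by (simp only: Im_cinner)
    then show "Im (cinner m x) = Im (f m)" by (simp add: scale[OF m])
  qed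
  with x(1) show ?thesis by blast
qed

lemma orthogonal_projection_exists:
  fixes M :: "'a::chilbert_space set"
  assumes M: "closed_csubspace M"
  shows "\<exists>p\<in>M. \<forall>m\<in>M. cinner m (y - p) = 0"
proof -
  have "\<exists>p\<in>M. \<forall>m\<in>M. cinner m p = cinner m y"
    by (rule riesz_representation[OF M, where C = "norm y"])
      (simp_all add: cinner_add_left mult.commute[of "norm y"] cmod_cinner_le)
  then show ?thesis by (metis cinner_diff_right diff_self)
qed

lemma double_orthogonal_complement:
  fixes M :: "'a::chilbert_space set"
  assumes M: "closed_csubspace M" and y: "\<And>v. (\<And>m. m \<in> M \<Longrightarrow> cinner m v = 0) \<Longrightarrow> cinner y v = 0"
  shows "y \<in> M"
proof -
  obtain p where p: "p \<in> M" "\<And>m. m \<in> M \<Longrightarrow> cinner m (y - p) = 0"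
    using orthogonal_projection_exists[OF M] by blast
  have "cinner (y - p) (y - p) = 0"
    using y[of "y - p"] p by (simp add: cinner_diff_left)
  then show ?thesis using p(1) cinner_eq_0_imp_eq_0[of "y - p"] by simp
qed


section \<open>Bounded operators and adjoints\<close>

lemma bounded_clinearD:
  assumes "bounded_clinear A"
  shows "bounded_linear A" "A (x + y) = A x + A y" "A (x - y) = A x - A y" "A (- x) = - A x"
    "A (c *\<^sub>C x) = c *\<^sub>C A x" "A 0 = 0"
  using assms by (auto simp: bounded_clinear_def clinear_on_def linear_diff bounded_linear.linear
      linear_0 linear_neg)

lemma bounded_clinearI:
  assumes "\<And>x y. A (x + y) = A x + A y" "\<And>c x. A (c *\<^sub>C x) = c *\<^sub>C A x" "\<And>x. norm (A x) \<le> K * norm x"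
  shows "bounded_clinear A"
  unfolding bounded_clinear_def clinear_on_def
  by (intro conjI bounded_linear_intro[where K = K])
    (use assms in \<open>auto simp: scaleR_scaleC mult.commute\<close>)

lemma contractionI:
  assumes "\<And>x y. A (x + y) = A x + A y" "\<And>c x. A (c *\<^sub>C x) = c *\<^sub>C A x" "\<And>x. norm (A x) \<le> norm x"
  shows "contraction A"
  unfolding contraction_def using bounded_clinearI[of A 1] onorm_bound[of 1 A] assms by simp

lemma contractionD:
  assumes "contraction A"
  shows "bounded_clinear A" "norm (A x) \<le> norm x"
proof -
  show *: "bounded_clinear A" using assms by (simp add: contraction_def)
  have "norm (A x) \<le> onorm A * norm x" by (rule onorm[OF bounded_clinearD(1)[OF *]])
  also have "\<dots> \<le> 1 * norm x" by (rule mult_right_mono) (use assms in \<open>auto simp: contraction_def\<close>)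
  finally show "norm (A x) \<le> norm x" by simp
qed

lemma contraction_funpow_norm:
  fixes A :: "'a::complex_inner \<Rightarrow> 'a"
  shows "contraction A \<Longrightarrow> norm ((A ^^ n) x) \<le> norm x"
proof (induction n)
  case (Suc n)
  then show ?case using order_trans[OF contractionD(2)[of A "(A ^^ n) x"]] by simp
qed simp

lemma bounded_clinear_funpow:
  fixes A :: "'a::complex_inner \<Rightarrow> 'a"
  assumes "bounded_clinear A"
  shows "(A ^^ n) (x + y) = (A ^^ n) x + (A ^^ n) y" "(A ^^ n) (x - y) = (A ^^ n) x - (A ^^ n) y"
    "(A ^^ n) (c *\<^sub>C x) = c *\<^sub>C (A ^^ n) x"
proof -
  note [simp] = bounded_clinearD(2,3,5)[OF assms]
  show "(A ^^ n) (x + y) = (A ^^ n) x + (A ^^ n) y" by (induction n) simp_all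
  show "(A ^^ n) (x - y) = (A ^^ n) x - (A ^^ n) y" by (induction n) simp_all
  show "(A ^^ n) (c *\<^sub>C x) = c *\<^sub>C (A ^^ n) x" by (induction n) simp_all
qed

lemma tendsto_bounded_clinear:
  "bounded_clinear A \<Longrightarrow> (f \<longlongrightarrow> l) F \<Longrightarrow> ((\<lambda>x. A (f x)) \<longlongrightarrow> A l) F"
  by (rule bounded_linear.tendsto[OF bounded_clinearD(1)])

lemma closed_csubspace_Collect_eq:
  assumes "bounded_clinear A" "bounded_clinear B"
  shows "closed_csubspace {x. A x = B x}"
  unfolding closed_csubspace_def
proof (intro conjI ballI allI)
  show "closed {x. A x = B x}"
    by (intro closed_Collect_eq linear_continuous_on bounded_clinearD(1) assms)
qed (simp_all add: bounded_clinearD[OF assms(1)] bounded_clinearD[OF assms(2)])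

lemma closed_csubspace_vimage:
  assumes A: "bounded_clinear A" and S: "closed_csubspace S"
  shows "closed_csubspace {x. A x \<in> S}"
  unfolding closed_csubspace_def
proof (intro conjI ballI allI)
  have "closed (A -` S)"
    by (intro continuous_closed_vimage closed_csubspaceD(1)[OF S] linear_continuous_at bounded_clinearD(1)[OF A])
  then show "closed {x. A x \<in> S}" by (simp add: vimage_def)
qed (simp_all add: bounded_clinearD[OF A] closed_csubspaceD[OF S])

lemma closed_csubspace_Int:
  "closed_csubspace A \<Longrightarrow> closed_csubspace B \<Longrightarrow> closed_csubspace (A \<inter> B)"
  by (simp add: closed_csubspace_def closed_Int)

lemma bounded_clinear_ident: "bounded_clinear (\<lambda>x. x)" "bounded_clinear (\<lambda>x. 0)"
  by (rule bounded_clinearI[where K = 1]; simp)+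

lemma bounded_clinear_compose:
  assumes A: "bounded_clinear A" and B: "bounded_clinear B"
  shows "bounded_clinear (\<lambda>x. A (B x))"
  unfolding bounded_clinear_def clinear_on_def
  using bounded_linear_compose[OF bounded_clinearD(1)[OF A] bounded_clinearD(1)[OF B]]
    bounded_clinearD[OF A] bounded_clinearD[OF B] by simp

lemma bounded_clinear_diff:
  assumes A: "bounded_clinear A" and B: "bounded_clinear B"
  shows "bounded_clinear (\<lambda>x. A x - B x)"
  unfolding bounded_clinear_def clinear_on_def
  using bounded_linear_sub[OF bounded_clinearD(1)[OF A] bounded_clinearD(1)[OF B]]
    bounded_clinearD[OF A] bounded_clinearD[OF B] by (simp add: scaleC_diff_right)

lemma adj_on_eqI:
  assumes S: "closed_csubspace S" and x: "x \<in> S" "\<And>s. s \<in> S \<Longrightarrow> cinner (A s) y = cinner s x"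
  shows "adj_on S A y = x"
  unfolding adj_on_def
proof (rule the_equality)
  show "x \<in> S \<and> (\<forall>s\<in>S. cinner (A s) y = cinner s x)" using x by blast
  fix z assume z: "z \<in> S \<and> (\<forall>s\<in>S. cinner (A s) y = cinner s z)"
  then have "cinner (z - x) (z - x) = 0"
    using x closed_csubspaceD(5)[OF S, of z x] by (simp add: cinner_diff_right)
  then show "z = x" using cinner_eq_0_imp_eq_0[of "z - x"] by simp
qed

lemma cadj_eqI: "(\<And>s. cinner (A s) y = cinner s x) \<Longrightarrow> cadj A y = x"
  by (rule adj_on_eqI[OF closed_csubspace_UNIV]) auto

lemma cinner_cadj_right:
  fixes A :: "'a::chilbert_space \<Rightarrow> 'b::complex_inner"
  assumes A: "bounded_clinear A"
  shows "cinner x (cadj A y) = cinner (A x) y"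
proof -
  obtain K where K: "norm (A x) \<le> norm x * K" for x
    using bounded_linear.bounded[OF bounded_clinearD(1)[OF A]] by blast
  have "\<exists>z\<in>UNIV. \<forall>s\<in>UNIV. cinner s z = cinner (A s) y"
  proof (rule riesz_representation[OF closed_csubspace_UNIV])
    show "cmod (cinner (A s) y) \<le> (K * norm y) * norm s" for s
      using order_trans[OF cmod_cinner_le mult_right_mono[OF K, of "norm y" s]] by (simp add: mult_ac)
  qed (simp_all add: bounded_clinearD[OF A] cinner_add_left)
  then obtain z where z: "\<And>s. cinner (A s) y = cinner s z" by (metis UNIV_I)
  then show ?thesis using cadj_eqI[of A y z] by simp
qed

lemma cinner_cadj_left:
  fixes A :: "'a::chilbert_space \<Rightarrow> 'b::complex_inner"
  assumes A: "bounded_clinear A"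
  shows "cinner (cadj A y) x = cinner y (A x)"
  by (metis assms cinner_cadj_right cinner_commute)

lemma cadj_comp:
  fixes A :: "'a::chilbert_space \<Rightarrow> 'b::chilbert_space" and B :: "'c::chilbert_space \<Rightarrow> 'a"
  assumes "bounded_clinear A" "bounded_clinear B"
  shows "cadj (A \<circ> B) y = cadj B (cadj A y)"
  by (rule cadj_eqI) (simp add: assms cinner_cadj_right)

lemma contraction_cadj:
  fixes A :: "'a::chilbert_space \<Rightarrow> 'b::chilbert_space"
  assumes A: "contraction A"
  shows "contraction (cadj A)"
proof (rule contractionI)
  note A' = cinner_cadj_right[OF contractionD(1)[OF A]]
  show "cadj A (x + y) = cadj A x + cadj A y" for x y
    by (rule cadj_eqI) (simp add: cinner_add_right A')
  show "cadj A (c *\<^sub>C x) = c *\<^sub>C cadj A x" for c x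
    by (rule cadj_eqI) (simp add: cinner_scaleC_right A')
  show "norm (cadj A x) \<le> norm x" for x
  proof -
    have "(norm (cadj A x))\<^sup>2 = cmod (cinner (A (cadj A x)) x)"
      by (simp add: A'[symmetric] cinner_norm_square norm_power)
    also have "\<dots> \<le> norm (A (cadj A x)) * norm x" by (rule cmod_cinner_le)
    also have "\<dots> \<le> norm (cadj A x) * norm x"
      by (intro mult_right_mono contractionD(2)[OF A]) simp
    finally have "norm (cadj A x) * norm (cadj A x) \<le> norm (cadj A x) * norm x"
      by (simp add: power2_eq_square)
    then show ?thesis by (cases "norm (cadj A x) = 0") auto
  qed
qed

lemma contraction_comp: "contraction A \<Longrightarrow> contraction B \<Longrightarrow> contraction (A \<circ> B)"
  by (rule contractionI)
    (auto simp: bounded_clinearD contractionD intro: order_trans[OF contractionD(2) contractionD(2)])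

lemma isometry_UNIV:
  assumes "isometry_into UNIV S A"
  shows "contraction A" "norm (A x) = norm x" "A x \<in> S"
  using assms by (auto intro!: contractionI simp: isometry_into_def clinear_on_def)

text \<open>By polarisation.  Hence inner products of linear images need only be compared through norms.\<close>

lemma cinner_eq_of_norm_eq:
  fixes x y :: "'a::complex_inner" and u v :: "'b::complex_inner"
  assumes "\<And>c. norm (x + c *\<^sub>C y) = norm (u + c *\<^sub>C v)"
  shows "cinner x y = cinner u v"
proof -
  have xy: "(norm (x + c *\<^sub>C y))\<^sup>2 = (norm x)\<^sup>2 + (norm (c *\<^sub>C y))\<^sup>2 + 2 * Re (cnj c * cinner x y)"
    for c :: complex and x y :: "'z::complex_inner"
    unfolding power2_norm_eq_inner
    by (simp add: inner_add_left inner_add_right inner_commute[of "c *\<^sub>C y" x])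
      (simp add: inner_eq_Re_cinner cinner_scaleC_right)
  have y: "(norm (c *\<^sub>C y))\<^sup>2 = (norm (c *\<^sub>C v))\<^sup>2" for c
  proof -
    have 1: "(norm (x + c *\<^sub>C y))\<^sup>2 + (norm (x + (-c) *\<^sub>C y))\<^sup>2 = 2 * (norm x)\<^sup>2 + 2 * (norm (c *\<^sub>C y))\<^sup>2"
      for c and x y :: "'z::complex_inner"
      unfolding xy by simp
    show ?thesis
      using 1[of x c y] 1[of u c v] assms[of c] assms[of "- c"] assms[of 0]
      by (simp del: norm_scaleC)
  qed
  have "Re (cnj c * cinner x y) = Re (cnj c * cinner u v)" for c
  proof -
    have "norm x = norm u" using assms[of 0] by simp
    then show ?thesis
      using xy[of x c y] xy[of u c v] unfolding assms[of c] y[of c] by simp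
  qed
  from this[of 1] this[of \<i>] show ?thesis by (simp add: complex_eq_iff)
qed

lemma isometry_cinner:
  assumes A: "isometry_into S S' A" and S: "closed_csubspace S" and xy: "x \<in> S" "y \<in> S"
  shows "cinner (A x) (A y) = cinner x y"
proof (rule cinner_eq_of_norm_eq)
  fix c
  have "A x + c *\<^sub>C A y = A (x + c *\<^sub>C y)"
    using A xy closed_csubspaceD[OF S] by (auto simp: isometry_into_def clinear_on_def)
  then show "norm (A x + c *\<^sub>C A y) = norm (x + c *\<^sub>C y)"
    using A xy closed_csubspaceD[OF S] by (auto simp: isometry_into_def)
qed

section \<open>Positive operators and their square roots\<close>

lemma positive_opD:
  assumes "positive_op A"
  shows "bounded_clinear A" "0 \<le> Re (cinner (A x) x)" "Im (cinner (A x) x) = 0"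
  using assms by (auto simp: positive_op_def complex_is_Real_iff)

text \<open>A positive form is Hermitian: compare the imaginary parts of its values at \<open>x + y\<close> and at
  \<open>x + \<i> y\<close>, all of which vanish.\<close>

lemma positive_op_selfadjoint:
  assumes A: "positive_op A"
  shows "cinner (A x) y = cinner x (A y)"
proof -
  note L = bounded_clinearD[OF positive_opD(1)[OF A]]
  have 1: "Im (cinner (A x) y) + Im (cinner (A y) x) = 0"
    using positive_opD(3)[OF A, of "x + y"] positive_opD(3)[OF A, of x] positive_opD(3)[OF A, of y]
    by (simp add: L cinner_algebra)
  have 2: "Re (cinner (A y) x) - Re (cinner (A x) y) = 0"
    using positive_opD(3)[OF A, of "x + \<i> *\<^sub>C y"] positive_opD(3)[OF A, of x] positive_opD(3)[OF A, of y]
    by (simp add: L cinner_algebra)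
  have "cinner (A x) y = cnj (cinner (A y) x)"
    using 1 2 by (simp add: complex_eq_iff)
  then show ?thesis by (metis cinner_commute)
qed

text \<open>The operator inequality \<open>A\<^sup>2 \<le> K A\<close>: positivity at \<open>x - A x / K\<close>.\<close>

lemma positive_op_norm_square_le:
  assumes A: "positive_op A" and K: "\<And>x. norm (A x) \<le> K * norm x" "K > 0"
  shows "(norm (A x))\<^sup>2 \<le> K * Re (cinner (A x) x)"
proof -
  note L = bounded_clinearD[OF positive_opD(1)[OF A]]
  define t where "t = complex_of_real (inverse K)"
  define n where "n = (norm (A x))\<^sup>2"
  have t: "cnj t = t" "Re t = inverse K" "Im t = 0"
    unfolding t_def by (simp_all only: complex_cnj_complex_of_real Re_complex_of_real Im_complex_of_real)
  have "cinner (A (x - t *\<^sub>C A x)) (x - t *\<^sub>C A x) =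
      cinner (A x) x - 2 * t * of_real n + t * t * cinner (A (A x)) (A x)"
    unfolding n_def cinner_norm_square[symmetric]
    by (simp add: L cinner_algebra positive_op_selfadjoint[OF A, of "A x" x] t algebra_simps)
  then have "0 \<le> Re (cinner (A x) x - 2 * t * of_real n + t * t * cinner (A (A x)) (A x))"
    using positive_opD(2)[OF A, of "x - t *\<^sub>C A x"] by simp
  also have "\<dots> = Re (cinner (A x) x) - 2 * inverse K * n
      + (inverse K)\<^sup>2 * Re (cinner (A (A x)) (A x))"
    by (simp add: t power2_eq_square)
  also have "Re (cinner (A (A x)) (A x)) \<le> K * n"
  proof -
    have "Re (cinner (A (A x)) (A x)) \<le> norm (A (A x)) * norm (A x)"
      using cmod_cinner_le[of "A (A x)" "A x"] complex_Re_le_cmod order_trans by blast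
    also have "\<dots> \<le> (K * norm (A x)) * norm (A x)"
      by (intro mult_right_mono K) simp
    finally show ?thesis by (simp add: n_def power2_eq_square mult.assoc)
  qed
  finally have "0 \<le> Re (cinner (A x) x) - 2 * inverse K * n + (inverse K)\<^sup>2 * (K * n)"
    by (simp add: mult_left_mono)
  also have "\<dots> = Re (cinner (A x) x) - n / K"
    using K(2) by (simp add: field_simps power2_eq_square)
  finally show ?thesis using K(2) by (simp add: n_def field_simps)
qed

lemma positive_op_eq_0:
  assumes A: "positive_op A" and "Re (cinner (A x) x) = 0"
  shows "A x = 0"
proof -
  obtain K where "K > 0" "\<And>x. norm (A x) \<le> norm x * K"
    using bounded_linear.pos_bounded[OF bounded_clinearD(1)[OF positive_opD(1)[OF A]]] by blast
  then show ?thesis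
    using positive_op_norm_square_le[OF A, of K x] assms(2) by (simp add: mult.commute)
qed

text \<open>With \<open>B = I - A\<close>, the recursion below converges to a solution \<open>S\<close> of
  \<open>S = (B + S\<^sup>2) / 2\<close>, which says \<open>(I - S)\<^sup>2 = A\<close>.  The same recursion for the real number \<open>1\<close> in
  place of \<open>B\<close> is increasing and bounded by \<open>1\<close>, and it majorises the increments of the iteration
  for \<open>B\<close>.\<close>

primrec sqrt_iteration :: "('a::complex_inner \<Rightarrow> 'a) \<Rightarrow> nat \<Rightarrow> 'a \<Rightarrow> 'a" where
  "sqrt_iteration B 0 = (\<lambda>x. 0)"
| "sqrt_iteration B (Suc n) = (\<lambda>x. (1/2) *\<^sub>C (B x + sqrt_iteration B n (sqrt_iteration B n x)))"

primrec sqrt_majorant :: "nat \<Rightarrow> real" where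
  "sqrt_majorant 0 = 0"
| "sqrt_majorant (Suc n) = (1 + (sqrt_majorant n)\<^sup>2) / 2"

lemma sqrt_majorant: "0 \<le> sqrt_majorant n" "sqrt_majorant n \<le> 1" "sqrt_majorant n \<le> sqrt_majorant (Suc n)"
proof -
  show 0: "0 \<le> sqrt_majorant n" for n by (induction n) auto
  show "sqrt_majorant n \<le> 1"
  proof (induction n)
    case (Suc n)
    then show ?case using power_mono[OF Suc 0, of 2] by simp
  qed simp
  have "2 * sqrt_majorant n \<le> 1 + (sqrt_majorant n)\<^sup>2"
    using sum_squares_bound[of 1 "sqrt_majorant n"] by simp
  then show "sqrt_majorant n \<le> sqrt_majorant (Suc n)" by simp
qed

lemma sqrt_exists:
  fixes A :: "'a::chilbert_space \<Rightarrow> 'a"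
  assumes A: "positive_op A" and le: "\<And>x. norm (x - A x) \<le> norm x"
  shows "\<exists>S. positive_op S \<and> S \<circ> S = A \<and>
    (\<forall>C. bounded_clinear C \<and> (\<forall>x. C (A x) = A (C x)) \<longrightarrow> (\<forall>x. C (S x) = S (C x)))"
proof -
  note L = bounded_clinearD[OF positive_opD(1)[OF A]]
  define B where "B = (\<lambda>x. x - A x)"
  define Y where "Y = sqrt_iteration B"
  define c where "c = sqrt_majorant"
  have Y0: "Y 0 x = 0" and YS: "Y (Suc n) x = (1/2) *\<^sub>C (B x + Y n (Y n x))" for n x
    by (simp_all add: Y_def)
  have cS: "c (Suc n) = (1 + (c n)\<^sup>2) / 2" for n by (simp add: c_def)
  have c: "0 \<le> c n" "c n \<le> 1" "c n \<le> c (Suc n)" for n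
    unfolding c_def by (rule sqrt_majorant)+
  have Bsa: "cinner (B x) y = cinner x (B y)" for x y
    by (simp add: B_def cinner_algebra positive_op_selfadjoint[OF A])
  have YL: "Y n (x + y) = Y n x + Y n y" for n x y
    by (induction n arbitrary: x y)
      (simp_all add: Y0 YS, simp add: B_def L scaleC_add_right[symmetric] algebra_simps)
  have YC: "Y n (a *\<^sub>C x) = a *\<^sub>C Y n x" for n a x
    by (induction n arbitrary: x)
      (simp_all add: Y0 YS, simp add: B_def L scaleC_diff_right[symmetric] scaleC_add_right mult.commute)
  have Yminus: "Y n (x - y) = Y n x - Y n y" for n x y
    using YL[of n "x - y" y] by simp
  have Ybound: "norm (Y n x) \<le> c n * norm x" for n x
  proof (induction n arbitrary: x)
    case (Suc n)
    have "norm (Y (Suc n) x) \<le> (norm (B x) + norm (Y n (Y n x))) / 2"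
      using norm_triangle_ineq[of "B x" "Y n (Y n x)"] by (simp add: YS)
    also have "norm (Y n (Y n x)) \<le> c n * (c n * norm x)"
      by (rule order_trans[OF Suc mult_left_mono[OF Suc c(1)]])
    also have "norm (B x) \<le> norm x" unfolding B_def by (rule le)
    finally show ?case by (simp add: cS field_simps power2_eq_square)
  qed (simp add: Y0 c_def)
  have Ydiff: "norm (Y (Suc n) x - Y n x) \<le> (c (Suc n) - c n) * norm x" for n x
  proof (induction n arbitrary: x)
    case 0
    have "norm (B x) \<le> norm x" unfolding B_def by (rule le)
    then show ?case by (simp add: Y0 YS cS) (simp add: c_def)
  next
    case (Suc n)
    have "Y (Suc (Suc n)) x - Y (Suc n) x =
        (1/2) *\<^sub>C (Y (Suc n) (Y (Suc n) x - Y n x) + (Y (Suc n) (Y n x) - Y n (Y n x)))"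
      by (subst YS, subst (2) YS) (simp add: scaleC_diff_right[symmetric] Yminus)
    then have "norm (Y (Suc (Suc n)) x - Y (Suc n) x) \<le>
        (norm (Y (Suc n) (Y (Suc n) x - Y n x)) + norm (Y (Suc n) (Y n x) - Y n (Y n x))) / 2"
      by (simp add: norm_triangle_ineq)
    also have "norm (Y (Suc n) (Y (Suc n) x - Y n x)) \<le> c (Suc n) * ((c (Suc n) - c n) * norm x)"
      by (rule order_trans[OF Ybound mult_left_mono[OF Suc c(1)]])
    also have "norm (Y (Suc n) (Y n x) - Y n (Y n x)) \<le> (c (Suc n) - c n) * (c n * norm x)"
      by (rule order_trans[OF Suc mult_left_mono[OF Ybound]]) (simp add: c(3))
    also have "(c (Suc n) * ((c (Suc n) - c n) * norm x) + (c (Suc n) - c n) * (c n * norm x)) / 2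
        = (c (Suc (Suc n)) - c (Suc n)) * norm x"
    proof -
      have "2 * c (Suc (Suc n)) = 1 + (c (Suc n))\<^sup>2" "2 * c (Suc n) = 1 + (c n)\<^sup>2"
        by (subst cS, simp)+
      then have e: "c (Suc (Suc n)) - c (Suc n) = (c (Suc n) * (c (Suc n) - c n) + (c (Suc n) - c n) * c n) / 2"
        by (simp add: algebra_simps power2_eq_square)
      show ?thesis unfolding e by (simp add: algebra_simps)
    qed
    finally show ?case by simp
  qed
  have "convergent c"
  proof (rule Bseq_mono_convergent)
    show "Bseq c" using c by (intro BseqI'[where K = 1]) auto
    show "\<forall>m. \<forall>n\<ge>m. c m \<le> c n" by (intro allI impI lift_Suc_mono_le[of c, OF c(3)])
  qed
  then have sc: "summable (\<lambda>n. c (Suc n) - c n)"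
    using telescope_summable by (auto simp: convergent_def)
  have "\<exists>l. (\<lambda>n. Y n x) \<longlonglongrightarrow> l" for x
  proof -
    have "summable (\<lambda>n. Y (Suc n) x - Y n x)"
      by (rule summable_comparison_test[OF _ summable_mult2[OF sc, of "norm x"]])
        (use Ydiff in blast)
    then have "(\<lambda>n. \<Sum>k<n. Y (Suc k) x - Y k x) \<longlonglongrightarrow> (\<Sum>k. Y (Suc k) x - Y k x)"
      by (rule summable_LIMSEQ)
    moreover have "(\<lambda>n. \<Sum>k<n. Y (Suc k) x - Y k x) = (\<lambda>n. Y n x)"
      using sum_lessThan_telescope[of "\<lambda>k. Y k x"] by (simp add: Y0)
    ultimately show ?thesis by auto
  qed
  then obtain S where S: "\<And>x. (\<lambda>n. Y n x) \<longlonglongrightarrow> S x" by metis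
  have SL: "S (x + y) = S x + S y" for x y
    by (rule LIMSEQ_unique[OF S]) (unfold YL, intro tendsto_add S)
  have SC: "S (a *\<^sub>C x) = a *\<^sub>C S x" for a x
    by (rule LIMSEQ_unique[OF S]) (unfold YC, intro tendsto_scaleC tendsto_const S)
  have Y1: "norm (Y n x) \<le> norm x" for n x
    using order_trans[OF Ybound mult_right_mono[OF c(2)]] by simp
  have Sn: "norm (S x) \<le> norm x" for x
    by (rule LIMSEQ_le_const2[OF tendsto_norm[OF S]]) (use Y1 in blast)
  have YY: "(\<lambda>n. Y n (Y n x)) \<longlonglongrightarrow> S (S x)" for x
  proof -
    have "(\<lambda>n. Y n (Y n x - S x)) \<longlonglongrightarrow> 0"
    proof (rule Lim_null_comparison)
      show "\<forall>\<^sub>F n in sequentially. norm (Y n (Y n x - S x)) \<le> norm (Y n x - S x)"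
        by (simp add: Y1)
      show "(\<lambda>n. norm (Y n x - S x)) \<longlonglongrightarrow> 0"
        using tendsto_norm[OF tendsto_diff[OF S[of x] tendsto_const[of "S x"]]] by simp
    qed
    from tendsto_add[OF this S[of "S x"]] show ?thesis by (simp add: Yminus)
  qed
  have fix_eq: "S x = (1/2) *\<^sub>C (B x + S (S x))" for x
  proof (rule LIMSEQ_unique)
    show "(\<lambda>n. Y (Suc n) x) \<longlonglongrightarrow> S x" by (rule LIMSEQ_Suc[OF S])
    show "(\<lambda>n. Y (Suc n) x) \<longlonglongrightarrow> (1/2) *\<^sub>C (B x + S (S x))"
      unfolding YS by (intro tendsto_scaleC tendsto_add tendsto_const YY)
  qed
  define R where "R = (\<lambda>x. x - S x)"
  have Ssa: "cinner (S x) y = cinner x (S y)" for x y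
  proof (rule LIMSEQ_unique)
    have "cinner (Y n x) y = cinner x (Y n y)" for n x y
      by (induction n arbitrary: x y) (simp_all add: Y0 YS cinner_algebra Bsa)
    then show "(\<lambda>n. cinner (Y n x) y) \<longlonglongrightarrow> cinner x (S y)"
      by (simp add: tendsto_cinner[OF tendsto_const S])
  qed (rule tendsto_cinner[OF S tendsto_const])
  have "positive_op R"
    unfolding positive_op_def
  proof (intro conjI allI)
    show "bounded_clinear R"
    proof (rule bounded_clinearI[where K = 2])
      show "norm (R x) \<le> 2 * norm x" for x
        using norm_triangle_ineq4[of x "S x"] Sn[of x] by (simp add: R_def)
    qed (simp_all add: R_def SL SC scaleC_diff_right)
    have "cnj (cinner (S x) x) = cinner (S x) x" for x
      using Ssa[of x x] cinner_commute[of x "S x"] by simp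
    then have "Im (cinner (S x) x) = 0" for x
      by (simp add: complex_eq_iff)
    then show "cinner (R x) x \<in> \<real>" for x
      by (simp add: R_def cinner_algebra cinner_same complex_is_Real_iff)
    show "0 \<le> Re (cinner (R x) x)" for x
    proof -
      have "Re (cinner (S x) x) \<le> norm (S x) * norm x"
        using cmod_cinner_le[of "S x" x] complex_Re_le_cmod order_trans by blast
      also have "\<dots> \<le> (norm x)\<^sup>2" using Sn[of x] by (simp add: power2_eq_square mult_right_mono)
      finally show ?thesis by (simp add: R_def cinner_algebra cinner_norm_square)
    qed
  qed
  moreover have "R \<circ> R = A"
  proof
    fix x
    have 1: "S (x - S x) = S x - S (S x)" using SL[of "x - S x" "S x"] by (simp add: eq_diff_eq)
    have "S x + S x = B x + S (S x)"
      by (subst (1 2) fix_eq) (simp flip: scaleC_add_left)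
    then have 2: "A x = x + S (S x) - S x - S x" by (simp add: B_def algebra_simps)
    show "(R \<circ> R) x = A x" by (simp only: R_def o_apply 1 2) (simp add: algebra_simps)
  qed
  moreover have "C (R x) = R (C x)" if C: "bounded_clinear C" "\<forall>x. C (A x) = A (C x)" for C x
  proof -
    have "C (Y n x) = Y n (C x)" for n x
      by (induction n arbitrary: x) (simp_all add: Y0 YS B_def bounded_clinearD[OF C(1)] C(2))
    then have "C (S x) = S (C x)"
      by (intro LIMSEQ_unique[OF tendsto_bounded_clinear[OF C(1) S]]) (simp add: S)
    then show ?thesis by (simp add: R_def bounded_clinearD[OF C(1)])
  qed
  ultimately show ?thesis by blast
qed

text \<open>A second root \<open>B\<close> commutes with \<open>A = B\<^sup>2\<close>, hence with the root \<open>S\<close> constructed above.  Then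
  \<open>(B + S) (B - S) = 0\<close>, so for \<open>y = (B - S) x\<close> the two positive numbers \<open>\<langle>B y, y\<rangle>\<close> and
  \<open>\<langle>S y, y\<rangle>\<close> add up to \<open>0\<close>.\<close>

lemma pos_sqrt:
  fixes A :: "'a::chilbert_space \<Rightarrow> 'a"
  assumes A: "positive_op A" and le: "\<And>x. norm (x - A x) \<le> norm x"
  shows "positive_op (pos_sqrt A)" "pos_sqrt A (pos_sqrt A x) = A x"
proof -
  obtain S where S: "positive_op S" "S \<circ> S = A"
    and comm: "\<And>C x. bounded_clinear C \<Longrightarrow> \<forall>x. C (A x) = A (C x) \<Longrightarrow> C (S x) = S (C x)"
    using sqrt_exists[OF A le] by blast
  note LS = bounded_clinearD[OF positive_opD(1)[OF S(1)]]
  have unique: "B = S" if B: "positive_op B" "B \<circ> B = A" for B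
  proof
    fix x
    note LB = bounded_clinearD[OF positive_opD(1)[OF B(1)]]
    have BS: "B (S z) = S (B z)" for z
      by (rule comm) (use B in \<open>auto simp: positive_op_def fun_eq_iff\<close>, metis)
    define y where "y = B x - S x"
    have "B y + S y = 0"
      using B(2) S(2) by (simp add: y_def LB LS BS fun_eq_iff)
    then have "cinner (B y) y + cinner (S y) y = 0"
      by (simp add: cinner_add_left[symmetric])
    then have "Re (cinner (B y) y) + Re (cinner (S y) y) = 0"
      by (simp add: complex_eq_iff)
    then have "Re (cinner (B y) y) = 0" "Re (cinner (S y) y) = 0"
      using positive_opD(2)[OF B(1), of y] positive_opD(2)[OF S(1), of y] by linarith+
    then have 0: "B y = 0" "S y = 0"
      by (auto intro: positive_op_eq_0[OF B(1)] positive_op_eq_0[OF S(1)])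
    have "cinner y y = cinner (B x) y - cinner (S x) y"
      by (subst y_def) (rule cinner_diff_left)
    also have "\<dots> = cinner x (B y) - cinner x (S y)"
      by (simp only: positive_op_selfadjoint[OF B(1)] positive_op_selfadjoint[OF S(1)])
    finally have "cinner y y = 0" by (simp add: 0)
    then show "B x = S x" using cinner_eq_0_imp_eq_0[of y] by (simp add: y_def)
  qed
  have "pos_sqrt A = S"
    unfolding pos_sqrt_def
    by (rule the_equality) (simp_all only: S unique simp_thms)
  then show "positive_op (pos_sqrt A)" "pos_sqrt A (pos_sqrt A x) = A x"
    using S(1) fun_cong[OF S(2), of x] by simp_all
qed

lemma norm_pos_sqrt:
  fixes A :: "'a::chilbert_space \<Rightarrow> 'a"
  assumes A: "positive_op A" and le: "\<And>x. norm (x - A x) \<le> norm x"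
  shows "(norm (pos_sqrt A x))\<^sup>2 = Re (cinner (A x) x)"
  using pos_sqrt[OF A le] positive_op_selfadjoint[OF pos_sqrt(1)[OF A le], of "pos_sqrt A x" x]
  by (simp add: cinner_norm_square)

lemma positive_op_defect:
  fixes A :: "'a::chilbert_space \<Rightarrow> 'b::chilbert_space"
  assumes A: "contraction A"
  shows "positive_op (\<lambda>x. x - cadj A (A x))" "norm (x - (x - cadj A (A x))) \<le> norm x"
    "Re (cinner (x - cadj A (A x)) x) = (norm x)\<^sup>2 - (norm (A x))\<^sup>2"
proof -
  note L = bounded_clinearD[OF contractionD(1)[OF A]]
  note A' = contraction_cadj[OF A]
  note L' = bounded_clinearD[OF contractionD(1)[OF A']]
  have le: "norm (cadj A (A x)) \<le> norm x" for x
    by (rule order_trans[OF contractionD(2)[OF A'] contractionD(2)[OF A]])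
  then show "norm (x - (x - cadj A (A x))) \<le> norm x" by simp
  have form: "cinner (x - cadj A (A x)) x = of_real ((norm x)\<^sup>2 - (norm (A x))\<^sup>2)" for x
    by (simp add: cinner_diff_left cinner_cadj_left[OF contractionD(1)[OF A]] cinner_norm_square)
  show "Re (cinner (x - cadj A (A x)) x) = (norm x)\<^sup>2 - (norm (A x))\<^sup>2"
    unfolding form by simp
  show "positive_op (\<lambda>x. x - cadj A (A x))"
    unfolding positive_op_def
  proof (intro conjI allI)
    show "bounded_clinear (\<lambda>x. x - cadj A (A x))"
    proof (rule bounded_clinearI[where K = 2])
      show "norm (x - cadj A (A x)) \<le> 2 * norm x" for x
        using norm_triangle_ineq4[of x "cadj A (A x)"] le[of x] by simp
    qed (simp_all add: L L' scaleC_diff_right)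
    show "cinner (x - cadj A (A x)) x \<in> \<real>" for x by (simp only: form Reals_of_real)
    show "0 \<le> Re (cinner (x - cadj A (A x)) x)" for x
      unfolding form using contractionD(2)[OF A, of x] by simp
  qed
qed

lemma positive_op_defect_op: "contraction A \<Longrightarrow> positive_op (defect A)"
  for A :: "'a::chilbert_space \<Rightarrow> 'b::chilbert_space"
  unfolding defect_def by (intro pos_sqrt(1) positive_op_defect)

lemma norm_defect:
  fixes A :: "'a::chilbert_space \<Rightarrow> 'b::chilbert_space"
  shows "contraction A \<Longrightarrow> (norm (defect A x))\<^sup>2 = (norm x)\<^sup>2 - (norm (A x))\<^sup>2"
  unfolding defect_def by (simp only: norm_pos_sqrt[OF positive_op_defect(1,2)] positive_op_defect(3))

lemma closed_csubspace_closure_range_op: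
  "bounded_clinear A \<Longrightarrow> closed_csubspace (closure (range A))"
  by (intro closed_csubspace_closure_range) (simp_all add: bounded_clinearD)

lemma closed_csubspace_defect_space:
  "contraction A \<Longrightarrow> closed_csubspace (defect_space A)"
  for A :: "'a::chilbert_space \<Rightarrow> 'b::chilbert_space"
  unfolding defect_space_def
  by (intro closed_csubspace_closure_range_op positive_opD(1)[OF positive_op_defect_op])

lemma defect_in_defect_space: "defect A x \<in> defect_space A"
  unfolding defect_space_def by (rule subsetD[OF closure_subset rangeI])


section \<open>The strong limit of \<open>T\<^sup>n T*\<^sup>n\<close>\<close>

lemma cinner_funpow_cadj:
  fixes T :: "'a::chilbert_space \<Rightarrow> 'a"
  assumes "bounded_clinear T"
  shows "cinner ((T ^^ n) x) y = cinner x ((cadj T ^^ n) y)"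
proof (induction n arbitrary: x)
  case (Suc n)
  have "cinner ((T ^^ Suc n) x) y = cinner (T x) ((cadj T ^^ n) y)"
    by (simp only: funpow_Suc_right o_apply Suc)
  then show ?case by (simp add: cinner_cadj_right[OF assms])
qed simp

definition power_limit :: "('a::complex_inner \<Rightarrow> 'a) \<Rightarrow> 'a \<Rightarrow> 'a" where
  "power_limit T h = lim (\<lambda>n. (T ^^ n) ((cadj T ^^ n) h))"

context
  fixes T :: "'a::chilbert_space \<Rightarrow> 'a"
  assumes T: "contraction T"
begin

lemma norm_funpow_cadj_convergent: "convergent (\<lambda>n. (norm ((cadj T ^^ n) x))\<^sup>2)"
proof -
  have "decseq (\<lambda>n. (norm ((cadj T ^^ n) x))\<^sup>2)"
    by (intro decseq_SucI power_mono) (simp_all add: contractionD(2)[OF contraction_cadj[OF T]])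
  then show ?thesis
    by (rule decseq_convergent[where B = 0]) (auto simp: convergent_def)
qed

text \<open>The operators \<open>T\<^sup>n T*\<^sup>n\<close> decrease.  For \<open>m \<le> n\<close> the difference \<open>B\<close> of two of them is positive
  with norm at most \<open>2\<close>, so \<open>\<parallel>B x\<parallel>\<^sup>2 \<le> 2 \<langle>B x, x\<rangle> = 2 (\<parallel>T*\<^sup>m x\<parallel>\<^sup>2 - \<parallel>T*\<^sup>n x\<parallel>\<^sup>2)\<close> and pointwise
  convergence follows from that of the decreasing sequence of norms.\<close>

lemma power_limit_LIMSEQ: "(\<lambda>n. (T ^^ n) ((cadj T ^^ n) x)) \<longlonglongrightarrow> power_limit T x"
proof -
  note T' = contraction_cadj[OF T]
  note L = bounded_clinear_funpow[OF contractionD(1)[OF T]] bounded_clinear_funpow[OF contractionD(1)[OF T']]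
  define D where "D = (\<lambda>n x. (T ^^ n) ((cadj T ^^ n) x))"
  have form: "cinner (D n x) x = of_real ((norm ((cadj T ^^ n) x))\<^sup>2)" for n x
    by (simp add: D_def cinner_funpow_cadj[OF contractionD(1)[OF T]] cinner_norm_square)
  have D1: "norm (D n x) \<le> norm x" for n x
    unfolding D_def by (rule order_trans[OF contraction_funpow_norm[OF T] contraction_funpow_norm[OF T']])
  have dec: "norm ((cadj T ^^ n) x) \<le> norm ((cadj T ^^ m) x)" if "m \<le> n" for m n x
    using contraction_funpow_norm[OF T', of "n - m" "(cadj T ^^ m) x"]
      funpow_add[of "n - m" m "cadj T"] that by simp
  have est: "(norm (D m x - D n x))\<^sup>2 \<le> 2 * ((norm ((cadj T ^^ m) x))\<^sup>2 - (norm ((cadj T ^^ n) x))\<^sup>2)"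
    if mn: "m \<le> n" for m n
  proof -
    have bound: "norm (D m x - D n x) \<le> 2 * norm x" for x
      using norm_triangle_ineq4[of "D m x" "D n x"] D1[of m x] D1[of n x] by simp
    have form': "cinner (D m x - D n x) x = of_real ((norm ((cadj T ^^ m) x))\<^sup>2 - (norm ((cadj T ^^ n) x))\<^sup>2)" for x
      by (simp add: cinner_diff_left form)
    have "positive_op (\<lambda>x. D m x - D n x)"
      unfolding positive_op_def
    proof (intro conjI allI)
      show "bounded_clinear (\<lambda>x. D m x - D n x)"
        by (rule bounded_clinearI[OF _ _ bound]) (simp_all add: D_def L scaleC_diff_right)
      show "cinner (D m x - D n x) x \<in> \<real>" for x by (simp only: form' Reals_of_real)
      show "0 \<le> Re (cinner (D m x - D n x) x)" for x
        unfolding form' using dec[OF mn, of x] by simp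
    qed
    from positive_op_norm_square_le[OF this bound, of x] show ?thesis unfolding form' by simp
  qed
  have "Cauchy (\<lambda>n. D n x)"
  proof (rule metric_CauchyI)
    fix e :: real assume "e > 0"
    then have e: "e\<^sup>2 / 2 > 0" by simp
    obtain N where N: "\<And>m n. m \<ge> N \<Longrightarrow> n \<ge> N \<Longrightarrow>
        dist ((norm ((cadj T ^^ m) x))\<^sup>2) ((norm ((cadj T ^^ n) x))\<^sup>2) < e\<^sup>2 / 2"
      using metric_CauchyD[OF convergent_Cauchy[OF norm_funpow_cadj_convergent[of x]] e] by blast
    have *: "dist (D m x) (D n x) < e" if "m \<ge> N" "n \<ge> N" "m \<le> n" for m n
    proof -
      have "(norm (D m x - D n x))\<^sup>2 < e\<^sup>2"
        using est[OF that(3)] N[OF that(1,2)] by (simp only: dist_real_def) argo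
      then show ?thesis using \<open>e > 0\<close> by (simp add: dist_norm power_less_imp_less_base)
    qed
    have "dist (D m x) (D n x) < e" if "m \<ge> N" "n \<ge> N" for m n
      using *[of m n] *[of n m] that by (metis dist_commute nle_le)
    then show "\<exists>M. \<forall>m\<ge>M. \<forall>n\<ge>M. dist (D m x) (D n x) < e" by blast
  qed
  then show ?thesis
    unfolding power_limit_def D_def using Cauchy_convergent convergent_LIMSEQ_iff by blast
qed

lemma power_limit_norm_LIMSEQ:
  "(\<lambda>n. (norm ((cadj T ^^ n) x))\<^sup>2) \<longlonglongrightarrow> Re (cinner (power_limit T x) x)"
proof -
  have "(\<lambda>n. cinner ((T ^^ n) ((cadj T ^^ n) x)) x) \<longlonglongrightarrow> cinner (power_limit T x) x"
    by (intro tendsto_cinner power_limit_LIMSEQ tendsto_const)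
  from tendsto_Re[OF this] show ?thesis
    by (simp add: cinner_funpow_cadj[OF contractionD(1)[OF T]] cinner_norm_square)
qed

lemma contraction_power_limit: "contraction (power_limit T)"
proof (rule contractionI)
  note L = bounded_clinear_funpow[OF contractionD(1)[OF T]]
    bounded_clinear_funpow[OF contractionD(1)[OF contraction_cadj[OF T]]]
  show "power_limit T (x + y) = power_limit T x + power_limit T y" for x y
    by (rule LIMSEQ_unique[OF power_limit_LIMSEQ]) (unfold L, intro tendsto_add power_limit_LIMSEQ)
  show "power_limit T (c *\<^sub>C x) = c *\<^sub>C power_limit T x" for c x
    by (rule LIMSEQ_unique[OF power_limit_LIMSEQ])
      (unfold L, intro tendsto_scaleC tendsto_const power_limit_LIMSEQ)
  show "norm (power_limit T x) \<le> norm x" for x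
    by (rule LIMSEQ_le_const2[OF tendsto_norm[OF power_limit_LIMSEQ]])
      (use order_trans[OF contraction_funpow_norm[OF T] contraction_funpow_norm[OF contraction_cadj[OF T]]] in blast)
qed

lemma positive_op_power_limit: "positive_op (power_limit T)"
  unfolding positive_op_def
proof (intro conjI allI)
  show "bounded_clinear (power_limit T)" by (rule contractionD(1)[OF contraction_power_limit])
  have "(\<lambda>n. cinner ((T ^^ n) ((cadj T ^^ n) x)) x) \<longlonglongrightarrow> cinner (power_limit T x) x" for x
    by (intro tendsto_cinner power_limit_LIMSEQ tendsto_const)
  then have "(\<lambda>n. Im (cinner ((T ^^ n) ((cadj T ^^ n) x)) x)) \<longlonglongrightarrow> Im (cinner (power_limit T x) x)" for x
    by (rule tendsto_Im)
  then have "Im (cinner (power_limit T x) x) = 0" for x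
    by (simp add: cinner_funpow_cadj[OF contractionD(1)[OF T]] cinner_norm_square LIMSEQ_const_iff)
  then show "cinner (power_limit T x) x \<in> \<real>" for x by (simp add: complex_is_Real_iff)
  show "0 \<le> Re (cinner (power_limit T x) x)" for x
    by (rule LIMSEQ_le_const[OF power_limit_norm_LIMSEQ]) simp
qed

lemma power_limit_complement_norm: "norm (x - power_limit T x) \<le> norm x"
proof -
  have "(norm (power_limit T x))\<^sup>2 \<le> Re (cinner (power_limit T x) x)"
    using positive_op_norm_square_le[OF positive_op_power_limit, of 1 x] contractionD(2)[OF contraction_power_limit]
    by simp
  moreover have "(norm (x - power_limit T x))\<^sup>2 =
      (norm x)\<^sup>2 + (norm (power_limit T x))\<^sup>2 - 2 * Re (cinner (power_limit T x) x)"
    using inner_commute[of x "power_limit T x"] inner_eq_Re_cinner[of "power_limit T x" x]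
    by (simp add: power2_norm_eq_inner inner_diff_left inner_diff_right)
  moreover have "0 \<le> Re (cinner (power_limit T x) x)"
    by (rule positive_opD(2)[OF positive_op_power_limit])
  ultimately have "(norm (x - power_limit T x))\<^sup>2 \<le> (norm x)\<^sup>2" by linarith
  then show ?thesis by (rule power2_le_imp_le) simp
qed

lemma Q_star_eq: "Q_star T = pos_sqrt (power_limit T)"
  by (simp add: Q_star_def power_limit_def[abs_def])

lemma bounded_clinear_Q_star: "bounded_clinear (Q_star T)"
  unfolding Q_star_eq
  by (intro positive_opD(1) pos_sqrt(1) positive_op_power_limit power_limit_complement_norm)

lemma norm_Q_star: "(norm (Q_star T x))\<^sup>2 = Re (cinner (power_limit T x) x)"
  unfolding Q_star_eq by (intro norm_pos_sqrt positive_op_power_limit power_limit_complement_norm)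

lemma norm_Q_star_LIMSEQ: "(\<lambda>n. (norm ((cadj T ^^ n) x))\<^sup>2) \<longlonglongrightarrow> (norm (Q_star T x))\<^sup>2"
  unfolding norm_Q_star by (rule power_limit_norm_LIMSEQ)

text \<open>Telescoping \<open>\<parallel>D h\<parallel>\<^sup>2 = \<parallel>h\<parallel>\<^sup>2 - \<parallel>T* h\<parallel>\<^sup>2\<close> along the orbit of \<open>T*\<close>.\<close>

lemma defect_orbit_sums:
  "(\<lambda>n. (norm (defect (cadj T) ((cadj T ^^ n) x)))\<^sup>2) sums ((norm x)\<^sup>2 - (norm (Q_star T x))\<^sup>2)"
  using telescope_sums'[OF norm_Q_star_LIMSEQ[of x]]
  by (simp add: norm_defect[OF contraction_cadj[OF T]])

end

section \<open>Operators on a closed subspace\<close>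

definition contraction_on :: "'a::complex_inner set \<Rightarrow> ('a \<Rightarrow> 'b::complex_inner) \<Rightarrow> bool" where
  "contraction_on S A \<longleftrightarrow> clinear_on S A \<and> (\<forall>x\<in>S. norm (A x) \<le> norm x)"

lemma contraction_onD:
  assumes "contraction_on S A" "closed_csubspace S"
  shows "x \<in> S \<Longrightarrow> y \<in> S \<Longrightarrow> A (x + y) = A x + A y" "x \<in> S \<Longrightarrow> A (c *\<^sub>C x) = c *\<^sub>C A x"
    "x \<in> S \<Longrightarrow> norm (A x) \<le> norm x" "A 0 = 0"
    "x \<in> S \<Longrightarrow> y \<in> S \<Longrightarrow> A (x - y) = A x - A y"
proof -
  show *: "x \<in> S \<Longrightarrow> y \<in> S \<Longrightarrow> A (x + y) = A x + A y" "x \<in> S \<Longrightarrow> A (c *\<^sub>C x) = c *\<^sub>C A x"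
    "x \<in> S \<Longrightarrow> norm (A x) \<le> norm x" for x y c
    using assms(1) by (auto simp: contraction_on_def clinear_on_def)
  show "A 0 = 0" using *(3)[of 0] closed_csubspaceD(2)[OF assms(2)] by simp
  show "x \<in> S \<Longrightarrow> y \<in> S \<Longrightarrow> A (x - y) = A x - A y"
    using *(1)[of "x - y" y] closed_csubspaceD(5)[OF assms(2), of x y] by simp
qed

lemma contraction_on_isometry: "isometry_into S S' A \<Longrightarrow> contraction_on S A"
  by (simp add: contraction_on_def isometry_into_def)

lemma contraction_on_contraction: "contraction A \<Longrightarrow> contraction_on S A"
  by (simp add: contraction_on_def clinear_on_def bounded_clinearD contractionD)

lemma contraction_on_comp:
  assumes "contraction_on S B" "B ` S \<subseteq> S'" "contraction_on S' A"
  shows "contraction_on S (\<lambda>x. A (B x))"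
  unfolding contraction_on_def clinear_on_def
proof (intro conjI ballI allI)
  note A = assms(3)[unfolded contraction_on_def clinear_on_def]
  note B = assms(1)[unfolded contraction_on_def clinear_on_def]
  have BS: "B x \<in> S'" if "x \<in> S" for x using assms(2) that by blast
  show "A (B (x + y)) = A (B x) + A (B y)" if "x \<in> S" "y \<in> S" for x y
    using A B BS that by simp
  show "A (B (c *\<^sub>C x)) = c *\<^sub>C A (B x)" if "x \<in> S" for x c
    using A B BS that by simp
  show "norm (A (B x)) \<le> norm x" if "x \<in> S" for x
    using order_trans[of "norm (A (B x))" "norm (B x)"] A B BS that by simp
qed

lemma contraction_on_tendsto:
  assumes A: "contraction_on S A" "closed_csubspace S" and X: "\<And>n. X n \<in> S" "X \<longlonglongrightarrow> x"
  shows "(\<lambda>n. A (X n)) \<longlonglongrightarrow> A x"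
proof -
  have x: "x \<in> S" using closed_sequentially[OF closed_csubspaceD(1)[OF A(2)] X] .
  have "(\<lambda>n. norm (X n - x)) \<longlonglongrightarrow> 0"
    using tendsto_norm[OF LIM_zero[OF X(2)]] by simp
  moreover have "norm (A (X n) - A x) \<le> norm (X n - x)" for n
    using contraction_onD(3)[OF A, of "X n - x"] contraction_onD(5)[OF A X(1) x]
      closed_csubspaceD(5)[OF A(2) X(1) x] by simp
  ultimately have "(\<lambda>n. A (X n) - A x) \<longlonglongrightarrow> 0"
    by (rule Lim_null_comparison[OF always_eventually[OF allI], rotated])
  then show ?thesis by (rule LIM_zero_cancel)
qed

lemma closed_csubspace_sum:
  "closed_csubspace S \<Longrightarrow> (\<And>n. a n \<in> S) \<Longrightarrow> (\<Sum>n\<in>I. a n) \<in> S"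
  by (induction I rule: infinite_finite_induct) (auto simp: closed_csubspaceD)

lemma closed_csubspace_sums:
  assumes "closed_csubspace S" "\<And>n. a n \<in> S" "a sums s"
  shows "s \<in> S"
  by (rule closed_sequentially[OF closed_csubspaceD(1)[OF assms(1)] _ assms(3)[unfolded sums_def]])
    (rule closed_csubspace_sum[OF assms(1,2)])

lemma contraction_on_sums:
  assumes A: "contraction_on S A" "closed_csubspace S" and a: "\<And>n. a n \<in> S" "a sums s"
  shows "(\<lambda>n. A (a n)) sums A s"
proof -
  have "A (\<Sum>k<n. a k) = (\<Sum>k<n. A (a k))" for n
    by (induction n)
      (simp_all add: contraction_onD[OF A] closed_csubspace_sum[OF A(2)] a(1))
  then show ?thesis
    using contraction_on_tendsto[OF A closed_csubspace_sum[OF A(2) a(1)] a(2)[unfolded sums_def]]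
    by (simp add: sums_def)
qed

text \<open>The set on which two contractions agree is a closed subspace.\<close>

lemma eq_on_hull:
  assumes fg: "contraction_on M f" "contraction_on M g" and M: "M = closed_csubspace hull G"
    and G: "\<And>x. x \<in> G \<Longrightarrow> f x = g x" and x: "x \<in> M"
  shows "f x = g x"
proof -
  have cM: "closed_csubspace M" unfolding M by (rule closed_csubspace_hull)
  note f = contraction_onD[OF fg(1) cM] and g = contraction_onD[OF fg(2) cM]
  define E where "E = {x \<in> M. f x = g x}"
  have "closed E"
    unfolding closed_sequential_limits
  proof (intro allI impI, elim conjE)
    fix X l assume X: "\<forall>n. X n \<in> E" "X \<longlonglongrightarrow> l"
    then have XM: "X n \<in> M" for n by (simp add: E_def)
    have "(\<lambda>n. f (X n)) \<longlonglongrightarrow> g l"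
      using contraction_on_tendsto[OF fg(2) cM XM X(2)] X(1) by (simp add: E_def)
    then have "f l = g l"
      using contraction_on_tendsto[OF fg(1) cM XM X(2)] LIMSEQ_unique by blast
    moreover have "l \<in> M" using closed_sequentially[OF closed_csubspaceD(1)[OF cM] XM X(2)] .
    ultimately show "l \<in> E" by (simp add: E_def)
  qed
  then have "closed_csubspace E"
    unfolding closed_csubspace_def E_def
    by (auto simp: f g closed_csubspaceD[OF cM])
  moreover have "G \<subseteq> E"
    using hull_subset[of G closed_csubspace] G by (auto simp: E_def M)
  ultimately have "M \<subseteq> E" unfolding M by (rule closed_csubspace_hull_least)
  then show ?thesis using x by (auto simp: E_def)
qed

lemma hull_range_eq_closure:
  assumes "bounded_clinear A"
  shows "closed_csubspace hull range A = closure (range A)"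
proof
  show "closed_csubspace hull range A \<subseteq> closure (range A)"
    by (intro closed_csubspace_hull_least closed_csubspace_closure_range_op assms closure_subset)
  show "closure (range A) \<subseteq> closed_csubspace hull range A"
    by (intro closure_minimal hull_subset closed_csubspaceD(1) closed_csubspace_hull)
qed

section \<open>Unitaries from Gram matrices\<close>

text \<open>If the images of a sequence in \<open>S\<close> converge, the lower bound makes the sequence itself Cauchy.\<close>

lemma closed_csubspace_image_bounded_below:
  fixes f :: "'a::chilbert_space \<Rightarrow> 'b::complex_inner"
  assumes S: "closed_csubspace S" and f: "bounded_clinear f"
    and below: "\<And>x. x \<in> S \<Longrightarrow> norm x \<le> K * norm (f x)"
  shows "closed_csubspace (f ` S)"
  unfolding closed_csubspace_def
proof (intro conjI ballI allI)
  note S' = closed_csubspaceD[OF S] and L = bounded_clinearD[OF f]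
  show "0 \<in> f ` S" using S'(2) L(6) by (intro image_eqI[of _ _ 0]) simp_all
  show "x + y \<in> f ` S" if xy: "x \<in> f ` S" "y \<in> f ` S" for x y
  proof -
    obtain a b where "a \<in> S" "b \<in> S" "x = f a" "y = f b" using xy by blast
    then show ?thesis using L(2)[of a b] S'(3)[of a b] by (intro image_eqI[of _ _ "a + b"]) auto
  qed
  show "c *\<^sub>C x \<in> f ` S" if x: "x \<in> f ` S" for c x
  proof -
    obtain a where "a \<in> S" "x = f a" using x by blast
    then show ?thesis using L(5)[of c a] S'(4)[of a c] by (intro image_eqI[of _ _ "c *\<^sub>C a"]) auto
  qed
  show "closed (f ` S)"
    unfolding closed_sequential_limits
  proof (intro allI impI, elim conjE)
    fix X y assume X: "\<forall>n. X n \<in> f ` S" "X \<longlonglongrightarrow> y"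
    then have "\<forall>n. \<exists>p. p \<in> S \<and> X n = f p" by blast
    then obtain P where P: "\<And>n. P n \<in> S" "\<And>n. X n = f (P n)" by metis
    have "Cauchy P"
    proof (rule metric_CauchyI)
      fix e :: real assume "e > 0"
      then have "e / (\<bar>K\<bar> + 1) > 0" by simp
      then obtain N where N: "\<And>m n. m \<ge> N \<Longrightarrow> n \<ge> N \<Longrightarrow> dist (X m) (X n) < e / (\<bar>K\<bar> + 1)"
        using metric_CauchyD[OF LIMSEQ_imp_Cauchy[OF X(2)]] by blast
      have "dist (P m) (P n) < e" if "m \<ge> N" "n \<ge> N" for m n
      proof -
        have "norm (P m - P n) \<le> K * dist (X m) (X n)"
          using below[OF S'(5)[OF P(1) P(1)], of m n] by (simp add: P(2) L(3) dist_norm)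
        also have "\<dots> \<le> (\<bar>K\<bar> + 1) * dist (X m) (X n)" by (rule mult_right_mono) auto
        also have "\<dots> < (\<bar>K\<bar> + 1) * (e / (\<bar>K\<bar> + 1))"
          by (rule mult_strict_left_mono[OF N[OF that]]) simp
        finally show ?thesis by (simp add: dist_norm)
      qed
      then show "\<exists>M. \<forall>m\<ge>M. \<forall>n\<ge>M. dist (P m) (P n) < e" by blast
    qed
    then obtain x where x: "P \<longlonglongrightarrow> x" using Cauchy_convergent convergent_def by blast
    then have "X \<longlonglongrightarrow> f x" using tendsto_bounded_clinear[OF f x] by (simp add: P(2)[abs_def])
    then show "y \<in> f ` S"
      using X(2) LIMSEQ_unique closed_sequentially[OF S'(1) P(1) x] by blast
  qed
qed

text \<open>Two families with the same Gram matrix are carried to each other by a unitary between their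
  closed spans.  Its graph is the closed span of the pairs \<open>(a i, b i)\<close> in the product space: by
  sesquilinearity and continuity the equality of the Gram matrices extends to all pairs in it.\<close>

theorem unitary_of_gram:
  fixes a :: "'i \<Rightarrow> 'a::chilbert_space" and b :: "'i \<Rightarrow> 'b::chilbert_space"
  assumes gram: "\<And>i j. cinner (a i) (a j) = cinner (b i) (b j)"
  shows "\<exists>\<tau>. unitary_onto (closed_csubspace hull range a) (closed_csubspace hull range b) \<tau> \<and>
    (\<forall>i. \<tau> (a i) = b i)"
proof -
  define \<Gamma> where "\<Gamma> = closed_csubspace hull range (\<lambda>i. (a i, b i))"
  have c\<Gamma>: "closed_csubspace \<Gamma>" unfolding \<Gamma>_def by (rule closed_csubspace_hull)
  note \<Gamma> = closed_csubspaceD[OF c\<Gamma>]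
  have gen: "(a i, b i) \<in> \<Gamma>" for i
    unfolding \<Gamma>_def using hull_subset[of "range (\<lambda>i. (a i, b i))"] by blast
  have lin: "bounded_clinear (fst :: 'a \<times> 'b \<Rightarrow> 'a)" "bounded_clinear (snd :: 'a \<times> 'b \<Rightarrow> 'b)"
    by (auto simp: bounded_clinear_def clinear_on_def scaleC_prod_def bounded_linear_fst bounded_linear_snd)
  have 1: "cinner (fst p) (a j) = cinner (snd p) (b j)" if "p \<in> \<Gamma>" for p j
  proof -
    have "\<Gamma> \<subseteq> {p. cinner (fst p) (a j) = cinner (snd p) (b j)}"
      unfolding \<Gamma>_def
      by (rule closed_csubspace_hull_least[OF closed_csubspace_cinner_eq[OF lin]]) (auto simp: gram)
    with that show ?thesis by auto
  qed
  have 2: "cinner (fst r) (fst p) = cinner (snd r) (snd p)" if "p \<in> \<Gamma>" "r \<in> \<Gamma>" for p r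
  proof -
    have "\<Gamma> \<subseteq> {r. cinner (fst r) (fst p) = cinner (snd r) (snd p)}"
      unfolding \<Gamma>_def
    proof (rule closed_csubspace_hull_least[OF closed_csubspace_cinner_eq[OF lin]], safe)
      fix i
      show "cinner (fst (a i, b i)) (fst p) = cinner (snd (a i, b i)) (snd p)"
        using 1[OF that(1), of i] by (metis cinner_commute fst_conv snd_conv)
    qed
    with that show ?thesis by auto
  qed
  have iso: "norm (fst p) = norm (snd p)" if "p \<in> \<Gamma>" for p
    using 2[OF that that] by (rule norm_eq_of_cinner_same)
  have iso_diff: "norm (fst p - fst r) = norm (snd p - snd r)" if "p \<in> \<Gamma>" "r \<in> \<Gamma>" for p r
    using iso[OF \<Gamma>(5)[OF that]] by simp
  define \<tau> where "\<tau> = (\<lambda>x. THE y. (x, y) \<in> \<Gamma>)"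
  have \<tau>: "\<tau> x = y" if "(x, y) \<in> \<Gamma>" for x y
    unfolding \<tau>_def using that iso_diff[OF _ that] by (intro the_equality) fastforce+
  have "norm p \<le> 2 * norm (fst p)" "norm p \<le> 2 * norm (snd p)" if "p \<in> \<Gamma>" for p
    using norm_Pair_le[of "fst p" "snd p"] iso[OF that] by auto
  then have closed_proj: "closed_csubspace (fst ` \<Gamma>)" "closed_csubspace (snd ` \<Gamma>)"
    using closed_csubspace_image_bounded_below[OF c\<Gamma> lin(1)]
      closed_csubspace_image_bounded_below[OF c\<Gamma> lin(2)] by blast+
  define A where "A = closed_csubspace hull range a"
  define B where "B = closed_csubspace hull range b"
  have cAB: "closed_csubspace (A \<times> B)"
    unfolding A_def B_def by (intro closed_csubspace_Times closed_csubspace_hull)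
  have "\<Gamma> \<subseteq> A \<times> B"
    unfolding \<Gamma>_def
  proof (rule closed_csubspace_hull_least[OF cAB], safe)
    fix i
    show "a i \<in> A" "b i \<in> B"
      unfolding A_def B_def using hull_subset[of "range a" closed_csubspace] hull_subset[of "range b" closed_csubspace] by blast+
  qed
  moreover have "A \<subseteq> fst ` \<Gamma>" unfolding A_def
    by (rule closed_csubspace_hull_least[OF closed_proj(1)]) (use gen in force)
  moreover have "B \<subseteq> snd ` \<Gamma>" unfolding B_def
    by (rule closed_csubspace_hull_least[OF closed_proj(2)]) (use gen in force)
  ultimately have A: "A = fst ` \<Gamma>" and B: "B = snd ` \<Gamma>" by force+
  have graph: "(x, \<tau> x) \<in> \<Gamma>" if "x \<in> A" for x
    using that \<tau> unfolding A by (metis imageE prod.collapse)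
  have "unitary_onto A B \<tau>"
    unfolding unitary_onto_def isometry_into_def clinear_on_def
  proof (intro conjI ballI allI)
    show "\<tau> (x + y) = \<tau> x + \<tau> y" if "x \<in> A" "y \<in> A" for x y
      by (rule \<tau>) (use \<Gamma>(3)[OF graph[OF that(1)] graph[OF that(2)]] in simp)
    show "\<tau> (c *\<^sub>C x) = c *\<^sub>C \<tau> x" if "x \<in> A" for c x
      by (rule \<tau>) (use \<Gamma>(4)[OF graph[OF that], of c] in \<open>simp add: scaleC_prod_def\<close>)
    show "norm (\<tau> x) = norm x" if "x \<in> A" for x
      using iso[OF graph[OF that]] by simp
    show im: "\<tau> ` A = B"
    proof
      show "\<tau> ` A \<subseteq> B" unfolding B using graph by force
      show "B \<subseteq> \<tau> ` A"
      proof
        fix y assume "y \<in> B"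
        then obtain x where "(x, y) \<in> \<Gamma>" unfolding B by force
        then have "x \<in> A" "y = \<tau> x" unfolding A using \<tau> by force+
        then show "y \<in> \<tau> ` A" by blast
      qed
    qed
    then show "\<tau> ` A \<subseteq> B" by simp
  qed
  with \<tau>[OF gen] show ?thesis unfolding A_def B_def by blast
qed


section \<open>Hardy space operators in terms of coefficients\<close>

lemma hardy_eval_sums:
  "cmod z < 1 \<Longrightarrow> (\<lambda>n. z ^ n *\<^sub>C hardy_coeff f n) sums hardy_eval f z"
  using hardy_coeff[of f] by (simp add: hardy_series_def)

lemma hardy_coeff_disk_fun:
  assumes "summable (\<lambda>n. (norm (a n))\<^sup>2)" "\<And>z. cmod z < 1 \<Longrightarrow> (\<lambda>n. z ^ n *\<^sub>C a n) sums g z"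
  shows "hardy_coeff (disk_fun g) = a"
proof (rule hardy_coeff_eqI)
  have *: "hardy_series a (\<lambda>z. if cmod z < 1 then g z else 0)"
    using assms by (simp add: hardy_series_def)
  show "hardy_series a (hardy_eval (disk_fun g))"
    unfolding disk_fun_def by (subst Abs_hardy_inverse) (use * in blast)+
qed

lemma hardy_coeff_disk_fun_series:
  assumes "summable (\<lambda>n. (norm (a n))\<^sup>2)"
  shows "hardy_coeff (disk_fun (\<lambda>z. \<Sum>n. z ^ n *\<^sub>C a n)) = a"
proof (rule hardy_coeff_disk_fun[OF assms])
  fix z :: complex assume "cmod z < 1"
  obtain f where "hardy_series a f" using hardy_series_exists[OF assms] by blast
  then have "(\<lambda>n. z ^ n *\<^sub>C a n) sums f z" using \<open>cmod z < 1\<close> by (simp add: hardy_series_def)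
  then show "(\<lambda>n. z ^ n *\<^sub>C a n) sums (\<Sum>n. z ^ n *\<^sub>C a n)" by (simp add: sums_iff)
qed

text \<open>If all values lie in \<open>F\<close>, then \<open>\<langle>f z, v\<rangle> = 0\<close> for every \<open>v\<close> orthogonal to \<open>F\<close>, so the
  coefficients are orthogonal to \<open>v\<close> by uniqueness of scalar power series.\<close>

lemma hardy_space_iff:
  assumes F: "closed_csubspace F"
  shows "f \<in> hardy_space F \<longleftrightarrow> (\<forall>n. hardy_coeff f n \<in> F)"
proof
  assume f: "f \<in> hardy_space F"
  show "\<forall>n. hardy_coeff f n \<in> F"
  proof (intro allI double_orthogonal_complement[OF F])
    fix n v assume v: "\<And>m. m \<in> F \<Longrightarrow> cinner m v = 0"
    show "cinner (hardy_coeff f n) v = 0"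
    proof (rule power_series_zero_coeff)
      fix z :: complex assume z: "cmod z < 1"
      then have "cinner (hardy_eval f z) v = 0" using f v by (simp add: hardy_space_def)
      then show "(\<lambda>n. cinner (hardy_coeff f n) v * z ^ n) sums 0"
        using bounded_linear.sums[OF cinner_bounded_linear hardy_eval_sums[OF z], of f v]
        by (simp add: mult.commute)
    qed
  qed
next
  assume f: "\<forall>n. hardy_coeff f n \<in> F"
  show "f \<in> hardy_space F"
    unfolding hardy_space_def
    using f by (auto intro: closed_csubspace_sums[OF F _ hardy_eval_sums] closed_csubspaceD(4)[OF F])
qed

lemma bounded_clinear_hardy_coeff:
  "bounded_clinear (\<lambda>f::'a::chilbert_space hardy. hardy_coeff f n)"
  by (rule bounded_clinearI[where K = 1]) (simp_all add: hardy_norm_coeff_le)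

lemma closed_csubspace_hardy_space:
  assumes F: "closed_csubspace F"
  shows "closed_csubspace (hardy_space F)"
proof -
  have "hardy_space F = (\<Inter>n. (\<lambda>f. hardy_coeff f n) -` F)"
    using hardy_space_iff[OF F] by blast
  moreover have "closed ((\<lambda>f::'a hardy. hardy_coeff f n) -` F)" for n
    by (intro continuous_closed_vimage closed_csubspaceD(1)[OF F] linear_continuous_at
        bounded_clinearD(1)[OF bounded_clinear_hardy_coeff])
  ultimately show ?thesis
    unfolding closed_csubspace_def[of "hardy_space F"]
    using closed_csubspaceD(2-4)[OF F] by (auto intro!: closed_INT)
qed

lemma hardy_cinner_sums:
  "(\<lambda>n. cinner (hardy_coeff f n) (hardy_coeff g n)) sums cinner f (g::'a::chilbert_space hardy)"
  unfolding cinner_hardy_def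
  by (intro summable_sums square_summable_cinner hardy_coeff_summable)

lemma hardy_coeff_rotation_op:
  assumes q: "cmod q = 1"
  shows "hardy_coeff (rotation_op q f) n = q ^ n *\<^sub>C hardy_coeff f n"
proof -
  have "hardy_coeff (rotation_op q f) = (\<lambda>n. q ^ n *\<^sub>C hardy_coeff f n)"
    unfolding rotation_op_def
  proof (rule hardy_coeff_disk_fun)
    show "summable (\<lambda>n. (norm (q ^ n *\<^sub>C hardy_coeff f n))\<^sup>2)"
      using hardy_coeff_summable[of f] by (simp add: norm_power q)
    fix z :: complex assume "cmod z < 1"
    then have "cmod (q * z) < 1" by (simp add: norm_mult q)
    then show "(\<lambda>n. z ^ n *\<^sub>C q ^ n *\<^sub>C hardy_coeff f n) sums hardy_eval f (q * z)"
      using hardy_eval_sums[of "q * z" f] by (simp add: power_mult_distrib mult.commute)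
  qed
  then show ?thesis by simp
qed

lemma rotation_op_in_hardy_space:
  "closed_csubspace F \<Longrightarrow> cmod q = 1 \<Longrightarrow> f \<in> hardy_space F \<Longrightarrow> rotation_op q f \<in> hardy_space F"
  by (simp add: hardy_space_iff hardy_coeff_rotation_op closed_csubspaceD)

lemma sums_case_nat_Suc:
  fixes b :: "nat \<Rightarrow> 'a::real_normed_vector"
  shows "b sums s \<Longrightarrow> (\<lambda>n. case n of 0 \<Rightarrow> 0 | Suc k \<Rightarrow> b k) sums s"
  using sums_Suc[of "\<lambda>n. case n of 0 \<Rightarrow> 0 | Suc k \<Rightarrow> b k" s] by simp

lemma square_summable_case_nat:
  fixes b :: "nat \<Rightarrow> 'a::real_inner"
  assumes "summable (\<lambda>n. (norm (b n))\<^sup>2)"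
  shows "summable (\<lambda>n. (norm (case n of 0 \<Rightarrow> 0 | Suc k \<Rightarrow> b k))\<^sup>2)"
  using assms by (subst summable_Suc_iff[symmetric]) simp

lemma hardy_coeff_mult_op_affine:
  assumes F: "closed_csubspace F" and AB: "contraction_on F A" "contraction_on F B"
    and f: "f \<in> hardy_space F"
    and \<phi>: "\<And>z v. v \<in> F \<Longrightarrow> \<phi> z v = A v + z *\<^sub>C B v"
  shows "hardy_coeff (mult_op \<phi> f) n =
    A (hardy_coeff f n) + (case n of 0 \<Rightarrow> 0 | Suc k \<Rightarrow> B (hardy_coeff f k))"
proof -
  have fF: "hardy_coeff f n \<in> F" for n using f by (simp add: hardy_space_iff[OF F])
  have sm: "summable (\<lambda>n. (norm (C (hardy_coeff f n)))\<^sup>2)" if "contraction_on F C" for C :: "'a \<Rightarrow> 'a"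
    by (rule summable_comparison_test[OF _ hardy_coeff_summable[of f]])
      (auto intro!: power_mono contraction_onD[OF that F] fF)
  have "hardy_coeff (mult_op \<phi> f) =
      (\<lambda>n. A (hardy_coeff f n) + (case n of 0 \<Rightarrow> 0 | Suc k \<Rightarrow> B (hardy_coeff f k)))"
    unfolding mult_op_def
  proof (rule hardy_coeff_disk_fun)
    show "summable (\<lambda>n. (norm (A (hardy_coeff f n) + (case n of 0 \<Rightarrow> 0 | Suc k \<Rightarrow> B (hardy_coeff f k))))\<^sup>2)"
      by (intro square_summable_add square_summable_case_nat sm AB)
    fix z :: complex assume z: "cmod z < 1"
    have C: "(\<lambda>n. z ^ n *\<^sub>C C (hardy_coeff f n)) sums C (hardy_eval f z)"
      if "contraction_on F C" for C :: "'a \<Rightarrow> 'a"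
      using contraction_on_sums[OF that F closed_csubspaceD(4)[OF F fF] hardy_eval_sums[OF z]]
      by (simp add: contraction_onD[OF that F] fF)
    have "(\<lambda>n. z *\<^sub>C (z ^ n *\<^sub>C B (hardy_coeff f n))) sums (z *\<^sub>C B (hardy_eval f z))"
      by (rule bounded_linear.sums[OF scaleC_bounded_linear C[OF AB(2)]])
    from sums_add[OF C[OF AB(1)] sums_case_nat_Suc[OF this]]
    have "(\<lambda>n. z ^ n *\<^sub>C (A (hardy_coeff f n) + (case n of 0 \<Rightarrow> 0 | Suc k \<Rightarrow> B (hardy_coeff f k))))
        sums (A (hardy_eval f z) + z *\<^sub>C B (hardy_eval f z))"
      by (rule sums_cong[THEN iffD1, rotated]) (simp add: scaleC_add_right split: nat.split)
    moreover have "hardy_eval f z \<in> F" using f z by (simp add: hardy_space_def)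
    ultimately show "(\<lambda>n. z ^ n *\<^sub>C (A (hardy_coeff f n) + (case n of 0 \<Rightarrow> 0 | Suc k \<Rightarrow> B (hardy_coeff f k))))
        sums \<phi> z (hardy_eval f z)"
      by (simp add: \<phi>)
  qed
  then show ?thesis by simp
qed

text \<open>Both model operators are bidiagonal: the \<open>n\<close>-th coefficient of the image is
  \<open>a n + b (n - 1)\<close>, where \<open>a k\<close> and \<open>b k\<close> come from the \<open>k\<close>-th coefficient of the argument.  Sums
  over \<open>n\<close> can then be reorganised by collecting the contributions of each argument coefficient.\<close>

lemma bidiagonal_cinner_sums:
  fixes f f' g :: "'a::chilbert_space hardy"
  assumes f': "\<And>n. hardy_coeff f' n = a n + (case n of 0 \<Rightarrow> 0 | Suc k \<Rightarrow> b k)"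
    and a: "\<And>n. norm (a n) \<le> norm (hardy_coeff f n)" and b: "\<And>n. norm (b n) \<le> norm (hardy_coeff f n)"
  shows "(\<lambda>n. cinner (a n) (hardy_coeff g n) + cinner (b n) (hardy_coeff g (Suc n))) sums cinner f' g"
proof -
  have sm: "summable (\<lambda>n. (norm (c n))\<^sup>2)" if "\<And>n. norm (c n) \<le> norm (hardy_coeff f n)" for c :: "nat \<Rightarrow> 'a"
    by (rule summable_comparison_test[OF _ hardy_coeff_summable[of f]])
      (auto intro!: power_mono that)
  have sa: "summable (\<lambda>n. cinner (a n) (hardy_coeff g n))"
    by (intro square_summable_cinner sm a hardy_coeff_summable)
  have "summable (\<lambda>n. (norm (hardy_coeff g (Suc n)))\<^sup>2)"
    using hardy_coeff_summable[of g] by (subst summable_Suc_iff)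
  then have sb: "summable (\<lambda>n. cinner (b n) (hardy_coeff g (Suc n)))"
    by (rule square_summable_cinner[OF sm[OF b]])
  have "(\<lambda>n. cinner (a n) (hardy_coeff g n) + (case n of 0 \<Rightarrow> 0 | Suc k \<Rightarrow> cinner (b k) (hardy_coeff g (Suc k))))
      sums ((\<Sum>n. cinner (a n) (hardy_coeff g n)) + (\<Sum>n. cinner (b n) (hardy_coeff g (Suc n))))"
    by (intro sums_add sums_case_nat_Suc summable_sums sa sb)
  moreover have "(\<lambda>n. cinner (a n) (hardy_coeff g n) + (case n of 0 \<Rightarrow> 0 | Suc k \<Rightarrow> cinner (b k) (hardy_coeff g (Suc k))))
      = (\<lambda>n. cinner (hardy_coeff f' n) (hardy_coeff g n))"
    by (auto simp: f' cinner_add_left split: nat.split)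
  ultimately have "cinner f' g = (\<Sum>n. cinner (a n) (hardy_coeff g n)) + (\<Sum>n. cinner (b n) (hardy_coeff g (Suc n)))"
    using hardy_cinner_sums[of f' g] sums_unique2 by metis
  then show ?thesis
    using sums_add[OF summable_sums[OF sa] summable_sums[OF sb]] by simp
qed

lemma bidiagonal_norm:
  fixes f f' :: "'a::chilbert_space hardy"
  assumes f': "\<And>n. hardy_coeff f' n = a n + (case n of 0 \<Rightarrow> 0 | Suc k \<Rightarrow> b k)"
    and ab: "\<And>n. (norm (a n))\<^sup>2 + (norm (b n))\<^sup>2 = (norm (hardy_coeff f n))\<^sup>2"
    and orth: "\<And>n. cinner (b n) (a (Suc n)) = 0"
  shows "norm f' = norm f"
proof -
  have le: "norm (a n) \<le> norm (hardy_coeff f n)" "norm (b n) \<le> norm (hardy_coeff f n)" for n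
  proof -
    have "(norm (a n))\<^sup>2 \<le> (norm (hardy_coeff f n))\<^sup>2" "(norm (b n))\<^sup>2 \<le> (norm (hardy_coeff f n))\<^sup>2"
      using ab[of n] zero_le_power2[of "norm (a n)"] zero_le_power2[of "norm (b n)"] by linarith+
    then show "norm (a n) \<le> norm (hardy_coeff f n)" "norm (b n) \<le> norm (hardy_coeff f n)"
      by (auto intro: power2_le_imp_le)
  qed
  have orth': "cinner (a (Suc n)) (b n) = 0" for n
    using orth[of n] by (metis cinner_commute complex_cnj_zero)
  have "cinner (a n) (hardy_coeff f' n) + cinner (b n) (hardy_coeff f' (Suc n)) =
      cinner (hardy_coeff f n) (hardy_coeff f n)" for n
  proof -
    have "cinner (a n) (hardy_coeff f' n) + cinner (b n) (hardy_coeff f' (Suc n)) =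
        of_real ((norm (a n))\<^sup>2 + (norm (b n))\<^sup>2)"
      by (cases n) (simp_all add: f' cinner_add_right orth orth' cinner_norm_square)
    then show ?thesis by (simp only: ab cinner_norm_square)
  qed
  then have "(\<lambda>n. cinner (hardy_coeff f n) (hardy_coeff f n)) sums cinner f' f'"
    using bidiagonal_cinner_sums[OF f' le, of f'] by simp
  then have "cinner f' f' = cinner f f"
    using hardy_cinner_sums[of f f] sums_unique2 by blast
  then show ?thesis by (rule norm_eq_of_cinner_same)
qed

section \<open>The model pair of a projection and a unitary\<close>

lemma unitary_onto_adj:
  assumes U: "unitary_onto S S' U" and S: "closed_csubspace S"
  shows "\<And>x. x \<in> S \<Longrightarrow> adj_on S U (U x) = x" "\<And>y. y \<in> S' \<Longrightarrow> adj_on S U y \<in> S"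
    "\<And>y. y \<in> S' \<Longrightarrow> U (adj_on S U y) = y"
    "\<And>x y. x \<in> S \<Longrightarrow> y \<in> S' \<Longrightarrow> cinner (U x) y = cinner x (adj_on S U y)"
    "isometry_into S' S (adj_on S U)"
proof -
  have iso: "isometry_into S S' U" and onto: "U ` S = S'" using U by (auto simp: unitary_onto_def)
  show 1: "adj_on S U (U x) = x" if "x \<in> S" for x
    by (rule adj_on_eqI[OF S that]) (rule isometry_cinner[OF iso S _ that])
  show 2: "adj_on S U y \<in> S" and 3: "U (adj_on S U y) = y" if "y \<in> S'" for y
    using that 1 unfolding onto[symmetric] by auto
  show "cinner (U x) y = cinner x (adj_on S U y)" if "x \<in> S" "y \<in> S'" for x y
    using isometry_cinner[OF iso S that(1) 2[OF that(2)]] by (simp add: 3[OF that(2)])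
  show "isometry_into S' S (adj_on S U)"
    unfolding isometry_into_def clinear_on_def
  proof (intro conjI ballI allI)
    note I = iso[unfolded isometry_into_def clinear_on_def]
    show "adj_on S U (x + y) = adj_on S U x + adj_on S U y" if "x \<in> S'" "y \<in> S'" for x y
      using 1[of "adj_on S U x + adj_on S U y"] that I 2 3 closed_csubspaceD(3)[OF S] by simp
    show "adj_on S U (c *\<^sub>C x) = c *\<^sub>C adj_on S U x" if "x \<in> S'" for c x
      using 1[of "c *\<^sub>C adj_on S U x"] that I 2 3 closed_csubspaceD(4)[OF S] by simp
    show "adj_on S U ` S' \<subseteq> S" using 2 by blast
    show "norm (adj_on S U x) = norm x" if "x \<in> S'" for x
      using that I 2 3 by metis
  qed
qed

lemma orth_projection_eqI:
  assumes P: "orth_projection S M P" and x: "x \<in> S" and y: "y \<in> M" "\<And>m. m \<in> M \<Longrightarrow> cinner (x - y) m = 0"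
  shows "P x = y"
proof -
  have M: "closed_csubspace M" and Px: "P x \<in> M" "\<And>m. m \<in> M \<Longrightarrow> cinner (x - P x) m = 0"
    using P x by (auto simp: orth_projection_def)
  have "cinner (P x - y) (P x - y) = cinner (x - y) (P x - y) - cinner (x - P x) (P x - y)"
    by (simp flip: cinner_diff_left)
  also have "\<dots> = 0" using Px y closed_csubspaceD(5)[OF M Px(1) y(1)] by simp
  finally show ?thesis using cinner_eq_0_imp_eq_0[of "P x - y"] by simp
qed

lemma orth_projectionD:
  assumes P: "orth_projection S M P" and S: "closed_csubspace S"
  shows "\<And>x. x \<in> S \<Longrightarrow> P x \<in> S" "\<And>x y. x \<in> S \<Longrightarrow> y \<in> S \<Longrightarrow> P (x + y) = P x + P y"
    "\<And>x c. x \<in> S \<Longrightarrow> P (c *\<^sub>C x) = c *\<^sub>C P x" "\<And>x. x \<in> S \<Longrightarrow> P (P x) = P x"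
    "\<And>x. x \<in> S \<Longrightarrow> P (x - P x) = 0"
    "\<And>x y. x \<in> S \<Longrightarrow> y \<in> S \<Longrightarrow> cinner (x - P x) (P y) = 0"
    "\<And>x y. x \<in> S \<Longrightarrow> y \<in> S \<Longrightarrow> cinner (P y) (x - P x) = 0"
    "\<And>x. x \<in> S \<Longrightarrow> (norm x)\<^sup>2 = (norm (x - P x))\<^sup>2 + (norm (P x))\<^sup>2"
    "P 0 = 0"
proof -
  have M: "closed_csubspace M" "M \<subseteq> S"
    and PM: "\<And>x. x \<in> S \<Longrightarrow> P x \<in> M" "\<And>x m. x \<in> S \<Longrightarrow> m \<in> M \<Longrightarrow> cinner (x - P x) m = 0"
    using P by (auto simp: orth_projection_def)
  note M' = closed_csubspaceD[OF M(1)] and S' = closed_csubspaceD[OF S]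
  show PS: "P x \<in> S" if "x \<in> S" for x using PM(1)[OF that] M(2) by blast
  show "P (x + y) = P x + P y" if "x \<in> S" "y \<in> S" for x y
  proof (rule orth_projection_eqI[OF P])
    show "cinner (x + y - (P x + P y)) m = 0" if "m \<in> M" for m
      using PM(2)[OF \<open>x \<in> S\<close> that] PM(2)[OF \<open>y \<in> S\<close> that] by (simp add: cinner_algebra)
  qed (use that PM S' M' in auto)
  show "P (c *\<^sub>C x) = c *\<^sub>C P x" if "x \<in> S" for x c
  proof (rule orth_projection_eqI[OF P])
    show "cinner (c *\<^sub>C x - c *\<^sub>C P x) m = 0" if "m \<in> M" for m
      using PM(2)[OF \<open>x \<in> S\<close> that] by (simp flip: scaleC_diff_right)
  qed (use that PM S' M' in auto)
  show "P (P x) = P x" if "x \<in> S" for x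
    by (rule orth_projection_eqI[OF P]) (use that PM PS in auto)
  show "P (x - P x) = 0" if "x \<in> S" for x
    by (rule orth_projection_eqI[OF P]) (use that PM PS S' M' in auto)
  show o: "cinner (x - P x) (P y) = 0" if "x \<in> S" "y \<in> S" for x y
    using that PM by simp
  show "cinner (P y) (x - P x) = 0" if "x \<in> S" "y \<in> S" for x y
    using o[OF that] by (metis cinner_commute complex_cnj_zero)
  show "(norm x)\<^sup>2 = (norm (x - P x))\<^sup>2 + (norm (P x))\<^sup>2" if "x \<in> S" for x
  proof -
    have "inner (x - P x) (P x) = 0" using o[OF that that] by (simp add: inner_eq_Re_cinner)
    then show ?thesis by (simp add: power2_norm_eq_inner inner_diff_left inner_diff_right inner_commute)
  qed
  show "P 0 = 0" by (rule orth_projection_eqI[OF P]) (use S' M' in auto)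
qed

definition hardy_V1 :: "complex \<Rightarrow> 'f::chilbert_space set \<Rightarrow> ('f \<Rightarrow> 'f) \<Rightarrow> ('f \<Rightarrow> 'f) \<Rightarrow> 'f hardy \<Rightarrow> 'f hardy" where
  "hardy_V1 q F P U = mult_op (\<lambda>z v. adj_on F U ((v - P v) + z *\<^sub>C P v)) \<circ> rotation_op q"

definition hardy_V2 :: "complex \<Rightarrow> ('f::chilbert_space \<Rightarrow> 'f) \<Rightarrow> ('f \<Rightarrow> 'f) \<Rightarrow> 'f hardy \<Rightarrow> 'f hardy" where
  "hardy_V2 q P U = rotation_op (cnj q) \<circ> mult_op (\<lambda>z v. P (U v) + z *\<^sub>C (U v - P (U v)))"

lemma model_V_hardy:
  "model_V1 q F P U W1 (f, w) = (hardy_V1 q F P U f, W1 w)"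
  "model_V2 q P U W2 (f, w) = (hardy_V2 q P U f, W2 w)"
  by (simp_all add: model_V1_def model_V2_def hardy_V1_def hardy_V2_def)

context
  fixes q :: complex and F M :: "'f::chilbert_space set" and P U :: "'f \<Rightarrow> 'f"
  assumes q: "cmod q = 1" and F: "closed_csubspace F" and P: "orth_projection F M P"
    and U: "unitary_onto F F U"
begin

private lemmas F' = closed_csubspaceD[OF F]
private lemmas P' = orth_projectionD[OF P F]
private lemmas Ui = unitary_onto_adj[OF U F]

private lemma isoU: "isometry_into F F U"
  using U by (simp add: unitary_onto_def)

private lemmas Ulin = contraction_onD[OF contraction_on_isometry[OF isoU] F]
private lemmas Uilin = contraction_onD[OF contraction_on_isometry[OF Ui(5)] F]

private lemma U_in: "x \<in> F \<Longrightarrow> U x \<in> F"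
  using isoU by (auto simp: isometry_into_def)

private lemma U_norm: "x \<in> F \<Longrightarrow> norm (U x) = norm x" "x \<in> F \<Longrightarrow> norm (adj_on F U x) = norm x"
  using isoU Ui(5) by (auto simp: isometry_into_def)

private lemma contr_P: "contraction_on F P" "contraction_on F (\<lambda>x. x - P x)"
proof -
  have le: "norm (P x) \<le> norm x" "norm (x - P x) \<le> norm x" if "x \<in> F" for x
    using P'(8)[OF that] by (auto intro: power2_le_imp_le)
  show "contraction_on F P" "contraction_on F (\<lambda>x. x - P x)"
    unfolding contraction_on_def clinear_on_def using le
    by (auto simp: P' scaleC_diff_right)
qed

private lemma contr_model:
  "contraction_on F (\<lambda>x. adj_on F U (x - P x))" "contraction_on F (\<lambda>x. adj_on F U (P x))"
  "contraction_on F (\<lambda>x. P (U x))" "contraction_on F (\<lambda>x. U x - P (U x))"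
  using F' P' U_in
  by (auto intro!: contraction_on_comp[where S' = F and A = "adj_on F U"] contraction_on_isometry[OF Ui(5)]
      contraction_on_comp[where S' = F and B = U] contr_P contraction_on_isometry[OF isoU])

lemma hardy_coeff_V1:
  assumes f: "f \<in> hardy_space F"
  shows "hardy_coeff (hardy_V1 q F P U f) n = q ^ n *\<^sub>C adj_on F U (hardy_coeff f n - P (hardy_coeff f n))
    + (case n of 0 \<Rightarrow> 0 | Suc k \<Rightarrow> q ^ k *\<^sub>C adj_on F U (P (hardy_coeff f k)))"
proof -
  have fn: "hardy_coeff f n \<in> F" for n using f by (simp add: hardy_space_iff[OF F])
  have "adj_on F U ((v - P v) + z *\<^sub>C P v) = adj_on F U (v - P v) + z *\<^sub>C adj_on F U (P v)"
    if "v \<in> F" for z v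
    using that F' P' by (simp add: Uilin)
  from hardy_coeff_mult_op_affine[OF F contr_model(1,2) rotation_op_in_hardy_space[OF F q f] this, of n]
  show ?thesis
    by (simp add: hardy_V1_def hardy_coeff_rotation_op[OF q] contraction_onD[OF contr_model(1) F]
        contraction_onD[OF contr_model(2) F] fn P' F' split: nat.split
        flip: scaleC_diff_right) (simp add: Uilin P' F' fn)
qed

lemma hardy_coeff_V2:
  assumes f: "f \<in> hardy_space F"
  shows "hardy_coeff (hardy_V2 q P U f) n = cnj q ^ n *\<^sub>C P (U (hardy_coeff f n))
    + (case n of 0 \<Rightarrow> 0 | Suc k \<Rightarrow> cnj q ^ Suc k *\<^sub>C (U (hardy_coeff f k) - P (U (hardy_coeff f k))))"
proof -
  have q': "cmod (cnj q) = 1" using q by simp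
  show ?thesis
    using hardy_coeff_mult_op_affine[OF F contr_model(3,4) f refl, of n]
    by (simp add: hardy_V2_def hardy_coeff_rotation_op[OF q'] scaleC_add_right split: nat.split)
qed

lemma hardy_V_in_hardy_space:
  assumes f: "f \<in> hardy_space F"
  shows "hardy_V1 q F P U f \<in> hardy_space F" "hardy_V2 q P U f \<in> hardy_space F"
proof -
  have fn: "hardy_coeff f n \<in> F" for n using f by (simp add: hardy_space_iff[OF F])
  show "hardy_V1 q F P U f \<in> hardy_space F" "hardy_V2 q P U f \<in> hardy_space F"
    unfolding hardy_space_iff[OF F]
    by (auto simp: hardy_coeff_V1[OF f] hardy_coeff_V2[OF f] split: nat.split
        intro!: F'(3-5) F'(2) Ui(2) P'(1) U_in fn)
qed

lemma hardy_V_linear: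
  assumes f: "f \<in> hardy_space F" and g: "g \<in> hardy_space F"
  shows "hardy_V1 q F P U (f + g) = hardy_V1 q F P U f + hardy_V1 q F P U g"
    "hardy_V2 q P U (f + g) = hardy_V2 q P U f + hardy_V2 q P U g"
    "hardy_V1 q F P U (c *\<^sub>C f) = c *\<^sub>C hardy_V1 q F P U f"
    "hardy_V2 q P U (c *\<^sub>C f) = c *\<^sub>C hardy_V2 q P U f"
proof -
  note H = closed_csubspaceD[OF closed_csubspace_hardy_space[OF F]]
  have fn: "hardy_coeff f n \<in> F" "hardy_coeff g n \<in> F" for n
    using f g by (simp_all add: hardy_space_iff[OF F])
  note L = contraction_onD(1)[OF contr_model(1) F] contraction_onD(1)[OF contr_model(2) F]
    contraction_onD(1)[OF contr_model(3) F] contraction_onD(1)[OF contr_model(4) F]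
  note C = contraction_onD(2)[OF contr_model(1) F] contraction_onD(2)[OF contr_model(2) F]
    contraction_onD(2)[OF contr_model(3) F] contraction_onD(2)[OF contr_model(4) F]
  show "hardy_V1 q F P U (f + g) = hardy_V1 q F P U f + hardy_V1 q F P U g"
    by (rule hardy_eqI, rule ext)
      (simp add: hardy_coeff_V1 f g H(3) L fn scaleC_add_right split: nat.split)
  show "hardy_V2 q P U (f + g) = hardy_V2 q P U f + hardy_V2 q P U g"
    by (rule hardy_eqI, rule ext)
      (simp add: hardy_coeff_V2 f g H(3) L fn scaleC_add_right scaleC_diff_right Ulin(1) U_in P'(2) algebra_simps
        split: nat.split)
  show "hardy_V1 q F P U (c *\<^sub>C f) = c *\<^sub>C hardy_V1 q F P U f"
    by (rule hardy_eqI, rule ext)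
      (simp add: hardy_coeff_V1 f H(4) C fn scaleC_add_right mult.commute split: nat.split)
  show "hardy_V2 q P U (c *\<^sub>C f) = c *\<^sub>C hardy_V2 q P U f"
    by (rule hardy_eqI, rule ext)
      (simp add: hardy_coeff_V2 f H(4) C fn scaleC_add_right scaleC_diff_right Ulin(2) P'(3) U_in mult_ac
        split: nat.split)
qed

lemma hardy_V_norm:
  assumes f: "f \<in> hardy_space F"
  shows "norm (hardy_V1 q F P U f) = norm f" "norm (hardy_V2 q P U f) = norm f"
proof -
  have fn: "hardy_coeff f n \<in> F" for n using f by (simp add: hardy_space_iff[OF F])
  note in_F = fn F'(5) P'(1) U_in
  show "norm (hardy_V1 q F P U f) = norm f"
  proof (rule bidiagonal_norm[OF hardy_coeff_V1[OF f]])
    show "(norm (q ^ n *\<^sub>C adj_on F U (hardy_coeff f n - P (hardy_coeff f n))))\<^sup>2 +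
        (norm (q ^ n *\<^sub>C adj_on F U (P (hardy_coeff f n))))\<^sup>2 = (norm (hardy_coeff f n))\<^sup>2" for n
      by (simp add: norm_power q U_norm in_F P'(8)[OF fn, of n, symmetric])
    show "cinner (q ^ n *\<^sub>C adj_on F U (P (hardy_coeff f n)))
        (q ^ Suc n *\<^sub>C adj_on F U (hardy_coeff f (Suc n) - P (hardy_coeff f (Suc n)))) = 0" for n
      by (simp add: cinner_scaleC_right isometry_cinner[OF Ui(5) F] in_F P'(7))
  qed
  show "norm (hardy_V2 q P U f) = norm f"
  proof (rule bidiagonal_norm[OF hardy_coeff_V2[OF f]])
    show "(norm (cnj q ^ n *\<^sub>C P (U (hardy_coeff f n))))\<^sup>2 +
        (norm (cnj q ^ Suc n *\<^sub>C (U (hardy_coeff f n) - P (U (hardy_coeff f n)))))\<^sup>2 = (norm (hardy_coeff f n))\<^sup>2" for n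
      using P'(8)[OF U_in[OF fn], of n] by (simp add: norm_power norm_mult q U_norm in_F)
    show "cinner (cnj q ^ Suc n *\<^sub>C (U (hardy_coeff f n) - P (U (hardy_coeff f n))))
        (cnj q ^ Suc n *\<^sub>C P (U (hardy_coeff f (Suc n)))) = 0" for n
      by (simp add: cinner_scaleC_right in_F P'(6))
  qed
qed

text \<open>\<open>V\<^sub>1 V\<^sub>2\<close> is the shift, because \<open>(P\<^sup>\<bottom> + z P) (P + z P\<^sup>\<bottom>) = z\<close>; the two rotations cancel in this
  order and leave a factor \<open>cnj q\<close> in the other order.\<close>

lemma hardy_V_q_commute:
  assumes f: "f \<in> hardy_space F"
  shows "hardy_V1 q F P U (hardy_V2 q P U f) = q *\<^sub>C hardy_V2 q P U (hardy_V1 q F P U f)"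
proof (rule hardy_eqI, rule ext)
  fix n
  have fn: "hardy_coeff f n \<in> F" for n using f by (simp add: hardy_space_iff[OF F])
  note in_F = fn F'(2-5) P'(1) U_in Ui(2)
  have qq: "q ^ k * cnj q ^ k = 1" "cnj q ^ k * q ^ k = 1" "q * cnj q = 1" for k
    using q by (simp_all add: power_mult_distrib[symmetric] complex_norm_square[symmetric] mult.commute)
  have qqS: "q * q ^ k * (cnj q * cnj q ^ k) = 1" "q * (cnj q * cnj q ^ k * q ^ k) = 1" for k
    using qq(1)[of "Suc k"] by (simp_all add: mult_ac)
  have qq': "q * (cnj q * a) = a" "q ^ k * (cnj q ^ k * a) = a" "cnj q ^ k * (q ^ k * a) = a" for a k
    by (simp_all add: qq mult.assoc[symmetric])
  note lin = Ulin(1,2,4,5) Uilin(1,2,4,5) P'(2,3,9) contraction_onD(5)[OF contr_P(1) F]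
  note simps = hardy_coeff_V1 hardy_coeff_V2 hardy_V_in_hardy_space f lin in_F P' Ui(1,3) qq qq'
     scaleC_add_right scaleC_diff_right
  show "hardy_coeff (hardy_V1 q F P U (hardy_V2 q P U f)) n =
      hardy_coeff (q *\<^sub>C hardy_V2 q P U (hardy_V1 q F P U f)) n"
  proof (cases n)
    case 0
    then show ?thesis by (simp add: simps)
  next
    case (Suc k)
    define x where "x = hardy_coeff f k"
    define y where "y = hardy_coeff f (Suc k)"
    \<comment> \<open>\<open>j\<close> and \<open>d\<close> are the contributions of the coefficient \<open>k - 1\<close>; the outer operator removes them
      because \<open>U j\<close> and \<open>d\<close> lie in the range and in the kernel of \<open>P\<close>\<close>
    define j where "j = (case k of 0 \<Rightarrow> 0 | Suc m \<Rightarrow> q ^ m *\<^sub>C adj_on F U (P (hardy_coeff f m)))"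
    have xy: "x \<in> F" "y \<in> F" unfolding x_def y_def by (rule fn)+
    define d where "d = (case k of 0 \<Rightarrow> 0 | Suc m \<Rightarrow> cnj q ^ Suc m *\<^sub>C (U (hardy_coeff f m) - P (U (hardy_coeff f m))))"
    have d: "d \<in> F" "P d = 0"
      unfolding d_def by (auto simp: lin in_F P' split: nat.split)
    have j: "j \<in> F" "U j - P (U j) = 0"
      unfolding j_def by (auto simp: lin in_F P' Ui split: nat.split)
    have "hardy_coeff (hardy_V1 q F P U (hardy_V2 q P U f)) n = x"
      unfolding Suc
      by (simp add: hardy_coeff_V1 hardy_coeff_V2 hardy_V_in_hardy_space f
          flip: x_def y_def d_def)
        (simp add: lin in_F P' xy d qq qq' qqS scaleC_add_right scaleC_diff_right Ui(1))
    moreover have "hardy_coeff (q *\<^sub>C hardy_V2 q P U (hardy_V1 q F P U f)) n = x"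
      unfolding Suc
      by (simp add: hardy_coeff_V1 hardy_coeff_V2 hardy_V_in_hardy_space f
          flip: x_def y_def j_def)
        (use j in \<open>simp add: lin in_F P' xy qq qq' qqS scaleC_add_right scaleC_diff_right Ui(3)\<close>)
    ultimately show ?thesis by simp
  qed
qed

text \<open>The adjoint of a lower bidiagonal operator is upper bidiagonal, so the \<open>n\<close>-th coefficient of its value
  at \<open>g\<close> involves the coefficients \<open>n\<close> and \<open>n + 1\<close> of \<open>g\<close>.  For the second operator \<open>U\<close> is applied to
  that coefficient, to avoid the inverse of \<open>U\<close>.\<close>

lemma hardy_V1_adjoint:
  assumes s: "s \<in> hardy_space F" and g: "g \<in> hardy_space F"
    and x: "\<And>n. hardy_coeff x n = cnj q ^ n *\<^sub>C
        ((U (hardy_coeff g n) - P (U (hardy_coeff g n))) + P (U (hardy_coeff g (Suc n))))"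
  shows "cinner (hardy_V1 q F P U s) g = cinner s x"
proof -
  have fn: "hardy_coeff s n \<in> F" "hardy_coeff g n \<in> F" for n using s g by (simp_all add: hardy_space_iff[OF F])
  note in_F = fn F'(2-5) P'(1) U_in Ui(2)
  have adj: "cinner (adj_on F U v) w = cinner v (U w)" if "v \<in> F" "w \<in> F" for v w
    using Ui(4)[OF that(2,1)] by (metis cinner_commute)
  have sa: "cinner (P v) w = cinner v (P w)" if "v \<in> F" "w \<in> F" for v w
    using P'(6)[OF that] P'(7)[OF that(2,1)] by (simp add: cinner_algebra)
  have "(\<lambda>n. cinner (q ^ n *\<^sub>C adj_on F U (hardy_coeff s n - P (hardy_coeff s n))) (hardy_coeff g n) +
      cinner (q ^ n *\<^sub>C adj_on F U (P (hardy_coeff s n))) (hardy_coeff g (Suc n))) sums cinner (hardy_V1 q F P U s) g"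
    by (rule bidiagonal_cinner_sums[where f = s, OF hardy_coeff_V1[OF s]])
      (simp_all add: norm_power q contraction_onD(3)[OF contr_model(1) F]
        contraction_onD(3)[OF contr_model(2) F] fn)
  moreover have "cinner (q ^ n *\<^sub>C adj_on F U (hardy_coeff s n - P (hardy_coeff s n))) (hardy_coeff g n) +
      cinner (q ^ n *\<^sub>C adj_on F U (P (hardy_coeff s n))) (hardy_coeff g (Suc n)) =
      cinner (hardy_coeff s n) (hardy_coeff x n)" for n
    by (simp add: x adj in_F cinner_algebra sa algebra_simps)
  ultimately show ?thesis
    using hardy_cinner_sums[of s x] sums_unique2 by simp
qed

lemma hardy_V2_adjoint:
  assumes s: "s \<in> hardy_space F" and g: "g \<in> hardy_space F"
    and x: "\<And>n. U (hardy_coeff x n) = q ^ n *\<^sub>C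
        (P (hardy_coeff g n) + q *\<^sub>C (hardy_coeff g (Suc n) - P (hardy_coeff g (Suc n))))"
    and xF: "x \<in> hardy_space F"
  shows "cinner (hardy_V2 q P U s) g = cinner s x"
proof -
  have fn: "hardy_coeff s n \<in> F" "hardy_coeff g n \<in> F" "hardy_coeff x n \<in> F" for n
    using s g xF by (simp_all add: hardy_space_iff[OF F])
  note in_F = fn F'(2-5) P'(1) U_in Ui(2)
  have sa: "cinner (P v) w = cinner v (P w)" if "v \<in> F" "w \<in> F" for v w
    using P'(6)[OF that] P'(7)[OF that(2,1)] by (simp add: cinner_algebra)
  have "(\<lambda>n. cinner (cnj q ^ n *\<^sub>C P (U (hardy_coeff s n))) (hardy_coeff g n) +
      cinner (cnj q ^ Suc n *\<^sub>C (U (hardy_coeff s n) - P (U (hardy_coeff s n)))) (hardy_coeff g (Suc n)))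
      sums cinner (hardy_V2 q P U s) g"
    by (rule bidiagonal_cinner_sums[where f = s, OF hardy_coeff_V2[OF s]])
      (simp_all add: norm_power norm_mult q contraction_onD(3)[OF contr_model(3) F]
        contraction_onD(3)[OF contr_model(4) F] fn)
  moreover have "cinner (cnj q ^ n *\<^sub>C P (U (hardy_coeff s n))) (hardy_coeff g n) +
      cinner (cnj q ^ Suc n *\<^sub>C (U (hardy_coeff s n) - P (U (hardy_coeff s n)))) (hardy_coeff g (Suc n)) =
      cinner (hardy_coeff s n) (hardy_coeff x n)" for n
  proof -
    have "cinner (hardy_coeff s n) (hardy_coeff x n) = cinner (U (hardy_coeff s n)) (U (hardy_coeff x n))"
      by (rule isometry_cinner[OF isoU F fn(1) fn(3), symmetric])
    then show ?thesis unfolding x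
      by (simp add: in_F cinner_algebra sa algebra_simps)
  qed
  ultimately show ?thesis
    using hardy_cinner_sums[of s x] sums_unique2 by simp
qed

lemma model_V_isometry:
  assumes "isometry_into UNIV UNIV W1" "isometry_into UNIV UNIV W2"
  shows "isometry_into (hardy_space F \<times> UNIV) (hardy_space F \<times> UNIV) (model_V1 q F P U W1)"
    "isometry_into (hardy_space F \<times> UNIV) (hardy_space F \<times> UNIV) (model_V2 q P U W2)"
  using assms unfolding isometry_into_def clinear_on_def
  by (auto simp: model_V_hardy hardy_V_linear hardy_V_in_hardy_space hardy_V_norm scaleC_prod_def norm_Pair)

lemma model_V_q_commuting:
  assumes "q_commuting_on q UNIV W1 W2"
  shows "q_commuting_on q (hardy_space F \<times> UNIV) (model_V1 q F P U W1) (model_V2 q P U W2)"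
  using assms unfolding q_commuting_on_def
  by (auto simp: model_V_hardy hardy_V_q_commute scaleC_prod_def)

end

section \<open>The canonical pair of unitaries\<close>

lemma unitary_cadj:
  assumes "unitary_onto UNIV UNIV W"
  shows "cadj W (W x) = x" "W (cadj W x) = x"
  using unitary_onto_adj[OF assms closed_csubspace_UNIV] by auto

lemma unitary_isometry: "unitary_onto S S' W \<Longrightarrow> isometry_into S S' W"
  by (simp add: unitary_onto_def)

text \<open>The properties of the canonical pair that matter below.  The generators \<open>\<iota> (Q h)\<close> enter only through their norms
  and the intertwining relations; the shift \<open>WD = W1 W2\<close> moves them to a set spanning the whole
  space.\<close>

lemma canonical_unitary_pairD:
  fixes T1 T2 :: "'h::chilbert_space \<Rightarrow> 'h" and \<iota> :: "'h \<Rightarrow> 'w::chilbert_space"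
  assumes T: "contraction T1" "contraction T2" and c: "canonical_unitary_pair q T1 T2 \<iota> W1 W2"
    and q: "cmod q = 1"
  defines "e \<equiv> \<lambda>h. \<iota> (Q_star (T1 \<circ> T2) h)"
  shows "unitary_onto UNIV UNIV W1" "unitary_onto UNIV UNIV W2"
    "q_commuting_on q UNIV W1 W2"
    "e (h + k) = e h + e k" "e (a *\<^sub>C h) = a *\<^sub>C e h"
    "norm (e h) = norm (Q_star (T1 \<circ> T2) h)"
    "cadj W1 (e h) = e (cadj T1 h)" "cadj W2 (e h) = e (cadj T2 h)"
    "closed_csubspace hull {((W1 \<circ> W2) ^^ n) (e h) | n h. True} = UNIV"
proof -
  define T where "T = T1 \<circ> T2"
  have cT: "contraction T" unfolding T_def by (rule contraction_comp[OF T])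
  define R where "R = Q_range T"
  obtain Xs X1s X2s WD where
    \<iota>: "isometry_into R UNIV \<iota>" and
    X: "Q_isometry T T1 X1s" "Q_isometry T T2 X2s" and
    WD: "unitary_onto UNIV UNIV WD" "UNIV = closed_csubspace hull (\<Union>n. (WD ^^ n) ` \<iota> ` R)" and
    W1: "unitary_onto UNIV UNIV W1" "\<And>x. x \<in> R \<Longrightarrow> cadj W1 (\<iota> x) = \<iota> (X1s x)" and
    W2: "unitary_onto UNIV UNIV W2" "\<And>x. x \<in> R \<Longrightarrow> cadj W2 (\<iota> x) = \<iota> (X2s x)" and
    qc: "q_commuting_on q UNIV (cadj W1) (cadj W2)" and
    W12: "\<And>x. cadj W1 (cadj W2 x) = q *\<^sub>C cadj WD x"
    using c unfolding canonical_unitary_pair_def Let_def R_def T_def by blast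
  have R: "closed_csubspace R"
    unfolding R_def Q_range_def
    by (intro closed_csubspace_closure_range_op bounded_clinear_Q_star cT)
  have QR: "Q_star T h \<in> R" for h
    unfolding R_def Q_range_def by (rule subsetD[OF closure_subset rangeI])
  note Q = bounded_clinearD[OF bounded_clinear_Q_star[OF cT]]
  note I = contraction_onD[OF contraction_on_isometry[OF \<iota>] R]
  show "unitary_onto UNIV UNIV W1" "unitary_onto UNIV UNIV W2" by fact+
  show "e (h + k) = e h + e k" "e (a *\<^sub>C h) = a *\<^sub>C e h"
    unfolding e_def T_def[symmetric] by (simp_all add: Q I QR)
  show "norm (e h) = norm (Q_star (T1 \<circ> T2) h)"
    unfolding e_def T_def[symmetric] using \<iota> QR by (simp add: isometry_into_def)
  show "cadj W1 (e h) = e (cadj T1 h)" "cadj W2 (e h) = e (cadj T2 h)"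
    unfolding e_def T_def[symmetric] using W1(2)[OF QR] W2(2)[OF QR] X
    by (auto simp: Q_isometry_def)
  note lin = bounded_clinearD[OF contractionD(1)[OF isometry_UNIV(1)[OF unitary_isometry[OF W1(1)]]]]
    bounded_clinearD[OF contractionD(1)[OF isometry_UNIV(1)[OF unitary_isometry[OF W2(1)]]]]
  note inv = unitary_cadj[OF W1(1)] unitary_cadj[OF W2(1)] unitary_cadj[OF WD(1)]
  have q0: "q \<noteq> 0" using q by auto
  have "W1 (W2 x) = WD x" for x
  proof -
    have "cadj W1 (cadj W2 (WD x)) = q *\<^sub>C cadj W2 (cadj W1 (WD x))"
      using qc by (simp add: q_commuting_on_def)
    then have "q *\<^sub>C x = q *\<^sub>C cadj W2 (cadj W1 (WD x))"
      using W12[of "WD x"] by (simp add: inv)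
    then have "inverse q *\<^sub>C (q *\<^sub>C x) = inverse q *\<^sub>C (q *\<^sub>C cadj W2 (cadj W1 (WD x)))" by simp
    then have "x = cadj W2 (cadj W1 (WD x))" using q0 by simp
    then show ?thesis using inv by metis
  qed
  then have WD_eq: "W1 \<circ> W2 = WD" by (simp add: fun_eq_iff)
  show "q_commuting_on q UNIV W1 W2"
    unfolding q_commuting_on_def
  proof
    fix x
    have "cadj W1 (cadj W2 (W2 (W1 x))) = q *\<^sub>C cadj W2 (cadj W1 (W2 (W1 x)))"
      using qc by (simp add: q_commuting_on_def)
    then have "x = q *\<^sub>C cadj W2 (cadj W1 (W2 (W1 x)))" by (simp add: inv)
    then have "W1 (W2 x) = q *\<^sub>C W1 (W2 (cadj W2 (cadj W1 (W2 (W1 x)))))" by (metis lin(5,11))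
    then show "W1 (W2 x) = q *\<^sub>C W2 (W1 x)" by (simp add: inv)
  qed
  define G where "G = closed_csubspace hull {(WD ^^ n) (e h) | n h. True}"
  have G: "closed_csubspace G" unfolding G_def by (rule closed_csubspace_hull)
  have gen: "(WD ^^ n) (e h) \<in> G" for n h
    unfolding G_def by (rule subsetD[OF hull_subset]) blast
  have cWD: "bounded_clinear WD"
    by (rule contractionD(1)[OF isometry_UNIV(1)[OF unitary_isometry[OF WD(1)]]])
  have "(WD ^^ n) (\<iota> x) \<in> G" if x: "x \<in> R" for n x
  proof -
    obtain X where X: "\<And>k. X k \<in> range (Q_star T)" "X \<longlonglongrightarrow> x"
      using x unfolding R_def Q_range_def closure_sequential by blast
    have XR: "X k \<in> R" for k using X(1)[of k] QR by auto
    have "(\<lambda>k. \<iota> (X k)) \<longlonglongrightarrow> \<iota> x"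
      by (rule contraction_on_tendsto[OF contraction_on_isometry[OF \<iota>] R XR X(2)])
    then have "(\<lambda>k. (WD ^^ n) (\<iota> (X k))) \<longlonglongrightarrow> (WD ^^ n) (\<iota> x)"
      by (induction n) (auto intro: tendsto_bounded_clinear[OF cWD])
    moreover have "(WD ^^ n) (\<iota> (X k)) \<in> G" for k
    proof -
      obtain h where "X k = Q_star T h" using X(1)[of k] by blast
      then show ?thesis using gen[of n h] by (simp add: e_def T_def)
    qed
    ultimately show ?thesis
      by (rule closed_sequentially[OF closed_csubspaceD(1)[OF G], rotated])
  qed
  then have "closed_csubspace hull (\<Union>n. (WD ^^ n) ` \<iota> ` R) \<subseteq> G"
    by (intro closed_csubspace_hull_least G) auto
  then have "G = UNIV" using WD(2) by blast
  then show "closed_csubspace hull {((W1 \<circ> W2) ^^ n) (e h) | n h. True} = UNIV"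
    unfolding WD_eq G_def .
qed

section \<open>The forward direction\<close>

lemma q_commuting_powers:
  assumes "bounded_clinear A" "\<And>x. A (B x) = q *\<^sub>C B (A x)"
  shows "(A ^^ n) (B x) = q ^ n *\<^sub>C B ((A ^^ n) x)"
  by (induction n) (simp_all add: assms(2) bounded_clinearD[OF assms(1)] mult.commute)

lemma cadj_q_commuting:
  fixes T1 T2 :: "'h::chilbert_space \<Rightarrow> 'h"
  assumes T: "bounded_clinear T1" "bounded_clinear T2" and q: "q_commuting_on q UNIV T1 T2" "cmod q = 1"
  shows "cadj T1 (cadj T2 h) = q *\<^sub>C cadj (T1 \<circ> T2) h"
    "cadj T2 (cadj T1 h) = cadj (T1 \<circ> T2) h"
proof -
  show 1: "cadj T2 (cadj T1 h) = cadj (T1 \<circ> T2) h" by (simp add: cadj_comp[OF T])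
  have qq: "cnj q * q = 1" using q(2) by (simp add: complex_norm_square[symmetric] mult.commute)
  show "cadj T1 (cadj T2 h) = q *\<^sub>C cadj (T1 \<circ> T2) h"
  proof (rule cinner_extensionality)
    fix s
    have "cinner s (q *\<^sub>C cadj (T1 \<circ> T2) h) = cnj q * cinner (T1 (T2 s)) h"
      unfolding 1[symmetric] by (simp add: cinner_scaleC_right cinner_cadj_right T)
    also have "\<dots> = (cnj q * q) * cinner (T2 (T1 s)) h"
      using q(1) by (simp add: q_commuting_on_def)
    finally show "cinner s (cadj T1 (cadj T2 h)) = cinner s (q *\<^sub>C cadj (T1 \<circ> T2) h)"
      by (simp add: cinner_cadj_right T qq)
  qed
qed

text \<open>The adjoints \<open>T*\<^sup>n\<close> move past \<open>T\<^sub>1*\<close> and \<open>T\<^sub>2*\<close> at the price of powers of \<open>q\<close>.\<close>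

lemma cadj_power_q_commuting:
  fixes T1 T2 :: "'h::chilbert_space \<Rightarrow> 'h"
  assumes T: "contraction T1" "contraction T2" and q: "q_commuting_on q UNIV T1 T2" "cmod q = 1"
  defines "Ts \<equiv> cadj (T1 \<circ> T2)"
  shows "(Ts ^^ n) (cadj T1 h) = cnj q ^ n *\<^sub>C cadj T1 ((Ts ^^ n) h)"
    "(Ts ^^ n) (cadj T2 h) = q ^ n *\<^sub>C cadj T2 ((Ts ^^ n) h)"
proof -
  note c = cadj_q_commuting[OF contractionD(1)[OF T(1)] contractionD(1)[OF T(2)] q]
  note b = contractionD(1)[OF contraction_cadj[OF T(1)]] contractionD(1)[OF contraction_cadj[OF T(2)]]
    contractionD(1)[OF contraction_cadj[OF contraction_comp[OF T]]]
  note L = bounded_clinearD(5)[OF b(1)] bounded_clinearD(5)[OF b(2)]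
  have qq: "cnj q * q = 1" using q(2) by (simp add: complex_norm_square[symmetric] mult.commute)
  have "Ts (cadj T1 h) = cnj q *\<^sub>C cadj T1 (Ts h)" for h
  proof -
    have "cadj T1 (Ts h) = q *\<^sub>C Ts (cadj T1 h)"
      unfolding Ts_def using c(1)[of "cadj T1 h"] c(2)[of h] by simp
    then show ?thesis by (simp add: qq)
  qed
  then show "(Ts ^^ n) (cadj T1 h) = cnj q ^ n *\<^sub>C cadj T1 ((Ts ^^ n) h)"
    by (rule q_commuting_powers[OF b(3)[folded Ts_def]])
  have "Ts (cadj T2 h) = q *\<^sub>C cadj T2 (Ts h)" for h
    unfolding Ts_def using c(1)[of h] c(2)[of "cadj T2 h"] by (simp add: L)
  then show "(Ts ^^ n) (cadj T2 h) = q ^ n *\<^sub>C cadj T2 ((Ts ^^ n) h)"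
    by (rule q_commuting_powers[OF b(3)[folded Ts_def]])
qed

text \<open>All prescribed values of \<open>\<Lambda>\<close> and of \<open>U\<close> have the form \<open>(D1 h, D2 k, 0)\<close>, and on such vectors the
  projection just deletes the second entry.\<close>

lemma special_ando_tupleD:
  fixes T1 T2 :: "'h::chilbert_space \<Rightarrow> 'h"
  assumes T: "contraction T1" "contraction T2" and s: "special_ando_tuple T1 T2 F \<Lambda> P U"
  shows "closed_csubspace F" "isometry_into (defect_space (cadj (T1 \<circ> T2))) F \<Lambda>"
    "orth_projection F (defect_space (cadj T1) \<times> {0} \<times> {0}) P" "unitary_onto F F U"
    "\<Lambda> (defect (cadj (T1 \<circ> T2)) h) = (defect (cadj T1) (cadj T2 h), defect (cadj T2) h, 0)"
    "U (\<Lambda> (defect (cadj (T1 \<circ> T2)) h)) = (defect (cadj T1) h, defect (cadj T2) (cadj T1 h), 0)"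
    "P (defect (cadj T1) h, defect (cadj T2) k, 0) = (defect (cadj T1) h, 0, 0)"
proof -
  obtain E where E: "E = {0} \<or> E = UNIV" "F = defect_space (cadj T1) \<times> defect_space (cadj T2) \<times> E"
    using s unfolding special_ando_tuple_def Let_def by blast
  have "closed_csubspace E" using E(1) closed_csubspace_UNIV closed_csubspace_sing_0 by auto
  then show "closed_csubspace F" unfolding E(2)
    by (intro closed_csubspace_Times closed_csubspace_defect_space contraction_cadj T)
  show "isometry_into (defect_space (cadj (T1 \<circ> T2))) F \<Lambda>" "unitary_onto F F U"
    and P: "orth_projection F (defect_space (cadj T1) \<times> {0} \<times> {0}) P"
    and "\<Lambda> (defect (cadj (T1 \<circ> T2)) h) = (defect (cadj T1) (cadj T2 h), defect (cadj T2) h, 0)"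
    and "U (\<Lambda> (defect (cadj (T1 \<circ> T2)) h)) = (defect (cadj T1) h, defect (cadj T2) (cadj T1 h), 0)"
    using s unfolding special_ando_tuple_def Let_def by auto
  have "0 \<in> E" using E(1) by auto
  show "P (defect (cadj T1) h, defect (cadj T2) k, 0) = (defect (cadj T1) h, 0, 0)"
  proof (rule orth_projection_eqI[OF P])
    show "(defect (cadj T1) h, defect (cadj T2) k, 0) \<in> F"
      unfolding E(2) using \<open>0 \<in> E\<close> by (auto intro: defect_in_defect_space)
    show "(defect (cadj T1) h, 0, 0) \<in> defect_space (cadj T1) \<times> {0} \<times> {0}"
      by (auto intro: defect_in_defect_space)
    show "cinner ((defect (cadj T1) h, defect (cadj T2) k, 0) - (defect (cadj T1) h, 0, 0)) m = 0"
      if "m \<in> defect_space (cadj T1) \<times> {0} \<times> {0}" for m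
      using that by (auto simp: cinner_prod_def)
  qed
qed

lemma hardy_coeff_model_embedding:
  fixes T :: "'h::chilbert_space \<Rightarrow> 'h" and \<Lambda> :: "'h \<Rightarrow> 'f::chilbert_space" and \<iota> :: "'h \<Rightarrow> 'w"
  assumes T: "contraction T" and \<Lambda>: "isometry_into (defect_space (cadj T)) F \<Lambda>"
  shows "hardy_coeff (fst (model_embedding T \<Lambda> \<iota> h)) n = \<Lambda> (defect (cadj T) ((cadj T ^^ n) h))"
    "snd (model_embedding T \<Lambda> \<iota> h) = \<iota> (Q_star T h)"
    "(\<lambda>n. (norm (\<Lambda> (defect (cadj T) ((cadj T ^^ n) h))))\<^sup>2) sums ((norm h)\<^sup>2 - (norm (Q_star T h))\<^sup>2)"
proof -
  have norm: "norm (\<Lambda> (defect (cadj T) k)) = norm (defect (cadj T) k)" for k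
    using \<Lambda> defect_in_defect_space by (auto simp: isometry_into_def)
  show s: "(\<lambda>n. (norm (\<Lambda> (defect (cadj T) ((cadj T ^^ n) h))))\<^sup>2) sums ((norm h)\<^sup>2 - (norm (Q_star T h))\<^sup>2)"
    unfolding norm by (rule defect_orbit_sums[OF T])
  show "hardy_coeff (fst (model_embedding T \<Lambda> \<iota> h)) n = \<Lambda> (defect (cadj T) ((cadj T ^^ n) h))"
    by (simp add: model_embedding_def hardy_coeff_disk_fun_series[OF sums_summable[OF s]])
qed (simp add: model_embedding_def)

text \<open>Telescoping the norms gives \<open>\<parallel>h\<parallel>\<^sup>2 - \<parallel>Q h\<parallel>\<^sup>2\<close> for the Hardy component, whatever the isometry \<open>\<Lambda>\<close>.\<close>

lemma model_embedding_isometry: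
  fixes T :: "'h::chilbert_space \<Rightarrow> 'h" and \<Lambda> :: "'h \<Rightarrow> 'f::chilbert_space" and \<iota> :: "'h \<Rightarrow> 'w::chilbert_space"
  assumes T: "contraction T" and F: "closed_csubspace F"
    and \<Lambda>: "isometry_into (defect_space (cadj T)) F \<Lambda>"
    and \<iota>: "\<And>h k. \<iota> (Q_star T (h + k)) = \<iota> (Q_star T h) + \<iota> (Q_star T k)"
      "\<And>c h. \<iota> (Q_star T (c *\<^sub>C h)) = c *\<^sub>C \<iota> (Q_star T h)"
      "\<And>h. norm (\<iota> (Q_star T h)) = norm (Q_star T h)"
  shows "isometry_into UNIV (hardy_space F \<times> UNIV) (model_embedding T \<Lambda> \<iota>)"
  unfolding isometry_into_def clinear_on_def
proof (intro conjI ballI allI)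
  let ?E = "model_embedding T \<Lambda> \<iota>"
  note cE = hardy_coeff_model_embedding(1,2)[OF T \<Lambda>]
  note D = bounded_clinearD[OF positive_opD(1)[OF positive_op_defect_op[OF contraction_cadj[OF T]]]]
  note S = bounded_clinear_funpow[OF contractionD(1)[OF contraction_cadj[OF T]]]
  note L = contraction_onD[OF contraction_on_isometry[OF \<Lambda>] closed_csubspace_defect_space[OF contraction_cadj[OF T]]]
  show "?E (h + k) = ?E h + ?E k" for h k
    by (rule prod_eqI, rule hardy_eqI, rule ext) (simp_all add: cE D S L defect_in_defect_space \<iota>)
  show "?E (c *\<^sub>C h) = c *\<^sub>C ?E h" for c h
    by (rule prod_eqI, rule hardy_eqI, rule ext)
      (simp_all add: cE D S L defect_in_defect_space \<iota> scaleC_prod_def)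
  show "?E ` UNIV \<subseteq> hardy_space F \<times> UNIV"
  proof safe
    fix f w h assume "(f, w) = ?E h"
    then have "f = fst (?E h)" by (metis fst_conv)
    then show "f \<in> hardy_space F"
      using \<Lambda> defect_in_defect_space by (auto simp: hardy_space_iff[OF F] cE isometry_into_def)
  qed simp
  show "norm (?E h) = norm h" for h
  proof -
    have "(norm (fst (?E h)))\<^sup>2 = (norm h)\<^sup>2 - (norm (Q_star T h))\<^sup>2"
      unfolding hardy_power2_norm cE using hardy_coeff_model_embedding(3)[OF T \<Lambda>, of h]
      by (simp add: sums_iff)
    then have "(norm (?E h))\<^sup>2 = (norm h)\<^sup>2"
      by (simp add: norm_prod_def cE \<iota>)
    then show ?thesis by simp
  qed
qed

text \<open>Comparing coefficients and writing \<open>k = T*\<^sup>n h\<close>, the two intertwining relations reduce to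
  \<open>\<Lambda> D T1* k = (I - P) U \<Lambda> D k + P U \<Lambda> D T* k\<close> and
  \<open>U \<Lambda> D T2* k = P \<Lambda> D k + q (I - P) \<Lambda> D T* k\<close>.  Both can be read off from the prescribed values
  \<open>\<Lambda> D k = (D1 T2* k, D2 k, 0)\<close> and \<open>U \<Lambda> D k = (D1 k, D2 T1* k, 0)\<close>.\<close>

theorem special_tuple_model_lift:
  fixes T1 T2 :: "'h::chilbert_space \<Rightarrow> 'h" and \<iota> :: "'h \<Rightarrow> 'w::chilbert_space"
  assumes q: "cmod q = 1" and T: "contraction T1" "contraction T2" and qT: "q_commuting_on q UNIV T1 T2"
    and can: "canonical_unitary_pair q T1 T2 \<iota> W1 W2"
    and sp: "special_ando_tuple T1 T2 F \<Lambda> P U"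
  shows "q_isometric_lift q T1 T2 (hardy_space F \<times> UNIV)
    (model_V1 q F P U W1) (model_V2 q P U W2) (model_embedding (T1 \<circ> T2) \<Lambda> \<iota>)"
proof -
  let ?E = "model_embedding (T1 \<circ> T2) \<Lambda> \<iota>" and ?K = "hardy_space F \<times> (UNIV :: 'w set)"
  define Ts where "Ts = cadj (T1 \<circ> T2)"
  note cT = contraction_comp[OF T]
  note sp = special_ando_tupleD[OF T sp] and can = canonical_unitary_pairD[OF T can q]
  note F = sp(1) and P = sp(3) and U = sp(4)
  have iso: "isometry_into UNIV ?K ?E"
    by (rule model_embedding_isometry[OF cT F sp(2) can(4-6)])
  have K: "closed_csubspace ?K"
    by (intro closed_csubspace_Times closed_csubspace_hardy_space F closed_csubspace_UNIV)
  note cE = hardy_coeff_model_embedding(1,2)[OF cT sp(2), folded Ts_def]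
  have EK: "fst (?E h) \<in> hardy_space F" for h using isometry_UNIV(3)[OF iso, of h] by (simp add: mem_Times_iff)
  note cqT = cadj_q_commuting[OF contractionD(1)[OF T(1)] contractionD(1)[OF T(2)] qT q]
  note powT = cadj_power_q_commuting[OF T qT q, folded Ts_def]
  note L = contraction_onD[OF contraction_on_isometry[OF sp(2)] closed_csubspace_defect_space[OF contraction_cadj[OF cT]]]
  note D = bounded_clinearD[OF positive_opD(1)[OF positive_op_defect_op[OF contraction_cadj[OF cT]]]]
    bounded_clinearD[OF positive_opD(1)[OF positive_op_defect_op[OF contraction_cadj[OF T(2)]]]]
  note Ulin = contraction_onD[OF contraction_on_isometry[OF unitary_isometry[OF U]] F]
  have \<Lambda>F: "\<Lambda> (defect (cadj (T1 \<circ> T2)) h) \<in> F" for h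
    using sp(2) defect_in_defect_space by (auto simp: isometry_into_def)
  have adj1: "adj_on ?K (model_V1 q F P U W1) (?E h) = ?E (cadj T1 h)" for h
  proof (rule adj_on_eqI[OF K])
    show "?E (cadj T1 h) \<in> ?K" using EK by (simp add: mem_Times_iff)
    have coeff: "hardy_coeff (fst (?E (cadj T1 h))) n = cnj q ^ n *\<^sub>C
        ((U (hardy_coeff (fst (?E h)) n) - P (U (hardy_coeff (fst (?E h)) n)))
          + P (U (hardy_coeff (fst (?E h)) (Suc n))))" for n
    proof -
      define k where "k = (Ts ^^ n) h"
      have k: "(Ts ^^ Suc n) h = Ts k" by (simp add: k_def)
      have "\<Lambda> (defect Ts (cadj T1 k)) =
          (U (\<Lambda> (defect Ts k)) - P (U (\<Lambda> (defect Ts k)))) + P (U (\<Lambda> (defect Ts (Ts k))))"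
        unfolding Ts_def sp(6) unfolding sp(5) sp(7) by (simp add: cqT)
      then show ?thesis
        unfolding cE k powT unfolding k_def[symmetric] unfolding Ts_def
        by (simp add: D L defect_in_defect_space)
    qed
    fix s assume "s \<in> ?K"
    then obtain f w where s: "s = (f, w)" "f \<in> hardy_space F" by auto
    show "cinner (model_V1 q F P U W1 s) (?E h) = cinner s (?E (cadj T1 h))"
      by (simp only: s(1) model_V_hardy cinner_prod_def fst_conv snd_conv cE can(7)
          unitary_onto_adj(4)[OF can(1) closed_csubspace_UNIV UNIV_I UNIV_I]
          hardy_V1_adjoint[OF q F P U s(2) EK coeff])
  qed
  have adj2: "adj_on ?K (model_V2 q P U W2) (?E h) = ?E (cadj T2 h)" for h
  proof (rule adj_on_eqI[OF K])
    show "?E (cadj T2 h) \<in> ?K" using EK by (simp add: mem_Times_iff)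
    have coeff: "U (hardy_coeff (fst (?E (cadj T2 h))) n) = q ^ n *\<^sub>C
        (P (hardy_coeff (fst (?E h)) n) + q *\<^sub>C (hardy_coeff (fst (?E h)) (Suc n) - P (hardy_coeff (fst (?E h)) (Suc n))))" for n
    proof -
      define k where "k = (Ts ^^ n) h"
      have k: "(Ts ^^ Suc n) h = Ts k" by (simp add: k_def)
      have "U (\<Lambda> (defect Ts (cadj T2 k))) =
          P (\<Lambda> (defect Ts k)) + q *\<^sub>C (\<Lambda> (defect Ts (Ts k)) - P (\<Lambda> (defect Ts (Ts k))))"
        unfolding Ts_def sp(6) unfolding sp(5) sp(7) by (simp add: cqT D scaleC_prod_def)
      then show ?thesis
        unfolding cE k powT unfolding k_def[symmetric] unfolding Ts_def
        by (simp add: D L Ulin \<Lambda>F defect_in_defect_space)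
    qed
    fix s assume "s \<in> ?K"
    then obtain f w where s: "s = (f, w)" "f \<in> hardy_space F" by auto
    show "cinner (model_V2 q P U W2 s) (?E h) = cinner s (?E (cadj T2 h))"
      by (simp only: s(1) model_V_hardy cinner_prod_def fst_conv snd_conv cE can(8)
          unitary_onto_adj(4)[OF can(2) closed_csubspace_UNIV UNIV_I UNIV_I]
          hardy_V2_adjoint[OF q F P U s(2) EK coeff EK])
  qed
  show ?thesis
    unfolding q_isometric_lift_def
    using K iso adj1 adj2 model_V_isometry[OF q F P U unitary_isometry[OF can(1)] unitary_isometry[OF can(2)]]
      model_V_q_commuting[OF q F P U can(3)]
    by blast
qed

section \<open>The Wold decomposition of a \<open>q\<close>-commuting pair of isometries\<close>

locale q_isometric_pair =
  fixes q :: complex and V1 V2 :: "'k::chilbert_space \<Rightarrow> 'k"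
  assumes q: "cmod q = 1" and V1: "isometry_into UNIV UNIV V1" and V2: "isometry_into UNIV UNIV V2"
    and comm: "V1 (V2 x) = q *\<^sub>C V2 (V1 x)"
begin

abbreviation "V1s \<equiv> cadj V1"
abbreviation "V2s \<equiv> cadj V2"
definition V :: "'k \<Rightarrow> 'k" where "V = V1 \<circ> V2"
abbreviation "Vs \<equiv> cadj V"

text \<open>The defect projection of \<open>V\<close>, onto the wandering subspace.\<close>

definition G :: "'k \<Rightarrow> 'k" where "G x = x - V (Vs x)"

definition wandering :: "'k set" where "wandering = {x. Vs x = 0}"

text \<open>The wandering space splits as \<open>ker V2* + V2 (ker V1*)\<close> and as \<open>V1 (ker V2*) + ker V1*\<close>.  On it, \<open>P\<close>
  is the projection onto \<open>V2 (ker V1*)\<close>, and \<open>U\<close> maps the second splitting onto the first, by \<open>V1*\<close> on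
  \<open>V1 (ker V2*)\<close> and by \<open>V2\<close> on \<open>ker V1*\<close>.  \<open>Us\<close> is the inverse of \<open>U\<close> there.\<close>

definition P :: "'k \<Rightarrow> 'k" where "P x = V2 (V2s x) - V (Vs x)"

definition U :: "'k \<Rightarrow> 'k" where "U x = V2 (x - V1 (V1s x)) + V1s x"

definition Us :: "'k \<Rightarrow> 'k" where "Us x = V1 (x - V2 (V2s x)) + V2s x"

text \<open>The projection onto the unitary part \<open>\<Inter>n. V\<^sup>n K\<close>.\<close>

abbreviation "E \<equiv> power_limit V"

lemma contractions: "contraction V1" "contraction V2" "contraction V" "contraction V1s" "contraction V2s" "contraction Vs"
  using isometry_UNIV(1)[OF V1] isometry_UNIV(1)[OF V2] unfolding V_def
  by (auto intro: contraction_comp contraction_cadj)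

lemma V_apply [simp]: "V x = V1 (V2 x)"
  by (simp add: V_def)

lemmas lins = bounded_clinearD(2-6)[OF contractionD(1)[OF contractions(1)]]
  bounded_clinearD(2-6)[OF contractionD(1)[OF contractions(2)]]
  bounded_clinearD(2-6)[OF contractionD(1)[OF contractions(4)]]
  bounded_clinearD(2-6)[OF contractionD(1)[OF contractions(5)]]

lemma norms: "norm (V1 x) = norm x" "norm (V2 x) = norm x" "norm (V x) = norm x"
  using isometry_UNIV(2)[OF V1] isometry_UNIV(2)[OF V2] by simp_all

lemma qq: "q * cnj q = 1" "cnj q * q = 1" "q * (cnj q * a) = a" "cnj q * (q * a) = a"
proof -
  show 1: "q * cnj q = 1" "cnj q * q = 1"
    using q by (simp_all add: complex_norm_square[symmetric] mult.commute)
  show "q * (cnj q * a) = a" "cnj q * (q * a) = a" by (simp_all add: 1 mult.assoc[symmetric])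
qed

lemma adj: "cinner (V1s x) y = cinner x (V1 y)" "cinner (V2s x) y = cinner x (V2 y)" "cinner (Vs x) y = cinner x (V y)"
  by (rule cinner_cadj_left, rule contractionD, rule contractions)+

lemma adj': "cinner x (V1s y) = cinner (V1 x) y" "cinner x (V2s y) = cinner (V2 x) y" "cinner x (Vs y) = cinner (V x) y"
  by (rule cinner_cadj_right, rule contractionD, rule contractions)+

lemma V1s_V1: "V1s (V1 x) = x" and V2s_V2: "V2s (V2 x) = x"
  by (rule cadj_eqI, rule isometry_cinner[OF V1 closed_csubspace_UNIV UNIV_I UNIV_I])
    (rule cadj_eqI, rule isometry_cinner[OF V2 closed_csubspace_UNIV UNIV_I UNIV_I])

lemma V2_V1: "V2 (V1 x) = cnj q *\<^sub>C V1 (V2 x)"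
  by (simp add: comm qq)

lemma Vs_eq: "Vs x = V2s (V1s x)"
  unfolding V_def by (rule cadj_comp[OF contractionD(1)[OF contractions(1)] contractionD(1)[OF contractions(2)]])

lemma V1s_V2s: "V1s (V2s x) = q *\<^sub>C V2s (V1s x)"
  using cadj_q_commuting(1)[OF contractionD(1)[OF contractions(1)] contractionD(1)[OF contractions(2)] _ q]
  by (simp add: q_commuting_on_def comm Vs_eq flip: V_def)

lemma V2s_V: "V2s (V1 (V2 x)) = q *\<^sub>C V1 x"
  by (subst comm) (simp add: lins V2s_V2)

lemma Vs_V2: "V2s (V1s (V2 x)) = cnj q *\<^sub>C V1s x"
  using V1s_V2s[of "V2 x"] by (simp add: V2s_V2 qq)

text \<open>Rewrite rules for words in the four operators.  Two of them order the factors, as \<open>V1 V2\<close> and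
  as \<open>V2* V1*\<close>.  The last two complete the system: \<open>V2* V1 V2\<close> and \<open>V2* V1* V2\<close> are ordered but contract
  after an exchange of \<open>V1\<close> or \<open>V1*\<close> with its neighbour.\<close>

lemmas words = V1s_V1 V2s_V2 V2_V1 V1s_V2s V2s_V Vs_V2

lemma Vs_V: "Vs (V x) = x"
  by (simp add: Vs_eq words)

lemma closed_csubspace_wandering: "closed_csubspace wandering"
  unfolding wandering_def
  by (intro closed_csubspace_Collect_eq bounded_clinear_ident contractionD(1) contractions)

lemma G_in_wandering: "G x \<in> wandering"
  by (simp add: wandering_def G_def Vs_eq lins words qq)

lemma wanderingD: "x \<in> wandering \<Longrightarrow> V2s (V1s x) = 0"
  by (simp add: wandering_def Vs_eq)

lemma P_orth_projection: "orth_projection wandering (wandering \<inter> {x. V2 (V2s x) = x}) P"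
  unfolding orth_projection_def
proof (intro conjI ballI)
  show "closed_csubspace (wandering \<inter> {x. V2 (V2s x) = x})"
    by (rule closed_csubspace_Int[OF closed_csubspace_wandering closed_csubspace_Collect_eq[OF
            bounded_clinear_compose[OF contractionD(1)[OF contractions(2)] contractionD(1)[OF contractions(5)]]
            bounded_clinear_ident(1)]])
  fix x assume x: "x \<in> wandering"
  then have Px: "P x = V2 (V2s x)" by (simp add: P_def wandering_def lins)
  show "P x \<in> wandering \<inter> {x. V2 (V2s x) = x}"
    unfolding Px using wanderingD[OF x] by (simp add: wandering_def Vs_eq words lins)
  fix m assume "m \<in> wandering \<inter> {x. V2 (V2s x) = x}"
  then have m: "V2 (V2s m) = m" by simp
  have "cinner x m = cinner (V2s x) (V2s m)" by (simp add: adj m)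
  also have "\<dots> = cinner (V2 (V2s x)) m"
    by (rule adj'(2))
  finally show "cinner (x - P x) m = 0" by (simp add: Px cinner_diff_left)
qed blast

lemma Us_in_wandering: "y \<in> wandering \<Longrightarrow> Us y \<in> wandering"
  using wanderingD[of y] by (simp add: wandering_def Vs_eq Us_def lins words qq)

lemma U_Us: "y \<in> wandering \<Longrightarrow> U (Us y) = y"
  using wanderingD[of y] by (simp add: U_def Us_def lins words qq)

lemma U_unitary: "unitary_onto wandering wandering U"
  unfolding unitary_onto_def isometry_into_def clinear_on_def
proof (intro conjI ballI allI)
  show "U (x + y) = U x + U y" "U (c *\<^sub>C x) = c *\<^sub>C U x" for x y c
    by (simp_all add: U_def lins scaleC_diff_right scaleC_add_right algebra_simps)
  have im: "U x \<in> wandering" if "x \<in> wandering" for x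
  proof -
    have "V2s (V1s (V1s x)) = cnj q *\<^sub>C V1s (V2s (V1s x))" by (simp add: V1s_V2s qq)
    then have "V2s (V1s (V1s x)) = 0" by (simp add: wanderingD[OF that] lins)
    then show ?thesis using wanderingD[OF that] by (simp add: wandering_def Vs_eq U_def lins words qq)
  qed
  then show "U ` wandering \<subseteq> wandering" by blast
  show "U ` wandering = wandering"
    using im U_Us Us_in_wandering by (metis (no_types, lifting) image_subset_iff subsetI subset_antisym image_eqI)
  fix x assume x: "x \<in> wandering"
  have "cinner (V2 (x - V1 (V1s x))) (V1s x) = cinner (x - V1 (V1s x)) (V2s (V1s x))"
    by (simp add: adj')
  then have o: "inner (V2 (x - V1 (V1s x))) (V1s x) = 0"
    using wanderingD[OF x] by (simp add: inner_eq_Re_cinner)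
  have o': "inner (x - V1 (V1s x)) (V1 (V1s x)) = 0"
    by (simp add: inner_eq_Re_cinner adj(1)[symmetric] lins words)
  have "(norm (U x))\<^sup>2 = (norm (V2 (x - V1 (V1s x))))\<^sup>2 + (norm (V1s x))\<^sup>2"
    unfolding U_def using o by (simp add: power2_norm_eq_inner inner_add_left inner_add_right inner_commute)
  also have "\<dots> = (norm (x - V1 (V1s x)))\<^sup>2 + (norm (V1 (V1s x)))\<^sup>2"
    by (simp add: norms)
  also have "\<dots> = (norm x)\<^sup>2"
    using o' by (simp add: power2_norm_eq_inner inner_diff_left inner_diff_right inner_commute)
  finally show "norm (U x) = norm x" by simp
qed

lemma adj_U: "y \<in> wandering \<Longrightarrow> adj_on wandering U y = Us y"
  using unitary_onto_adj(1)[OF U_unitary closed_csubspace_wandering Us_in_wandering, of y]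
  by (simp add: U_Us)

text \<open>The four coefficients of the bidiagonal model operators, evaluated on \<open>G y\<close>.\<close>

lemma Us_complement_G: "adj_on wandering U (G y - P (G y)) = V1 (y - V2 (V2s y))"
proof -
  have e: "G y - P (G y) = y - V2 (V2s y)"
    by (simp add: G_def P_def Vs_eq lins words qq)
  have "y - V2 (V2s y) \<in> wandering"
    by (simp add: wandering_def Vs_eq lins words qq)
  then show ?thesis unfolding e by (simp add: adj_U Us_def lins words)
qed

lemma Us_P_G: "adj_on wandering U (P (G y)) = V2s y - q *\<^sub>C V1 (Vs y)"
proof -
  have e: "P (G y) = V2 (V2s y - q *\<^sub>C V1 (Vs y))"
    by (simp add: G_def P_def Vs_eq lins words qq)
  have "P (G y) \<in> wandering"
    unfolding e by (simp add: wandering_def Vs_eq lins words qq)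
  then have "adj_on wandering U (P (G y)) = Us (V2 (V2s y - q *\<^sub>C V1 (Vs y)))"
    by (simp add: adj_U) (simp add: e)
  moreover have "Us (V2 t) = t" for t by (simp add: Us_def V2s_V2 lins)
  ultimately show ?thesis by simp
qed

lemma P_U_G: "P (U (G y)) = V2 (y - V1 (V1s y))"
  by (simp add: G_def P_def U_def Vs_eq lins words qq scaleC_diff_right)

lemma U_G_complement: "U (G y) - P (U (G y)) = V1s y - V2 (Vs y)"
  unfolding P_U_G by (simp add: G_def U_def Vs_eq lins words qq scaleC_diff_right)

lemma funpow_rules:
  "(Vs ^^ n) (V2s x) = q ^ n *\<^sub>C V2s ((Vs ^^ n) x)"
  "(Vs ^^ n) (V1s x) = cnj q ^ n *\<^sub>C V1s ((Vs ^^ n) x)"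
  "(Vs ^^ Suc n) (V1 x) = q ^ n *\<^sub>C V2s ((Vs ^^ n) x)"
  "(Vs ^^ Suc n) (V2 x) = cnj q ^ Suc n *\<^sub>C V1s ((Vs ^^ n) x)"
proof -
  note Vsb = contractionD(1)[OF contractions(6)]
  show 1: "(Vs ^^ n) (V2s x) = q ^ n *\<^sub>C V2s ((Vs ^^ n) x)" for x
    by (rule q_commuting_powers[OF Vsb]) (simp add: Vs_eq words lins)
  show 2: "(Vs ^^ n) (V1s x) = cnj q ^ n *\<^sub>C V1s ((Vs ^^ n) x)" for x
    by (rule q_commuting_powers[OF Vsb]) (simp add: Vs_eq words lins qq)
  have 3: "Vs (V1 x) = V2s x" "Vs (V2 x) = cnj q *\<^sub>C V1s x"
    by (simp_all add: Vs_eq words)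
  show "(Vs ^^ Suc n) (V1 x) = q ^ n *\<^sub>C V2s ((Vs ^^ n) x)"
    unfolding funpow_Suc_right o_apply[of "Vs ^^ n"] 3 by (rule 1)
  show "(Vs ^^ Suc n) (V2 x) = cnj q ^ Suc n *\<^sub>C V1s ((Vs ^^ n) x)"
    unfolding funpow_Suc_right o_apply[of "Vs ^^ n"] 3 bounded_clinear_funpow(3)[OF Vsb] 2 by simp
qed

lemma norm_G: "(norm (G x))\<^sup>2 = (norm x)\<^sup>2 - (norm (Vs x))\<^sup>2"
proof -
  have "cinner x (V (Vs x)) = of_real ((norm (Vs x))\<^sup>2)" "cinner (V (Vs x)) x = of_real ((norm (Vs x))\<^sup>2)"
    by (simp_all only: adj(3)[symmetric] adj'(3)[symmetric] cinner_norm_square)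
  then have "inner x (V (Vs x)) = (norm (Vs x))\<^sup>2" "inner (V (Vs x)) x = (norm (Vs x))\<^sup>2"
    by (simp_all only: inner_eq_Re_cinner Re_complex_of_real)
  moreover have "(norm (V (Vs x)))\<^sup>2 = (norm (Vs x))\<^sup>2" by (simp only: norms)
  ultimately show ?thesis
    unfolding G_def by (simp add: power2_norm_eq_inner inner_diff_left inner_diff_right)
qed

lemma bounded_clinear_G: "bounded_clinear G"
  unfolding G_def[abs_def]
  by (rule bounded_clinear_diff[OF bounded_clinear_ident(1)
        bounded_clinear_compose[OF contractionD(1)[OF contractions(3)] contractionD(1)[OF contractions(6)]]])

lemma G_selfadjoint: "cinner (G x) y = cinner x (G y)"
  unfolding G_def by (simp only: cinner_diff_left cinner_diff_right adj(3)[symmetric] adj'(3)[symmetric])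

lemma G_V: "G (V x) = 0"
  by (simp only: G_def Vs_V diff_self)

lemma G_wandering: "x \<in> wandering \<Longrightarrow> G x = x"
  by (simp add: G_def wandering_def lins)

lemma Vs_funpow_V_funpow: "(Vs ^^ n) ((V ^^ n) x) = x"
proof (induction n arbitrary: x)
  case (Suc n)
  have "(Vs ^^ Suc n) ((V ^^ Suc n) x) = (Vs ^^ n) (Vs (V ((V ^^ n) x)))"
    by (simp only: funpow_Suc_right[of n Vs] funpow.simps(2)[of n V] o_apply)
  then show ?case by (simp only: Vs_V Suc)
qed simp

lemma norm_V_funpow: "norm ((V ^^ n) x) = norm x"
  by (induction n) (simp_all add: norms)

lemma norm_E_LIMSEQ: "(\<lambda>n. (norm ((Vs ^^ n) x))\<^sup>2) \<longlonglongrightarrow> (norm (E x))\<^sup>2"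
  using tendsto_power[OF tendsto_norm[OF power_limit_LIMSEQ[OF contractions(3), of x]], of 2]
  by (simp add: norm_V_funpow)

lemma G_orbit_sums: "(\<lambda>n. (norm (G ((Vs ^^ n) x)))\<^sup>2) sums ((norm x)\<^sup>2 - (norm (E x))\<^sup>2)"
  using telescope_sums'[OF norm_E_LIMSEQ[of x]] by (simp add: norm_G)

lemma V_E: "V (E x) = E (V x)"
proof (rule LIMSEQ_unique)
  show "(\<lambda>n. V ((V ^^ n) ((Vs ^^ n) x))) \<longlonglongrightarrow> V (E x)"
    by (rule tendsto_bounded_clinear[OF contractionD(1)[OF contractions(3)] power_limit_LIMSEQ[OF contractions(3)]])
  have "(\<lambda>n. (V ^^ Suc n) ((Vs ^^ Suc n) (V x))) \<longlonglongrightarrow> E (V x)"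
    by (rule LIMSEQ_Suc[OF power_limit_LIMSEQ[OF contractions(3)]])
  moreover have "(V ^^ Suc n) ((Vs ^^ Suc n) (V x)) = V ((V ^^ n) ((Vs ^^ n) x))" for n
    by (simp only: funpow_Suc_right[of n Vs] funpow.simps(2)[of n V] o_apply[of "Vs ^^ n"] Vs_V)
      (simp only: o_apply[of V])
  ultimately show "(\<lambda>n. V ((V ^^ n) ((Vs ^^ n) x))) \<longlonglongrightarrow> E (V x)" by simp
qed

lemma Vs_E: "Vs (E x) = E (Vs x)"
proof (rule LIMSEQ_unique)
  have "(\<lambda>n. Vs ((V ^^ Suc n) ((Vs ^^ Suc n) x))) \<longlonglongrightarrow> Vs (E x)"
    by (rule tendsto_bounded_clinear[OF contractionD(1)[OF contractions(6)]
          LIMSEQ_Suc[OF power_limit_LIMSEQ[OF contractions(3)]]])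
  moreover have "Vs ((V ^^ Suc n) ((Vs ^^ Suc n) x)) = (V ^^ n) ((Vs ^^ n) (Vs x))" for n
    by (simp only: funpow_Suc_right[of n Vs] funpow.simps(2)[of n V] o_apply[of V] o_apply[of "Vs ^^ n"] Vs_V)
  ultimately show "(\<lambda>n. (V ^^ n) ((Vs ^^ n) (Vs x))) \<longlonglongrightarrow> Vs (E x)" by simp
qed (rule power_limit_LIMSEQ[OF contractions(3)])

lemma E_in_range: "(V ^^ m) ((Vs ^^ m) (E x)) = E x"
proof (rule LIMSEQ_unique)
  have b: "bounded_clinear (\<lambda>x. (V ^^ m) ((Vs ^^ m) x))"
    by (rule bounded_clinearI[where K = 1])
      (simp_all add: bounded_clinear_funpow[OF contractionD(1)[OF contractions(3)]]
        bounded_clinear_funpow[OF contractionD(1)[OF contractions(6)]] norm_V_funpow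
        contraction_funpow_norm[OF contractions(6)])
  have "(\<lambda>n. (V ^^ m) ((Vs ^^ m) ((V ^^ (n + m)) ((Vs ^^ (n + m)) x)))) \<longlonglongrightarrow> (V ^^ m) ((Vs ^^ m) (E x))"
    by (rule tendsto_bounded_clinear[OF b LIMSEQ_ignore_initial_segment[OF power_limit_LIMSEQ[OF contractions(3)]]])
  moreover have "(V ^^ m) ((Vs ^^ m) ((V ^^ (n + m)) y)) = (V ^^ (n + m)) y" for n y
    unfolding add.commute[of n m] funpow_add o_apply[of "V ^^ m"] Vs_funpow_V_funpow ..
  ultimately show "(\<lambda>n. (V ^^ (n + m)) ((Vs ^^ (n + m)) x)) \<longlonglongrightarrow> (V ^^ m) ((Vs ^^ m) (E x))"
    by simp
qed (rule LIMSEQ_ignore_initial_segment[OF power_limit_LIMSEQ[OF contractions(3)]])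

lemma E_fixed: "(\<And>n. (V ^^ n) ((Vs ^^ n) x) = x) \<Longrightarrow> E x = x"
  using LIMSEQ_unique[OF power_limit_LIMSEQ[OF contractions(3), of x]] by simp

lemma E_idem: "E (E x) = E x"
  by (rule E_fixed) (rule E_in_range)

lemmas E_lin = bounded_clinearD[OF contractionD(1)[OF contraction_power_limit[OF contractions(3)]]]

text \<open>The unitary part reduces \<open>V1\<close> and \<open>V2\<close>.  It is invariant because \<open>V1\<close> and \<open>V2\<close> commute with
  \<open>V\<^sup>n\<close> up to a scalar.  Its complement consists of the \<open>y\<close> with \<open>V*\<^sup>n y \<longlonglongrightarrow> 0\<close>, and
  \<open>V*\<^sup>n\<^sup>+\<^sup>1 V1 y\<close> is a multiple of \<open>V2* V*\<^sup>n y\<close>.\<close>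

lemma E_commutes:
  assumes A: "bounded_clinear A"
    and inv: "\<And>n z. \<exists>c. A ((V ^^ n) z) = c *\<^sub>C (V ^^ n) (A z)"
    and bound: "\<And>n y. norm ((Vs ^^ Suc n) (A y)) \<le> norm ((Vs ^^ n) y)"
  shows "E (A x) = A (E x)"
proof -
  note AL = bounded_clinearD[OF A]
  have "E (A (E x)) = A (E x)"
  proof (rule E_fixed)
    fix n
    obtain c where "A ((V ^^ n) ((Vs ^^ n) (E x))) = c *\<^sub>C (V ^^ n) (A ((Vs ^^ n) (E x)))" using inv by blast
    then have "A (E x) = (V ^^ n) (c *\<^sub>C A ((Vs ^^ n) (E x)))"
      by (simp add: E_in_range bounded_clinear_funpow[OF contractionD(1)[OF contractions(3)]])
    then show "(V ^^ n) ((Vs ^^ n) (A (E x))) = A (E x)" by (simp add: Vs_funpow_V_funpow)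
  qed
  moreover have "E (A (x - E x)) = 0"
  proof -
    define y where "y = x - E x"
    have "E y = 0" by (simp add: y_def E_lin E_idem)
    then have "(\<lambda>n. (norm ((Vs ^^ n) y))\<^sup>2) \<longlonglongrightarrow> 0" using norm_E_LIMSEQ[of y] by simp
    moreover have "(\<lambda>n. (norm ((Vs ^^ Suc n) (A y)))\<^sup>2) \<longlonglongrightarrow> (norm (E (A y)))\<^sup>2"
      by (rule LIMSEQ_Suc[OF norm_E_LIMSEQ])
    moreover have "\<exists>N. \<forall>n\<ge>N. (norm ((Vs ^^ Suc n) (A y)))\<^sup>2 \<le> (norm ((Vs ^^ n) y))\<^sup>2"
      using power_mono[OF bound norm_ge_zero] by blast
    ultimately have "(norm (E (A y)))\<^sup>2 \<le> 0" using LIMSEQ_le by blast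
    then show ?thesis by (simp add: y_def)
  qed
  ultimately show ?thesis by (simp add: AL E_lin)
qed

lemma V_funpow_rules:
  "V1 ((V ^^ n) z) = q ^ n *\<^sub>C (V ^^ n) (V1 z)" "V2 ((V ^^ n) z) = cnj q ^ n *\<^sub>C (V ^^ n) (V2 z)"
proof -
  note Vb = contractionD(1)[OF contractions(3)]
  have "(V ^^ n) (V1 z) = cnj q ^ n *\<^sub>C V1 ((V ^^ n) z)" "(V ^^ n) (V2 z) = q ^ n *\<^sub>C V2 ((V ^^ n) z)"
    by (rule q_commuting_powers[OF Vb], simp add: words lins qq)+
  then show "V1 ((V ^^ n) z) = q ^ n *\<^sub>C (V ^^ n) (V1 z)" "V2 ((V ^^ n) z) = cnj q ^ n *\<^sub>C (V ^^ n) (V2 z)"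
    by (simp_all add: power_mult_distrib[symmetric] qq)
qed

lemma E_V: "E (V1 x) = V1 (E x)" "E (V2 x) = V2 (E x)"
proof -
  show "E (V1 x) = V1 (E x)"
  proof (rule E_commutes[OF contractionD(1)[OF contractions(1)]])
    show "\<exists>c. V1 ((V ^^ n) z) = c *\<^sub>C (V ^^ n) (V1 z)" for n z using V_funpow_rules(1) by blast
    show "norm ((Vs ^^ Suc n) (V1 y)) \<le> norm ((Vs ^^ n) y)" for n y
      unfolding funpow_rules by (simp add: norm_power q contractionD(2)[OF contractions(5)])
  qed
  show "E (V2 x) = V2 (E x)"
  proof (rule E_commutes[OF contractionD(1)[OF contractions(2)]])
    show "\<exists>c. V2 ((V ^^ n) z) = c *\<^sub>C (V ^^ n) (V2 z)" for n z using V_funpow_rules(2) by blast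
    show "norm ((Vs ^^ Suc n) (V2 y)) \<le> norm ((Vs ^^ n) y)" for n y
      unfolding funpow_rules by (simp add: norm_power norm_mult q contractionD(2)[OF contractions(4)])
  qed
qed

lemma E_selfadjoint: "cinner (E x) y = cinner x (E y)"
  by (rule positive_op_selfadjoint[OF positive_op_power_limit[OF contractions(3)]])

lemma E_Vs: "E (V1s x) = V1s (E x)" "E (V2s x) = V2s (E x)"
  by (rule cinner_extensionality, simp add: adj' E_selfadjoint[symmetric] E_V)+

lemma V_unitary_on_E: "V1 (V1s (E x)) = E x" "V2 (V2s (E x)) = E x"
proof -
  have e: "E x = V (Vs (E x))" using E_in_range[of 1 x] by simp
  show "V1 (V1s (E x)) = E x" by (subst (1 2) e) (simp add: words)
  show "V2 (V2s (E x)) = E x" by (subst (1 2) e) (simp add: words lins qq)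
qed

lemma G_orbit_E: "G ((Vs ^^ n) (E x)) = 0"
proof -
  have "(Vs ^^ n) (E x) = E ((Vs ^^ n) x)" by (induction n) (simp_all add: Vs_E del: V_apply)
  moreover have "G (E y) = 0" for y
    using E_in_range[of 1 y] by (simp add: G_def)
  ultimately show ?thesis by simp
qed

text \<open>The Hardy space component of the Wold decomposition: the coefficients of \<open>x\<close> along the orthogonal
  subspaces \<open>V\<^sup>n F\<close>, pulled back to \<open>F\<close>.\<close>

definition wold :: "'k \<Rightarrow> 'k hardy" where
  "wold x = (SOME f. hardy_coeff f = (\<lambda>n. G ((Vs ^^ n) x)))"

lemma hardy_coeff_wold: "hardy_coeff (wold x) n = G ((Vs ^^ n) x)"
proof -
  have "\<exists>f. hardy_coeff f = (\<lambda>n. G ((Vs ^^ n) x))"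
    by (rule hardy_coeff_surj[OF sums_summable[OF G_orbit_sums]])
  then have "hardy_coeff (wold x) = (\<lambda>n. G ((Vs ^^ n) x))"
    unfolding wold_def by (rule someI_ex)
  then show ?thesis by simp
qed

lemma wold_in_hardy_space: "wold x \<in> hardy_space wandering"
  by (simp add: hardy_space_iff[OF closed_csubspace_wandering] hardy_coeff_wold G_in_wandering)

lemma norm_wold: "(norm (wold x))\<^sup>2 = (norm x)\<^sup>2 - (norm (E x))\<^sup>2"
  unfolding hardy_power2_norm hardy_coeff_wold using G_orbit_sums[of x] by (simp add: sums_iff)

lemma bounded_clinear_wold: "bounded_clinear wold"
proof (rule bounded_clinearI[where K = 1])
  note L = bounded_clinear_funpow[OF contractionD(1)[OF contractions(6)]] bounded_clinearD[OF bounded_clinear_G]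
  show "wold (x + y) = wold x + wold y" for x y
    by (rule hardy_eqI, rule ext) (simp add: hardy_coeff_wold L)
  show "wold (c *\<^sub>C x) = c *\<^sub>C wold x" for c x
    by (rule hardy_eqI, rule ext) (simp add: hardy_coeff_wold L)
  have "(norm (wold x))\<^sup>2 \<le> (norm x)\<^sup>2" for x by (simp add: norm_wold)
  then show "norm (wold x) \<le> 1 * norm x" for x by (auto intro: power2_le_imp_le)
qed

lemma wold_E: "wold (E x) = 0"
  by (rule hardy_eqI, rule ext) (simp add: hardy_coeff_wold G_orbit_E)

lemma hardy_coeff_wold_shift:
  assumes g: "g \<in> wandering"
  shows "hardy_coeff (wold ((V ^^ n) g)) k = (if k = n then g else 0)"
proof -
  note L = bounded_clinearD[OF bounded_clinear_G] and Vs0 = bounded_clinearD(6)[OF contractionD(1)[OF contractions(6)]]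
  consider "k < n" | "k = n" | "k > n" by linarith
  then show ?thesis
  proof cases
    case 1
    then obtain j where "n = k + Suc j" using less_imp_Suc_add by auto
    then have "(Vs ^^ k) ((V ^^ n) g) = V ((V ^^ j) g)"
      using Vs_funpow_V_funpow[of k "(V ^^ Suc j) g"] by (simp only: funpow_add o_apply[of "V ^^ k"] funpow.simps(2) o_apply[of V "V ^^ j"])
    then show ?thesis using 1 by (simp add: hardy_coeff_wold G_V del: V_apply)
  next
    case 2
    then show ?thesis by (simp add: hardy_coeff_wold Vs_funpow_V_funpow G_wandering g)
  next
    case 3
    then obtain j where "k = j + Suc n" using less_imp_Suc_add[of n k] by auto
    then have k: "k = (j + 1) + n" by simp
    have "(Vs ^^ k) ((V ^^ n) g) = (Vs ^^ j) (Vs g)"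
      unfolding k funpow_add[of "j + 1"] o_apply[of "Vs ^^ (j + 1)"] Vs_funpow_V_funpow
      by (simp add: funpow_swap1)
    also have "\<dots> = 0" using g by (induction j) (simp_all add: wandering_def Vs0)
    finally show ?thesis using 3 by (simp add: hardy_coeff_wold L)
  qed
qed

text \<open>The adjoint of \<open>wold\<close> provides preimages.  Testing against \<open>V\<^sup>n G s\<close> recovers the coefficients,
  testing against the unitary part gives \<open>0\<close>.\<close>

lemma wold_surj:
  assumes f: "f \<in> hardy_space wandering"
  shows "wold (cadj wold f) = f" "E (cadj wold f) = 0"
proof -
  note adjw = cinner_cadj_right[OF bounded_clinear_wold]
  have fn: "hardy_coeff f n \<in> wandering" for n
    using f by (simp add: hardy_space_iff[OF closed_csubspace_wandering])
  have "hardy_coeff (wold (cadj wold f)) n = hardy_coeff f n" for n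
  proof (rule cinner_extensionality)
    fix s
    have "cinner s (hardy_coeff (wold (cadj wold f)) n) = cinner (wold ((V ^^ n) (G s))) f"
      by (simp add: hardy_coeff_wold G_selfadjoint[symmetric] adjw
          cinner_funpow_cadj[OF contractionD(1)[OF contractions(3)], symmetric])
    also have "\<dots> = (\<Sum>k. if k = n then cinner (G s) (hardy_coeff f k) else 0)"
      unfolding cinner_hardy_def hardy_coeff_wold_shift[OF G_in_wandering]
      by (rule suminf_cong) simp
    also have "\<dots> = cinner (G s) (hardy_coeff f n)"
      using sums_single[of n "\<lambda>k. cinner (G s) (hardy_coeff f k)"] by (simp add: sums_iff)
    also have "\<dots> = cinner s (hardy_coeff f n)"
      by (simp add: G_selfadjoint G_wandering fn)
    finally show "cinner s (hardy_coeff (wold (cadj wold f)) n) = cinner s (hardy_coeff f n)" .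
  qed
  then show "wold (cadj wold f) = f" by (intro hardy_eqI ext)
  show "E (cadj wold f) = 0"
    by (rule cinner_extensionality) (simp add: E_selfadjoint[symmetric] adjw wold_E)
qed

text \<open>For the coefficient \<open>n + 1\<close>, move \<open>V*\<^sup>n\<^sup>+\<^sup>1\<close> past \<open>V1\<close>, which leaves \<open>q\<^sup>n V2* y\<close> with
  \<open>y = V*\<^sup>n x\<close>; then \<open>G V2* y\<close> splits into the contributions of \<open>G V* y\<close> and \<open>G y\<close>.  The argument for
  \<open>V2\<close> is the same with \<open>cnj q\<close> and \<open>V1*\<close>.\<close>

lemma wold_V1: "wold (V1 x) = hardy_V1 q wandering P U (wold x)"
proof (rule hardy_eqI, rule ext)
  fix n
  have G_V1: "G (V1 y) = V1 (y - V2 (V2s y))" for y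
    by (simp add: G_def Vs_eq lins words)
  have G_V2s: "G (V2s y) = q *\<^sub>C V1 (Vs y - V2 (V2s (Vs y))) + (V2s y - q *\<^sub>C V1 (Vs y))" for y
    by (simp add: G_def Vs_eq lins words qq scaleC_diff_right)
  show "hardy_coeff (wold (V1 x)) n = hardy_coeff (hardy_V1 q wandering P U (wold x)) n"
    unfolding hardy_coeff_V1[OF q closed_csubspace_wandering P_orth_projection U_unitary wold_in_hardy_space]
      hardy_coeff_wold Us_complement_G Us_P_G
  proof (cases n)
    case 0
    then show "G ((Vs ^^ n) (V1 x)) = q ^ n *\<^sub>C V1 ((Vs ^^ n) x - V2 (V2s ((Vs ^^ n) x))) +
        (case n of 0 \<Rightarrow> 0 | Suc k \<Rightarrow> q ^ k *\<^sub>C (V2s ((Vs ^^ k) x) - q *\<^sub>C V1 (Vs ((Vs ^^ k) x))))"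
      by (simp add: G_V1)
  next
    case (Suc k)
    then show "G ((Vs ^^ n) (V1 x)) = q ^ n *\<^sub>C V1 ((Vs ^^ n) x - V2 (V2s ((Vs ^^ n) x))) +
        (case n of 0 \<Rightarrow> 0 | Suc k \<Rightarrow> q ^ k *\<^sub>C (V2s ((Vs ^^ k) x) - q *\<^sub>C V1 (Vs ((Vs ^^ k) x))))"
      by (simp only: funpow_rules bounded_clinearD(5)[OF bounded_clinear_G] G_V2s)
        (simp add: scaleC_add_right mult.commute)
  qed
qed

lemma wold_V2: "wold (V2 x) = hardy_V2 q P U (wold x)"
proof (rule hardy_eqI, rule ext)
  fix n
  have G_V2: "G (V2 y) = V2 (y - V1 (V1s y))" for y
    by (simp add: G_def Vs_eq lins words)
  have G_V1s: "G (V1s y) = V2 (Vs y - V1 (V1s (Vs y))) + (V1s y - V2 (Vs y))" for y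
    by (simp add: G_def Vs_eq lins words qq)
  show "hardy_coeff (wold (V2 x)) n = hardy_coeff (hardy_V2 q P U (wold x)) n"
    unfolding hardy_coeff_V2[OF q closed_csubspace_wandering P_orth_projection U_unitary wold_in_hardy_space]
      hardy_coeff_wold U_G_complement unfolding P_U_G
  proof (cases n)
    case 0
    then show "G ((Vs ^^ n) (V2 x)) = cnj q ^ n *\<^sub>C V2 ((Vs ^^ n) x - V1 (V1s ((Vs ^^ n) x))) +
        (case n of 0 \<Rightarrow> 0 | Suc k \<Rightarrow> cnj q ^ Suc k *\<^sub>C (V1s ((Vs ^^ k) x) - V2 (Vs ((Vs ^^ k) x))))"
      by (simp add: G_V2)
  next
    case (Suc k)
    then show "G ((Vs ^^ n) (V2 x)) = cnj q ^ n *\<^sub>C V2 ((Vs ^^ n) x - V1 (V1s ((Vs ^^ n) x))) +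
        (case n of 0 \<Rightarrow> 0 | Suc k \<Rightarrow> cnj q ^ Suc k *\<^sub>C (V1s ((Vs ^^ k) x) - V2 (Vs ((Vs ^^ k) x))))"
      by (simp only: funpow_rules bounded_clinearD(5)[OF bounded_clinear_G] G_V1s)
        (simp add: scaleC_add_right mult.commute)
  qed
qed

end

section \<open>The converse direction\<close>

text \<open>The inner products of \<open>V\<^sup>m u h\<close> and \<open>V\<^sup>n u k\<close> are determined by those of the \<open>u h\<close>, because
  \<open>V\<close> is an isometry and \<open>V*\<close> acts on the family \<open>u\<close>.\<close>

lemma orbit_cinner:
  fixes V :: "'k::chilbert_space \<Rightarrow> 'k" and u :: "'h \<Rightarrow> 'k"
  assumes V: "isometry_into UNIV UNIV V" and S: "\<And>h. cadj V (u h) = u (S h)"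
  shows "cinner ((V ^^ (n + j)) (u h)) ((V ^^ n) (u k)) = cinner (u h) (u ((S ^^ j) k))"
proof -
  have "cinner ((V ^^ n) x) ((V ^^ n) y) = cinner x y" for x y
    by (induction n) (simp_all add: isometry_cinner[OF V closed_csubspace_UNIV])
  moreover have "(cadj V ^^ j) (u k) = u ((S ^^ j) k)"
    by (induction j) (simp_all add: S)
  ultimately show ?thesis
    by (simp add: funpow_add cinner_funpow_cadj[OF contractionD(1)[OF isometry_UNIV(1)[OF V]]])
qed

lemma isometry_comp:
  "isometry_into UNIV UNIV A \<Longrightarrow> isometry_into UNIV UNIV B \<Longrightarrow> isometry_into UNIV UNIV (A \<circ> B)"
  by (simp add: isometry_into_def clinear_on_def)

lemma orbit_gram_eq:
  fixes V :: "'k::chilbert_space \<Rightarrow> 'k" and W :: "'w::chilbert_space \<Rightarrow> 'w"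
    and u :: "'h \<Rightarrow> 'k" and e :: "'h \<Rightarrow> 'w"
  assumes V: "isometry_into UNIV UNIV V" "\<And>h. cadj V (u h) = u (S h)"
    and W: "isometry_into UNIV UNIV W" "\<And>h. cadj W (e h) = e (S h)"
    and gram: "\<And>h k. cinner (u h) (u k) = cinner (e h) (e k)"
  shows "cinner ((V ^^ m) (u h)) ((V ^^ n) (u k)) = cinner ((W ^^ m) (e h)) ((W ^^ n) (e k))"
proof -
  have *: "cinner ((V ^^ (n + j)) (u h)) ((V ^^ n) (u k)) = cinner ((W ^^ (n + j)) (e h)) ((W ^^ n) (e k))" for n j h k
    using orbit_cinner[where u = u and S = S, OF V, of n j h k]
      orbit_cinner[where u = e and S = S, OF W, of n j h k] gram by simp
  show ?thesis
  proof (cases "n \<le> m")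
    case True
    then show ?thesis using *[of n "m - n" h k] by simp
  next
    case False
    then show ?thesis using *[of m "n - m" k h] by (metis cinner_commute le_add_diff_inverse nat_le_linear)
  qed
qed

text \<open>On vectors of the form \<open>V\<^sup>n u h\<close>, the operators \<open>V1\<close> and \<open>V2\<close> are expressed by \<open>V\<close> and an action
  on the index: \<open>V1 u h = V1 V2 V2* u h = V u (S2 h)\<close>, and similarly for \<open>V2\<close>.\<close>

lemma unitary_orbit:
  fixes V1 V2 :: "'k::chilbert_space \<Rightarrow> 'k" and u :: "'h \<Rightarrow> 'k"
  assumes V1: "bounded_clinear V1" and V2: "bounded_clinear V2" and q: "cmod q = 1"
    and comm: "\<And>x. V1 (V2 x) = q *\<^sub>C V2 (V1 x)"
    and S: "\<And>h. V1 (u (S1 h)) = u h" "\<And>h. V2 (u (S2 h)) = u h"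
  shows "V1 (((V1 \<circ> V2) ^^ n) (u h)) = q ^ n *\<^sub>C ((V1 \<circ> V2) ^^ Suc n) (u (S2 h))"
    "V2 (((V1 \<circ> V2) ^^ n) (u h)) = cnj q ^ Suc n *\<^sub>C ((V1 \<circ> V2) ^^ Suc n) (u (S1 h))"
proof -
  define V where "V = V1 \<circ> V2"
  note L1 = bounded_clinearD[OF V1] and L2 = bounded_clinearD[OF V2]
  have V: "V x = V1 (V2 x)" for x by (simp add: V_def)
  have bV: "bounded_clinear V"
    unfolding V_def comp_def by (rule bounded_clinear_compose[OF V1 V2])
  note LV = bounded_clinearD(5)[OF bV]
  have qq: "cnj q * q = 1" "q * cnj q = 1"
    using q by (simp_all add: complex_norm_square[symmetric] mult.commute)
  have c2: "V2 (V1 x) = cnj q *\<^sub>C V x" for x unfolding V comm by (simp add: qq)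
  have "V1 ((V ^^ n) x) = q ^ n *\<^sub>C (V ^^ n) (V1 x)" for x
  proof (induction n)
    case (Suc n)
    have "V1 (V y) = q *\<^sub>C V (V1 y)" for y by (simp add: V c2 L1 qq)
    then show ?case by (simp add: Suc LV mult.commute)
  qed simp
  moreover have "V1 (u h) = V (u (S2 h))" by (simp add: V S)
  ultimately have "V1 ((V ^^ n) (u h)) = q ^ n *\<^sub>C (V ^^ Suc n) (u (S2 h))"
    by (simp add: funpow_swap1)
  then show "V1 (((V1 \<circ> V2) ^^ n) (u h)) = q ^ n *\<^sub>C ((V1 \<circ> V2) ^^ Suc n) (u (S2 h))"
    by (simp only: V_def)
  have "V2 ((V ^^ n) x) = cnj q ^ n *\<^sub>C (V ^^ n) (V2 x)" for x
  proof (induction n)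
    case (Suc n)
    have "V2 (V y) = cnj q *\<^sub>C V (V2 y)" for y unfolding V[of y] c2 ..
    then show ?case by (simp add: Suc LV mult.commute)
  qed simp
  moreover have "V2 (u h) = cnj q *\<^sub>C V (u (S1 h))" unfolding c2[symmetric] S ..
  ultimately have "V2 ((V ^^ n) (u h)) = cnj q ^ Suc n *\<^sub>C (V ^^ Suc n) (u (S1 h))"
    by (simp add: funpow_swap1 bounded_clinear_funpow(3)[OF bV] mult.commute)
  then show "V2 (((V1 \<circ> V2) ^^ n) (u h)) = cnj q ^ Suc n *\<^sub>C ((V1 \<circ> V2) ^^ Suc n) (u (S1 h))"
    by (simp only: V_def)
qed

text \<open>The equivalence is \<open>x \<mapsto> (wold x, \<tau> (E x))\<close>, where \<open>\<tau>\<close> is the unitary between the unitary parts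
  given by the Gram matrices of the orbits of \<open>E (Emb h)\<close> and \<open>\<iota> (Q h)\<close>.\<close>

theorem minimal_lift_model:
  fixes T1 T2 :: "'h::chilbert_space \<Rightarrow> 'h" and \<iota> :: "'h \<Rightarrow> 'w::chilbert_space"
    and V1 V2 :: "'k::chilbert_space \<Rightarrow> 'k"
  assumes q: "cmod q = 1" and T: "contraction T1" "contraction T2" and qT: "q_commuting_on q UNIV T1 T2"
    and can: "canonical_unitary_pair q T1 T2 \<iota> W1 W2"
    and lift: "q_isometric_lift q T1 T2 UNIV V1 V2 Emb" and min: "minimal_lift UNIV V1 V2 Emb"
  shows "\<exists>(F :: 'k set) \<Lambda> P U. ando_tuple T1 T2 F \<Lambda> P U \<and>
    (\<exists>\<Phi>. unitary_onto UNIV (hardy_space F \<times> UNIV) \<Phi> \<and>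
      (\<forall>x. \<Phi> (V1 x) = model_V1 q F P U W1 (\<Phi> x)) \<and>
      (\<forall>x. \<Phi> (V2 x) = model_V2 q P U W2 (\<Phi> x)) \<and>
      (\<forall>h. \<Phi> (Emb h) = model_embedding (T1 \<circ> T2) \<Lambda> \<iota> h))"
proof -
  have V: "isometry_into UNIV UNIV V1" "isometry_into UNIV UNIV V2"
    and comm: "\<And>x. V1 (V2 x) = q *\<^sub>C V2 (V1 x)" and Emb: "isometry_into UNIV UNIV Emb"
    and adjEmb: "\<And>h. cadj V1 (Emb h) = Emb (cadj T1 h)" "\<And>h. cadj V2 (Emb h) = Emb (cadj T2 h)"
    using lift by (auto simp: q_isometric_lift_def q_commuting_on_def)
  interpret pair: q_isometric_pair q V1 V2
    by unfold_locales (fact q V comm)+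
  note pair.V_apply [simp del]
  define Ts where "Ts = cadj (T1 \<circ> T2)"
  define W where "W = W1 \<circ> W2"
  define e where "e = (\<lambda>h. \<iota> (Q_star (T1 \<circ> T2) h))"
  define u where "u = (\<lambda>h. pair.E (Emb h))"
  note cT = contraction_comp[OF T]
  note can' = canonical_unitary_pairD[OF T can q, folded e_def[THEN fun_cong]]
  note isoW = unitary_isometry[OF can'(1)] unitary_isometry[OF can'(2)]
  note linW = contractionD(1)[OF isometry_UNIV(1)[OF isoW(1)]] contractionD(1)[OF isometry_UNIV(1)[OF isoW(2)]]
  note linV = contractionD(1)[OF pair.contractions(1)] contractionD(1)[OF pair.contractions(2)]
  note linEmb = bounded_clinearD[OF contractionD(1)[OF isometry_UNIV(1)[OF Emb]]]
  have commW: "W1 (W2 x) = q *\<^sub>C W2 (W1 x)" for x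
    using can'(3) by (simp add: q_commuting_on_def)
  have Ts_eq: "cadj T2 (cadj T1 h) = Ts h" for h
    unfolding Ts_def by (rule cadj_q_commuting(2)[OF contractionD(1)[OF T(1)] contractionD(1)[OF T(2)] qT q])
  have Vs_Emb: "pair.Vs (Emb h) = Emb (Ts h)" for h
    by (simp add: pair.Vs_eq adjEmb Ts_eq)
  have Vs_Emb_pow: "(pair.Vs ^^ n) (Emb h) = Emb ((Ts ^^ n) h)" for n h
    by (induction n) (simp_all add: Vs_Emb)

  \<comment> \<open>the unitary parts of both sides are generated by the vectors \<open>u h\<close> and \<open>e h\<close>\<close>
  have u_lin: "u (h + k) = u h + u k" "u (c *\<^sub>C h) = c *\<^sub>C u h" for h k c
    by (simp_all add: u_def pair.E_lin linEmb)
  have "norm (u h) = norm (e h)" for h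
  proof -
    have "(\<lambda>n. (norm ((Ts ^^ n) h))\<^sup>2) \<longlonglongrightarrow> (norm (u h))\<^sup>2"
      using pair.norm_E_LIMSEQ[of "Emb h"] by (simp add: Vs_Emb_pow u_def isometry_UNIV(2)[OF Emb])
    then have "(norm (u h))\<^sup>2 = (norm (Q_star (T1 \<circ> T2) h))\<^sup>2"
      unfolding Ts_def using norm_Q_star_LIMSEQ[OF cT] LIMSEQ_unique by blast
    then show ?thesis by (simp add: can'(6))
  qed
  then have gram: "cinner (u h) (u k) = cinner (e h) (e k)" for h k
    by (intro cinner_eq_of_norm_eq) (simp flip: u_lin can'(4,5))
  have isoV: "isometry_into UNIV UNIV pair.V" and isoW12: "isometry_into UNIV UNIV W"
    unfolding pair.V_def W_def by (intro isometry_comp V isoW)+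
  have adju: "cadj V1 (u h) = u (cadj T1 h)" "cadj V2 (u h) = u (cadj T2 h)" "pair.Vs (u h) = u (Ts h)" for h
    by (simp_all add: u_def pair.E_Vs[symmetric] adjEmb pair.Vs_E Vs_Emb)
  have adje: "cadj W (e h) = e (Ts h)" for h
    by (simp add: W_def cadj_comp[OF linW] can'(7,8) Ts_eq)
  have gram': "cinner ((pair.V ^^ m) (u h)) ((pair.V ^^ n) (u k)) = cinner ((W ^^ m) (e h)) ((W ^^ n) (e k))" for m n h k
    by (rule orbit_gram_eq[where u = u and e = e and S = Ts, OF isoV adju(3) isoW12 adje gram])
  define a where "a = (\<lambda>(n, h). (pair.V ^^ n) (u h))"
  define b where "b = (\<lambda>(n, h). (W ^^ n) (e h))"
  define M where "M = closed_csubspace hull range a"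
  have M: "closed_csubspace M" unfolding M_def by (rule closed_csubspace_hull)
  have "range b = {(W ^^ n) (e h) | n h. True}" by (auto simp: b_def)
  then have hull_b: "closed_csubspace hull range b = UNIV"
    using can'(9) by (simp add: W_def)
  have "\<exists>\<tau>. unitary_onto M UNIV \<tau> \<and> (\<forall>i. \<tau> (a i) = b i)"
    unfolding M_def hull_b[symmetric]
    by (rule unitary_of_gram) (auto simp: a_def b_def gram')
  then obtain \<tau> where \<tau>: "unitary_onto M UNIV \<tau>" "\<And>i. \<tau> (a i) = b i" by blast
  note iso\<tau> = unitary_isometry[OF \<tau>(1)]
  note \<tau>lin = contraction_onD[OF contraction_on_isometry[OF iso\<tau>] M]
  have aM: "a i \<in> M" for i unfolding M_def by (rule subsetD[OF hull_subset rangeI])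
  have uS: "V1 (u (cadj T1 h)) = u h" "V2 (u (cadj T2 h)) = u h" for h
    unfolding adju[symmetric] by (simp_all add: u_def pair.V_unitary_on_E)
  have eS: "W1 (e (cadj T1 h)) = e h" "W2 (e (cadj T2 h)) = e h" for h
    unfolding can'(7,8)[symmetric] by (simp_all add: unitary_cadj can'(1,2))
  note Va = unitary_orbit[where u = u and ?S1.0 = "cadj T1" and ?S2.0 = "cadj T2", OF linV q comm uS, folded pair.V_def]
  note Wb = unitary_orbit[where u = e and ?S1.0 = "cadj T1" and ?S2.0 = "cadj T2", OF linW q commW eS, folded W_def]
  have Va': "V1 (a (n, h)) = q ^ n *\<^sub>C a (Suc n, cadj T2 h)"
    "V2 (a (n, h)) = cnj q ^ Suc n *\<^sub>C a (Suc n, cadj T1 h)" for n h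
    by (simp_all only: a_def prod.case Va)
  have Wb': "W1 (b (n, h)) = q ^ n *\<^sub>C b (Suc n, cadj T2 h)"
    "W2 (b (n, h)) = cnj q ^ Suc n *\<^sub>C b (Suc n, cadj T1 h)" for n h
    by (simp_all only: b_def prod.case Wb)
  have inv: "V1 ` M \<subseteq> M" "V2 ` M \<subseteq> M"
  proof -
    have "M \<subseteq> {x. V1 x \<in> M}" "M \<subseteq> {x. V2 x \<in> M}"
      unfolding M_def
      by (intro closed_csubspace_hull_least closed_csubspace_vimage linV closed_csubspace_hull;
          auto simp: Va' simp flip: M_def intro!: closed_csubspaceD(4)[OF M] aM)+
    then show "V1 ` M \<subseteq> M" "V2 ` M \<subseteq> M" by auto
  qed
  have \<tau>V: "\<tau> (V1 x) = W1 (\<tau> x)" "\<tau> (V2 x) = W2 (\<tau> x)" if "x \<in> M" for x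
  proof -
    note c\<tau> = contraction_on_isometry[OF iso\<tau>]
    note comp = contraction_on_comp[OF contraction_on_contraction inv(1) c\<tau>, OF pair.contractions(1)]
      contraction_on_comp[OF contraction_on_contraction inv(2) c\<tau>, OF pair.contractions(2)]
      contraction_on_comp[OF c\<tau> subset_UNIV contraction_on_contraction, OF isometry_UNIV(1)[OF isoW(1)]]
      contraction_on_comp[OF c\<tau> subset_UNIV contraction_on_contraction, OF isometry_UNIV(1)[OF isoW(2)]]
    show "\<tau> (V1 x) = W1 (\<tau> x)"
      by (rule eq_on_hull[OF comp(1) comp(3) M_def _ that]) (auto simp: Va' Wb' \<tau> \<tau>lin aM)
    show "\<tau> (V2 x) = W2 (\<tau> x)"
      by (rule eq_on_hull[OF comp(2) comp(4) M_def _ that]) (auto simp: Va' Wb' \<tau> \<tau>lin aM)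
  qed

  \<comment> \<open>minimality makes these vectors generate the whole unitary part\<close>
  have E_M: "pair.E x \<in> M" for x
  proof -
    have bE: "bounded_clinear pair.E"
      by (rule contractionD(1)[OF contraction_power_limit[OF pair.contractions(3)]])
    have "u h \<in> M" for h using aM[of "(0, h)"] by (simp add: a_def)
    then have "(V2 ^^ n) (u h) \<in> M" for n h by (induction n) (use inv in auto)
    then have *: "(V1 ^^ m) ((V2 ^^ n) (u h)) \<in> M" for m n h by (induction m) (use inv in auto)
    have "pair.E ((V2 ^^ n) x) = (V2 ^^ n) (pair.E x)" "pair.E ((V1 ^^ n) x) = (V1 ^^ n) (pair.E x)" for n x
      by (induction n) (simp_all add: pair.E_V)
    then have "pair.E ((V1 ^^ m) ((V2 ^^ n) (Emb h))) \<in> M" for m n h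
      using * by (simp add: u_def)
    then have "closed_csubspace hull {(V1 ^^ m) ((V2 ^^ n) (Emb h)) | m n h. True} \<subseteq> {x. pair.E x \<in> M}"
      by (intro closed_csubspace_hull_least closed_csubspace_vimage bE M) auto
    then show ?thesis using min unfolding minimal_lift_def by blast
  qed
  have M_E: "pair.E x = x" if "x \<in> M" for x
  proof -
    have "M \<subseteq> {x. pair.E x = x}"
      unfolding M_def
    proof (rule closed_csubspace_hull_least)
      show "closed_csubspace {x. pair.E x = x}"
        by (rule closed_csubspace_Collect_eq[OF contractionD(1)[OF contraction_power_limit[OF pair.contractions(3)]]
              bounded_clinear_ident(1)])
      have "pair.E ((pair.V ^^ n) x) = (pair.V ^^ n) (pair.E x)" for n x
        by (induction n) (simp_all add: pair.V_E[symmetric])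
      then show "range a \<subseteq> {x. pair.E x = x}"
        by (auto simp: a_def u_def pair.E_idem)
    qed
    then show ?thesis using that by blast
  qed

  \<comment> \<open>\<open>\<Lambda>\<close> carries \<open>D h\<close> to the wandering part of the embedded \<open>h\<close>, which has the same norm\<close>
  have cTs: "contraction Ts" unfolding Ts_def by (rule contraction_cadj[OF cT])
  note bD = positive_opD(1)[OF positive_op_defect_op[OF cTs]]
  note Dlin = bounded_clinearD[OF bD] and Glin = bounded_clinearD[OF pair.bounded_clinear_G]
  have "norm (defect Ts h) = norm (pair.G (Emb h))" for h
  proof -
    have "(norm (defect Ts h))\<^sup>2 = (norm (pair.G (Emb h)))\<^sup>2"
      by (simp add: norm_defect[OF cTs] pair.norm_G Vs_Emb isometry_UNIV(2)[OF Emb])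
    then show ?thesis by simp
  qed
  then have "cinner (defect Ts h) (defect Ts k) = cinner (pair.G (Emb h)) (pair.G (Emb k))" for h k
    by (intro cinner_eq_of_norm_eq) (simp flip: Dlin(2,5) Glin(2,5) linEmb(2,5))
  from unitary_of_gram[where a = "defect Ts" and b = "\<lambda>h. pair.G (Emb h)", OF this] obtain \<Lambda> where
    \<Lambda>: "unitary_onto (closed_csubspace hull range (defect Ts)) (closed_csubspace hull range (\<lambda>h. pair.G (Emb h))) \<Lambda>"
      "\<And>h. \<Lambda> (defect Ts h) = pair.G (Emb h)" by blast
  have "closed_csubspace hull range (\<lambda>h. pair.G (Emb h)) \<subseteq> pair.wandering"
    by (rule closed_csubspace_hull_least[OF pair.closed_csubspace_wandering]) (auto intro: pair.G_in_wandering)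
  then have iso\<Lambda>: "isometry_into (defect_space Ts) pair.wandering \<Lambda>"
    using unitary_isometry[OF \<Lambda>(1)] unfolding isometry_into_def defect_space_def hull_range_eq_closure[OF bD] by blast
  have ando: "ando_tuple T1 T2 pair.wandering \<Lambda> pair.P pair.U"
    unfolding ando_tuple_def
    using pair.closed_csubspace_wandering iso\<Lambda> pair.P_orth_projection pair.U_unitary unfolding Ts_def by blast

  define \<Phi> where "\<Phi> = (\<lambda>x. (pair.wold x, \<tau> (pair.E x)))"
  note wlin = bounded_clinearD[OF pair.bounded_clinear_wold]
  have "unitary_onto UNIV (hardy_space pair.wandering \<times> UNIV) \<Phi>"
    unfolding unitary_onto_def isometry_into_def clinear_on_def
  proof (intro conjI ballI allI)
    show "\<Phi> (x + y) = \<Phi> x + \<Phi> y" "\<Phi> (c *\<^sub>C x) = c *\<^sub>C \<Phi> x" for x y c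
      by (simp_all add: \<Phi>_def wlin pair.E_lin \<tau>lin E_M scaleC_prod_def)
    show "\<Phi> ` UNIV \<subseteq> hardy_space pair.wandering \<times> UNIV"
      by (auto simp: \<Phi>_def pair.wold_in_hardy_space)
    show "norm (\<Phi> x) = norm x" for x
    proof -
      have "norm (\<tau> (pair.E x)) = norm (pair.E x)" using iso\<tau> E_M by (simp add: isometry_into_def)
      then have "(norm (\<Phi> x))\<^sup>2 = (norm x)\<^sup>2" by (simp add: \<Phi>_def norm_Pair pair.norm_wold)
      then show ?thesis by simp
    qed
    show "\<Phi> ` UNIV = hardy_space pair.wandering \<times> UNIV"
    proof
      show "hardy_space pair.wandering \<times> UNIV \<subseteq> \<Phi> ` UNIV"
      proof
        fix p :: "'k hardy \<times> 'w" assume "p \<in> hardy_space pair.wandering \<times> UNIV"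
        then obtain f w where p: "p = (f, w)" "f \<in> hardy_space pair.wandering" by auto
        obtain y where y: "y \<in> M" "\<tau> y = w" using \<tau>(1) by (metis UNIV_I imageE unitary_onto_def)
        have "pair.wold y = 0" using pair.wold_E[of y] M_E[OF y(1)] by simp
        then have "\<Phi> (cadj pair.wold f + y) = p"
          by (simp add: \<Phi>_def p wlin pair.E_lin pair.wold_surj M_E y)
        then show "p \<in> \<Phi> ` UNIV" by blast
      qed
    qed (auto simp: \<Phi>_def pair.wold_in_hardy_space)
  qed
  moreover have "\<Phi> (V1 x) = model_V1 q pair.wandering pair.P pair.U W1 (\<Phi> x)" for x
    by (simp add: \<Phi>_def model_V_hardy pair.wold_V1 pair.E_V \<tau>V E_M)
  moreover have "\<Phi> (V2 x) = model_V2 q pair.P pair.U W2 (\<Phi> x)" for x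
    by (simp add: \<Phi>_def model_V_hardy pair.wold_V2 pair.E_V \<tau>V E_M)
  moreover have "\<Phi> (Emb h) = model_embedding (T1 \<circ> T2) \<Lambda> \<iota> h" for h
  proof (rule prod_eqI)
    note cE = hardy_coeff_model_embedding(1,2)[OF cT iso\<Lambda>[unfolded Ts_def], folded Ts_def]
    show "fst (\<Phi> (Emb h)) = fst (model_embedding (T1 \<circ> T2) \<Lambda> \<iota> h)"
      by (rule hardy_eqI, rule ext) (simp only: cE \<Phi>_def fst_conv pair.hardy_coeff_wold Vs_Emb_pow \<Lambda>(2))
    have "\<tau> (u h) = e h" using \<tau>(2)[of "(0, h)"] by (simp add: a_def b_def)
    then show "snd (\<Phi> (Emb h)) = snd (model_embedding (T1 \<circ> T2) \<Lambda> \<iota> h)"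
      by (simp only: cE \<Phi>_def snd_conv u_def e_def)
  qed
  ultimately show ?thesis using ando by blast
qed

theorem theorem4p5:
  fixes q :: complex
    and T1 T2 :: "'h::chilbert_space \<Rightarrow> 'h"
    and \<iota> :: "'h \<Rightarrow> 'w::chilbert_space"
    and W1 W2 :: "'w \<Rightarrow> 'w"
  assumes "cmod q = 1"
    and "contraction T1" and "contraction T2"
    and "q_commuting_on q UNIV T1 T2"
    and "canonical_unitary_pair q T1 T2 \<iota> W1 W2"
  shows
    "(\<forall>F \<Lambda> P U. special_ando_tuple T1 T2 F \<Lambda> P U \<longrightarrow>
        isometry_into UNIV (hardy_space F \<times> UNIV) (model_embedding (T1 \<circ> T2) \<Lambda> \<iota>) \<and>
        q_isometric_lift q T1 T2 (hardy_space F \<times> UNIV)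
          (model_V1 q F P U W1) (model_V2 q P U W2) (model_embedding (T1 \<circ> T2) \<Lambda> \<iota>)) \<and>
     (\<forall>V1 V2 (Emb :: 'h \<Rightarrow> 'k::chilbert_space).
        q_isometric_lift q T1 T2 UNIV V1 V2 Emb \<and> minimal_lift UNIV V1 V2 Emb \<longrightarrow>
        (\<exists>(F :: 'k set) \<Lambda> P U. ando_tuple T1 T2 F \<Lambda> P U \<and>
          (\<exists>\<Phi>. unitary_onto UNIV (hardy_space F \<times> UNIV) \<Phi> \<and>
             (\<forall>x. \<Phi> (V1 x) = model_V1 q F P U W1 (\<Phi> x)) \<and>
             (\<forall>x. \<Phi> (V2 x) = model_V2 q P U W2 (\<Phi> x)) \<and>
             (\<forall>h. \<Phi> (Emb h) = model_embedding (T1 \<circ> T2) \<Lambda> \<iota> h))))"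
proof (intro conjI allI impI)
  fix F \<Lambda> P U assume "special_ando_tuple T1 T2 F \<Lambda> P U"
  then show lift: "q_isometric_lift q T1 T2 (hardy_space F \<times> UNIV)
      (model_V1 q F P U W1) (model_V2 q P U W2) (model_embedding (T1 \<circ> T2) \<Lambda> \<iota>)"
    by (rule special_tuple_model_lift[OF assms])
  then show "isometry_into UNIV (hardy_space F \<times> UNIV) (model_embedding (T1 \<circ> T2) \<Lambda> \<iota>)"
    by (simp only: q_isometric_lift_def)
next
  fix V1 V2 and Emb :: "'h \<Rightarrow> 'k"
  assume "q_isometric_lift q T1 T2 UNIV V1 V2 Emb \<and> minimal_lift UNIV V1 V2 Emb"
  then show "\<exists>(F :: 'k set) \<Lambda> P U. ando_tuple T1 T2 F \<Lambda> P U \<and>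
      (\<exists>\<Phi>. unitary_onto UNIV (hardy_space F \<times> UNIV) \<Phi> \<and>
         (\<forall>x. \<Phi> (V1 x) = model_V1 q F P U W1 (\<Phi> x)) \<and>
         (\<forall>x. \<Phi> (V2 x) = model_V2 q P U W2 (\<Phi> x)) \<and>
         (\<forall>h. \<Phi> (Emb h) = model_embedding (T1 \<circ> T2) \<Lambda> \<iota> h))"
    by (elim conjE) (rule minimal_lift_model[OF assms])
qed

end
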